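(* Let $\mathcal Y$ be the algebraic curve over $\mathbb F_q$ defined by $y^m=f(x)$, where $m\ge 2$, $\operatorname{char}(\mathbb F_q)\nmid m$, and $f(x)\in\mathbb F_q[x]$ is a separable polynomial of degree $n$ with $2\le n\le q$, $\gcd(m,n)=1$, all of whose roots lie in $\mathbb F_q$. Let $Q_0$ be the only place at infinity of $\mathbb F_q(\mathcal Y)$ and let $Q_1,\dots,Q_n$ be all the rational places of $\mathbb F_q(\mathcal Y)$ corresponding to the zeros of $f(x)$. Let $D$ be a divisor of $\mathbb F_q(\mathcal Y)$ with support contained in $\{Q_0,Q_1,\dots,Q_n\}$. Then $D$ is a non-special divisor of degree $g(\mathcal Y)-1$ if and only if there exist an integer $0\le\alpha_0\le m-1$, a tuple $(j_0,\dots,j_n)\in\mathbb Z^{n+1}$ with $\sum_{k=0}^nj_k=-1$, and a permutation $\sigma$ of $\{1,\dots,n\}$ such that $$D=\sum_{k=0}^{n}mj_kQ_k+\alpha_0Q_0+\sum_{k=1}^n\alpha_{\sigma(k)}Q_k,$$ where $(\alpha_1,\dots,\alpha_n)$ is the non-decreasing $n$-tuple with entries in $\{0,1,\dots,m-1\}$ in which the value $0$ occurs exactly $\left\lfloor\frac{\alpha_0+n}{m}\right\rfloor$ times, the value $i$ occurs exactly $\left\lfloor\frac{\alpha_0+(i+1)n}{m}\right\rfloor-\left\lfloor\frac{\alpha_0+in}{m}\right\rfloor$ times for each $1\le i\le m-2$, and the value $m-1$ occurs exactly $\left\lceil\frac{n-\alpha_0}{m}\right\rceil$ times. In particular, if $n<m$,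 then a divisor $D$ with support contained in $\{Q_0,\dots,Q_n\}$ is non-special of degree $g(\mathcal Y)-1$ if and only if $$D=\sum_{k=0}^{n}mj_kQ_k+\alpha_0Q_0+\sum_{k=1}^{n}\left(\left\lceil\frac{km-\alpha_0}{n}\right\rceil-1\right)Q_{\sigma(k)}$$ for some $0\le\alpha_0\le m-1$, some $(j_0,\dots,j_n)\in\mathbb Z^{n+1}$ with $\sum_{k=0}^{n}j_k=-1$, and some permutation $\sigma$ of $\{1,\dots,n\}$.
   Context: $\mathbb F_q$ is the finite field with $q$ elements and $g(\mathcal Y)$ is the genus of the function field $\mathbb F_q(\mathcal Y)=\mathbb F_q(x,y)$. A divisor $G$ of a function field of genus $g$ is non-special if $\ell(G)=\deg(G)+1-g$, where $\ell(G)$ is the dimension of the Riemann-Roch space $\mathcal L(G)$. *)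

theory Defs
  imports Complex_Main "HOL-Library.Cardinality" "HOL-Library.Poly_Mapping" "HOL-Combinatorics.Permutations"
    "HOL-Computational_Algebra.Computational_Algebra"
begin

text \<open>
  An extension \<open>F/K\<close> of fields is given by two types of sort field and an embedding
  \<open>emb :: 'k \<Rightarrow> 'a\<close>, so that \<open>K\<close> is \<open>range emb\<close> and \<open>F\<close> is all of \<open>'a\<close>.
  Places, valuations, divisors, Riemann--Roch spaces and the genus follow Stichtenoth,
  \<open>Algebraic Function Fields and Codes\<close>, Chapter 1.
\<close>

definition field_embedding :: "('k::field \<Rightarrow> 'a::field) \<Rightarrow> bool" where
  "field_embedding emb \<longleftrightarrow> emb 1 = 1 \<and>
     (\<forall>a b. emb (a + b) = emb a + emb b) \<and> (\<forall>a b. emb (a * b) = emb a * emb b)"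

definition eval1 :: "('k::field \<Rightarrow> 'a::field) \<Rightarrow> 'a \<Rightarrow> 'k poly \<Rightarrow> 'a" where
  "eval1 emb x p = poly (map_poly emb p) x"

text \<open>A polynomial in two variables is an element of \<open>K[X][Y]\<close>.\<close>

definition eval2 :: "('k::field \<Rightarrow> 'a::field) \<Rightarrow> 'a \<Rightarrow> 'a \<Rightarrow> 'k poly poly \<Rightarrow> 'a" where
  "eval2 emb x y p = poly (map_poly (eval1 emb x) p) y"

text \<open>
  \<open>F\<close> is the function field \<open>K(x,y)\<close> of the curve \<open>y^m = f(x)\<close>.  It is determined up to
  isomorphism over \<open>K\<close> by these conditions as soon as \<open>Y^m - f(X)\<close> is irreducible, in particular
  whenever \<open>m\<close> and the degree of \<open>f\<close> are coprime and positive.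
\<close>

definition is_function_field_of_curve ::
  "('k::field \<Rightarrow> 'a::field) \<Rightarrow> 'a \<Rightarrow> 'a \<Rightarrow> nat \<Rightarrow> 'k poly \<Rightarrow> bool" where
  "is_function_field_of_curve emb x y m f \<longleftrightarrow>
     field_embedding emb \<and>
     (\<forall>p. eval1 emb x p = 0 \<longrightarrow> p = 0) \<and>
     y ^ m = eval1 emb x f \<and>
     (\<forall>z. \<exists>p r. eval2 emb x y r \<noteq> 0 \<and> z = eval2 emb x y p / eval2 emb x y r)"

definition valuation_ring :: "('k::field \<Rightarrow> 'a::field) \<Rightarrow> 'a set \<Rightarrow> bool" where
  "valuation_ring emb R \<longleftrightarrow>
     range emb \<subset> R \<and> R \<subset> UNIV \<and>
     (\<forall>a\<in>R. \<forall>b\<in>R. a - b \<in> R \<and> a * b \<in> R) \<and>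
     (\<forall>z. z \<noteq> 0 \<longrightarrow> z \<in> R \<or> inverse z \<in> R)"

text \<open>
  A place is the maximal ideal of a valuation ring \<open>R\<close>; since \<open>R\<close> is local, this
  is the set of non-units of \<open>R\<close>.
\<close>

definition nonunits :: "'a::field set \<Rightarrow> 'a set" where
  "nonunits R = {z \<in> R. z = 0 \<or> inverse z \<notin> R}"

definition places :: "('k::field \<Rightarrow> 'a::field) \<Rightarrow> 'a set set" where
  "places emb = {nonunits R |R. valuation_ring emb R}"

text \<open>The valuation ring \<open>O_P\<close> is recovered from \<open>P\<close>; note that \<open>inverse 0 = 0 \<in> P\<close>.\<close>

definition ring_at :: "'a::field set \<Rightarrow> 'a set" where
  "ring_at P = {z. z = 0 \<or> inverse z \<notin> P}"

definition prime_element :: "'a::field set \<Rightarrow> 'a \<Rightarrow> bool" where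
  "prime_element P t \<longleftrightarrow> t \<in> P \<and> P = (\<lambda>w. t * w) ` ring_at P"

text \<open>
  For \<open>z \<noteq> 0\<close>, the normalized discrete valuation \<open>v_P(z)\<close>: write \<open>z = t^k u\<close> with \<open>t\<close> a
  prime element and \<open>u\<close> a unit.  The value at \<open>z = 0\<close> (which should be \<open>\<infinity>\<close>) is
  meaningless and never used.
\<close>

definition val :: "'a::field set \<Rightarrow> 'a \<Rightarrow> int" where
  "val P z = (THE k. \<exists>t u. prime_element P t \<and> u \<in> ring_at P - P \<and> z = t powi k * u)"

text \<open>
  \<open>B\<close> is a finite set of representatives, one for each basis vector, of a \<open>K\<close>-basis of the
  residue field \<open>O_P/P\<close>.  (Applying independence to \<open>b - b'\<close> shows that different members
  of \<open>B\<close> have different residue classes.)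
\<close>

definition residue_basis :: "('k::field \<Rightarrow> 'a::field) \<Rightarrow> 'a set \<Rightarrow> 'a set \<Rightarrow> bool" where
  "residue_basis emb P B \<longleftrightarrow> finite B \<and> B \<subseteq> ring_at P \<and>
     (\<forall>c. (\<Sum>b\<in>B. emb (c b) * b) \<in> P \<longrightarrow> (\<forall>b\<in>B. c b = 0)) \<and>
     (\<forall>z\<in>ring_at P. \<exists>c. z - (\<Sum>b\<in>B. emb (c b) * b) \<in> P)"

definition place_degree :: "('k::field \<Rightarrow> 'a::field) \<Rightarrow> 'a set \<Rightarrow> nat" where
  "place_degree emb P = (THE d. \<exists>B. residue_basis emb P B \<and> card B = d)"

text \<open>Divisors are the elements of the free abelian group on the places.\<close>

definition divisor :: "('k::field \<Rightarrow> 'a::field) \<Rightarrow> ('a set \<Rightarrow>\<^sub>0 int) \<Rightarrow> bool" where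
  "divisor emb D \<longleftrightarrow> Poly_Mapping.keys D \<subseteq> places emb"

definition div_degree :: "('k::field \<Rightarrow> 'a::field) \<Rightarrow> ('a set \<Rightarrow>\<^sub>0 int) \<Rightarrow> int" where
  "div_degree emb D =
     (\<Sum>P\<in>Poly_Mapping.keys D. Poly_Mapping.lookup D P * int (place_degree emb P))"

definition RR_space :: "('k::field \<Rightarrow> 'a::field) \<Rightarrow> ('a set \<Rightarrow>\<^sub>0 int) \<Rightarrow> 'a set" where
  "RR_space emb D = {z. z = 0 \<or> (\<forall>P\<in>places emb. val P z \<ge> - Poly_Mapping.lookup D P)}"

lemma vector_space_emb:
  "field_embedding emb \<Longrightarrow> vector_space (\<lambda>c z. emb c * z)"
  by unfold_locales (auto simp: field_embedding_def algebra_simps)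

definition ell :: "('k::field \<Rightarrow> 'a::field) \<Rightarrow> ('a set \<Rightarrow>\<^sub>0 int) \<Rightarrow> nat" where
  "ell emb D = vector_space.dim (\<lambda>c z. emb c * z) (RR_space emb D)"

definition genus :: "('k::field \<Rightarrow> 'a::field) \<Rightarrow> int" where
  "genus emb =
     (GREATEST g. \<exists>A. divisor emb A \<and> g = div_degree emb A - int (ell emb A) + 1)"

definition nonspecial :: "('k::field \<Rightarrow> 'a::field) \<Rightarrow> ('a set \<Rightarrow>\<^sub>0 int) \<Rightarrow> bool" where
  "nonspecial emb D \<longleftrightarrow> int (ell emb D) = div_degree emb D + 1 - genus emb"

text \<open>
  \<open>\<alpha> 1, \<dots>, \<alpha> n\<close> is the non-decreasing tuple with entries in \<open>{0,\<dots>,m-1}\<close> and the prescribed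
  multiplicities, which determine it uniquely (values of \<open>\<alpha>\<close> outside \<open>{1..n}\<close> are irrelevant).
\<close>

definition occurrences :: "nat \<Rightarrow> (nat \<Rightarrow> int) \<Rightarrow> int \<Rightarrow> int" where
  "occurrences n \<alpha> i = int (card {k \<in> {1..n}. \<alpha> k = i})"

definition multiplicity_tuple :: "nat \<Rightarrow> nat \<Rightarrow> int \<Rightarrow> (nat \<Rightarrow> int) \<Rightarrow> bool" where
  "multiplicity_tuple m n \<alpha>\<^sub>0 \<alpha> \<longleftrightarrow>
     (\<forall>k\<in>{1..n}. \<alpha> k \<in> {0..int m - 1}) \<and> mono_on {1..n} \<alpha> \<and>
     occurrences n \<alpha> 0 = \<lfloor>(of_int \<alpha>\<^sub>0 + of_nat n) / of_nat m :: real\<rfloor> \<and>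
     (\<forall>i. 1 \<le> i \<and> i \<le> int m - 2 \<longrightarrow>
        occurrences n \<alpha> i =
          \<lfloor>(of_int \<alpha>\<^sub>0 + (of_int i + 1) * of_nat n) / of_nat m :: real\<rfloor>
          - \<lfloor>(of_int \<alpha>\<^sub>0 + of_int i * of_nat n) / of_nat m :: real\<rfloor>) \<and>
     occurrences n \<alpha> (int m - 1) = \<lceil>(of_nat n - of_int \<alpha>\<^sub>0) / of_nat m :: real\<rceil>"

end

theory Submission
  imports Defs
begin

text \<open>
  All dimensions are computed by counting, since \<open>K\<close> is finite.  The places \<open>Q\<^sub>0, Q\<^sub>1, \<dots>, Q\<^sub>n\<close> are
  totally ramified over \<open>K(x)\<close>, and at each of them the terms of \<open>\<Sum>j<m. w\<^sub>j(x) y^j\<close> have distinct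
  valuations.  Hence, for \<open>D\<close> supported on these places, \<open>L(D)\<close> is the direct sum over \<open>j < m\<close> of the
  products of \<open>y^j\<close> with Riemann--Roch spaces of the projective line, the \<open>j\<close>-th of which belongs to
  a divisor of some degree \<open>s\<^sub>j\<close>.  These degrees have sum \<open>deg D - (n + 1)(m - 1) / 2\<close>, so \<open>L(D) = 0\<close> and
  \<open>deg D = g - 1\<close> hold together precisely when every \<open>s\<^sub>j\<close> is \<open>-1\<close>.  Writing the coefficients of \<open>D\<close>
  as \<open>m j\<^sub>k + r\<^sub>k\<close>, this prescribes the number of \<open>k\<close> with \<open>r\<^sub>k < i\<close> for every \<open>i\<close>.

  That the genus is \<open>(m - 1)(n - 1) / 2\<close> needs Riemann's inequality for every divisor.  It follows
  from the functions \<open>x^i y^j\<close> with their only pole at \<open>Q\<^sub>0\<close> and from the bound of the degree of the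
  zeros of a polynomial in \<open>x\<close>.  That nothing but \<open>K[x,y]\<close> is regular away from \<open>Q\<^sub>0\<close> follows from
  Zorn's lemma and a Frobenius argument: powers \<open>L\<close> of the characteristic permute the exponents of \<open>y\<close>
  modulo \<open>m\<close>, so a denominator of \<open>z\<close> would occur in all the functions \<open>z^L\<close> with unbounded order.
\<close>

section \<open>Field extensions and places\<close>

text \<open>The degree of \<open>F\<close> over \<open>K(z)\<close> is never computed. Only upper
  bounds \<open>degree_bound\<close> are obtained, by counting, and with them a bound for the sum of
  \<open>v_P(z) deg P\<close> over zeros of \<open>z\<close>. On the other side
  \<open>y^m = f\<close> and the coprimality of \<open>m\<close> and \<open>n\<close> make
  \<open>m\<close> divide the order of \<open>x\<close> at its pole and of \<open>x - a\<close> at a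
  zero, for a root \<open>a\<close> of \<open>f\<close>. The two bounds meet at \<open>m\<close>:
  ramification is total and the degree is one. That \<open>1, y, ..., y^(m-1)\<close> are
  independent over \<open>K(x)\<close> also comes from valuations, namely from pole orders at
  \<open>Q\<^sub>0\<close> that differ modulo \<open>m\<close>. The floors of the theorem arise as
  follows. For a coefficient \<open>m j_k + r_k\<close>, the quotient
  \<open>(m j_k + r_k + j) div m\<close> is \<open>j_k + 1\<close> if \<open>r_k \<ge> m - j\<close>
  and \<open>j_k\<close> otherwise. So the condition on the \<open>j\<close>-th degree says, for
  \<open>j = 0\<close>, that the \<open>j_k\<close> have sum \<open>-1\<close>, and for
  \<open>i = m - j\<close> that exactly \<open>(r_0 + i n) div m\<close> of the \<open>r_k\<close>
  are below \<open>i\<close>. Multiplicities are differences of these counts, and inverting the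
  counting function gives the formula with ceilings. The solution with \<open>r_0 = 0\<close> also
  shows that the bound for the genus is attained.\<close>

locale field_extension =
  fixes emb :: "'k::field \<Rightarrow> 'a::field"
  assumes field_embedding: "field_embedding emb"
begin

lemma emb_1 [simp]: "emb 1 = 1"
  and emb_add: "emb (a + b) = emb a + emb b"
  and emb_mult: "emb (a * b) = emb a * emb b"
  using field_embedding by (auto simp: field_embedding_def)

lemma emb_0 [simp]: "emb 0 = 0"
  by (metis add_0_right add_left_cancel emb_add)

lemma emb_uminus: "emb (- a) = - emb a"
  using emb_add[of a "- a"] by (simp add: eq_neg_iff_add_eq_0 add.commute)

lemma emb_diff: "emb (a - b) = emb a - emb b"
  using emb_add[of a "- b"] by (simp add: emb_uminus)

lemma emb_eq_0_iff [simp]: "emb a = 0 \<longleftrightarrow> a = 0"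
proof
  assume "emb a = 0"
  show "a = 0"
  proof (rule ccontr)
    assume "a \<noteq> 0"
    then have "emb a * emb (inverse a) = 1" by (simp flip: emb_mult)
    with \<open>emb a = 0\<close> show False by simp
  qed
qed simp

lemma emb_inverse: "emb (inverse a) = inverse (emb a)"
proof (cases "a = 0")
  case False
  then have "emb a * emb (inverse a) = 1" by (simp flip: emb_mult)
  then show ?thesis by (metis inverse_unique)
qed simp

lemma eval1_0 [simp]: "eval1 emb z 0 = 0"
  by (simp add: eval1_def)

lemma eval1_pCons [simp]: "eval1 emb z (pCons a p) = emb a + z * eval1 emb z p"
  by (simp add: eval1_def map_poly_pCons)

lemma eval1_1 [simp]: "eval1 emb z 1 = 1"
  by (simp add: one_pCons)

lemma eval1_add: "eval1 emb z (p + r) = eval1 emb z p + eval1 emb z r"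
  by (induction p r rule: poly_induct2) (auto simp: emb_add algebra_simps)

lemma eval1_smult: "eval1 emb z (smult a p) = emb a * eval1 emb z p"
  by (induction p) (auto simp: emb_mult algebra_simps)

lemma eval1_mult: "eval1 emb z (p * r) = eval1 emb z p * eval1 emb z r"
  by (induction p) (auto simp: eval1_add eval1_smult algebra_simps)

lemma eval1_uminus: "eval1 emb z (- p) = - eval1 emb z p"
  by (induction p) (auto simp: emb_uminus)

lemma eval1_diff: "eval1 emb z (p - r) = eval1 emb z p - eval1 emb z r"
  using eval1_add[of z p "- r"] by (simp add: eval1_uminus)

lemma eval1_power: "eval1 emb z (p ^ k) = eval1 emb z p ^ k"
  by (induction k) (auto simp: eval1_mult)

lemma eval1_sum: "eval1 emb z (sum h A) = (\<Sum>i\<in>A. eval1 emb z (h i))"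
  by (induction A rule: infinite_finite_induct) (auto simp: eval1_add)

lemma eval1_prod: "eval1 emb z (prod h A) = (\<Prod>i\<in>A. eval1 emb z (h i))"
  by (induction A rule: infinite_finite_induct) (auto simp: eval1_mult)

lemma eval1_monom: "eval1 emb z (monom a k) = emb a * z ^ k"
  by (induction k) (auto simp: monom_Suc monom_0 algebra_simps)

lemma eval1_altdef: "eval1 emb z p = (\<Sum>i\<le>degree p. emb (coeff p i) * z ^ i)"
  by (subst poly_as_sum_of_monoms[symmetric]) (simp add: eval1_sum eval1_monom)

end

section \<open>The local ring of a place and its maximal ideal\<close>

lemma ring_at_nonunits: "valuation_ring emb R \<Longrightarrow> ring_at (nonunits R) = R"
proof (intro set_eqI)
  fix z assume R: "valuation_ring emb R"
  have 0: "a - a \<in> R" if "a \<in> R" for a using R that unfolding valuation_ring_def by blast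
  moreover obtain a where "a \<in> R" using R by (auto simp: valuation_ring_def)
  ultimately have "0 \<in> R" by force
  then show "z \<in> ring_at (nonunits R) \<longleftrightarrow> z \<in> R"
    using R by (cases "z = 0") (auto simp: valuation_ring_def ring_at_def nonunits_def)
qed

lemma prime_elementD:
  "prime_element P t \<Longrightarrow> t \<in> P"
  "prime_element P t \<Longrightarrow> a \<in> P \<Longrightarrow> \<exists>w\<in>ring_at P. a = t * w"
  unfolding prime_element_def by blast+

locale place = field_extension emb for emb :: "'k::field \<Rightarrow> 'a::field" +
  fixes P :: "'a set"
  assumes in_places: "P \<in> places emb"
begin

abbreviation \<O> where "\<O> \<equiv> ring_at P"

lemma valuation_ring: "valuation_ring emb \<O>" and nonunits_ring: "nonunits \<O> = P"
  using in_places ring_at_nonunits unfolding places_def by fastforce+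

lemma mem_P_iff: "z \<in> P \<longleftrightarrow> z \<in> \<O> \<and> (z = 0 \<or> inverse z \<notin> \<O>)"
  by (subst nonunits_ring[symmetric]) (simp add: nonunits_def)

lemma P_subset: "z \<in> P \<Longrightarrow> z \<in> \<O>"
  by (simp add: mem_P_iff)

lemma ring_emb [simp]: "emb c \<in> \<O>"
  and ring_diff: "a \<in> \<O> \<Longrightarrow> b \<in> \<O> \<Longrightarrow> a - b \<in> \<O>"
  and ring_mult: "a \<in> \<O> \<Longrightarrow> b \<in> \<O> \<Longrightarrow> a * b \<in> \<O>"
  and ring_or_inverse: "z \<in> \<O> \<or> inverse z \<in> \<O>"
  and ring_proper: "\<exists>z. z \<notin> \<O>"
proof -
  show "z \<in> \<O> \<or> inverse z \<in> \<O>"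
    using valuation_ring unfolding valuation_ring_def by (cases "z = 0") (auto simp: ring_at_def)
qed (use valuation_ring in \<open>auto simp: valuation_ring_def\<close>)

lemma ring_0 [simp]: "0 \<in> \<O>" and ring_1 [simp]: "1 \<in> \<O>"
  using ring_emb[of 0] ring_emb[of 1] by auto

lemma ring_uminus: "a \<in> \<O> \<Longrightarrow> - a \<in> \<O>"
  using ring_diff[of 0 a] by simp

lemma ring_add: "a \<in> \<O> \<Longrightarrow> b \<in> \<O> \<Longrightarrow> a + b \<in> \<O>"
  using ring_diff[of a "- b"] ring_uminus[of b] by simp

lemma ring_power: "a \<in> \<O> \<Longrightarrow> a ^ k \<in> \<O>"
  by (induction k) (auto intro: ring_mult)

lemma ring_sum: "(\<And>i. i \<in> A \<Longrightarrow> h i \<in> \<O>) \<Longrightarrow> sum h A \<in> \<O>"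
  by (induction A rule: infinite_finite_induct) (auto intro: ring_add)

lemma P_0 [simp]: "0 \<in> P" and not_1_in_P [simp]: "1 \<notin> P"
  by (auto simp: mem_P_iff)

lemma P_mult: "a \<in> \<O> \<Longrightarrow> b \<in> P \<Longrightarrow> a * b \<in> P"
proof (cases "a * b = 0")
  case False
  assume "a \<in> \<O>" "b \<in> P"
  moreover have "inverse b = a * inverse (a * b)" using False by (simp add: field_simps)
  ultimately show ?thesis by (metis False mem_P_iff mult_zero_right ring_mult)
qed (auto simp: mem_P_iff)

lemma P_mult': "a \<in> P \<Longrightarrow> b \<in> \<O> \<Longrightarrow> a * b \<in> P"
  using P_mult[of b a] by (simp add: mult.commute)

lemma divide_cases: "b \<noteq> 0 \<Longrightarrow> a / b \<in> \<O> \<or> b / a \<in> P"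
  using ring_or_inverse[of "a / b"] by (auto simp: mem_P_iff)

lemma P_add: "a \<in> P \<Longrightarrow> b \<in> P \<Longrightarrow> a + b \<in> P"
proof (cases "a = 0 \<or> b = 0")
  case False
  assume *: "a \<in> P" "b \<in> P"
  have "a + b = (1 + a / b) * b" "a + b = (1 + b / a) * a" using False by (auto simp: field_simps)
  moreover have "a / b \<in> \<O> \<or> b / a \<in> \<O>" using divide_cases[of b a] False by (auto simp: mem_P_iff)
  ultimately show ?thesis by (metis * P_mult ring_1 ring_add)
qed auto

lemma P_uminus: "a \<in> P \<Longrightarrow> - a \<in> P"
  using P_mult[of "- 1" a] ring_uminus[of 1] by simp

lemma P_diff: "a \<in> P \<Longrightarrow> b \<in> P \<Longrightarrow> a - b \<in> P"
  using P_add[of a "- b"] P_uminus[of b] by simp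

lemma P_sum: "(\<And>i. i \<in> A \<Longrightarrow> h i \<in> P) \<Longrightarrow> sum h A \<in> P"
  by (induction A rule: infinite_finite_induct) (auto intro: P_add)

lemma unit_iff: "u \<in> \<O> - P \<longleftrightarrow> u \<in> \<O> \<and> u \<noteq> 0 \<and> inverse u \<in> \<O>"
  by (auto simp: mem_P_iff)

lemma unit_mult: "u \<in> \<O> - P \<Longrightarrow> w \<in> \<O> - P \<Longrightarrow> u * w \<in> \<O> - P"
  by (simp only: unit_iff) (simp add: ring_mult)

lemma unit_inverse: "u \<in> \<O> - P \<Longrightarrow> inverse u \<in> \<O> - P"
  by (simp only: unit_iff) simp

lemma unit_power_int: "u \<in> \<O> - P \<Longrightarrow> u powi k \<in> \<O> - P"
  by (simp only: unit_iff) (simp add: power_int_def ring_power flip: power_inverse)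

lemma emb_in_P_iff: "emb c \<in> P \<longleftrightarrow> c = 0"
  by (auto simp: mem_P_iff simp flip: emb_inverse)

lemma P_power: "a \<in> P \<Longrightarrow> k > 0 \<Longrightarrow> a ^ k \<in> P"
  by (cases k) (auto intro: P_mult' ring_power P_subset)

lemma prime_ideal: "a * b \<in> P \<Longrightarrow> a \<in> \<O> \<Longrightarrow> b \<in> \<O> \<Longrightarrow> a \<in> P \<or> b \<in> P"
  using unit_mult[of a b] by blast

lemma eval1_in_ring: "z \<in> \<O> \<Longrightarrow> eval1 emb z p \<in> \<O>"
  by (induction p) (auto intro: ring_add ring_mult)

text \<open>The value is congruent to the constant coefficient modulo \<open>P\<close>, and nonzero
  constants are units.\<close>

lemma eval1_not_in_P: "z \<in> P \<Longrightarrow> coeff p 0 \<noteq> 0 \<Longrightarrow> eval1 emb z p \<in> \<O> - P"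
proof (cases p)
  case (pCons a r)
  assume *: "z \<in> P" "coeff p 0 \<noteq> 0"
  have "z * eval1 emb z r \<in> P" using * by (intro P_mult' eval1_in_ring P_subset)
  then have "eval1 emb z p \<in> P \<Longrightarrow> emb a \<in> P" using P_diff[of "eval1 emb z p" "z * eval1 emb z r"] pCons by simp
  with * pCons show ?thesis by (auto simp: emb_in_P_iff eval1_in_ring P_subset simp del: eval1_pCons)
qed

text \<open>Valuation rings are integrally closed: for \<open>z\<close> outside the ring, dividing
  the equation by \<open>z^k\<close> would put 1 into \<open>P\<close>.\<close>

lemma root_in_ring:
  assumes "k > 0" "z ^ k = (\<Sum>i<k. a i * z ^ i)" "\<And>i. i < k \<Longrightarrow> a i \<in> \<O>"
  shows "z \<in> \<O>"
proof (rule ccontr)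
  assume "z \<notin> \<O>"
  then have z: "z \<noteq> 0" "inverse z \<in> P" using ring_or_inverse[of z] by (auto simp: mem_P_iff)
  have "z ^ k * inverse z ^ k = 1" using z by (simp add: power_inverse)
  then have "1 = (\<Sum>i<k. a i * z ^ i) * inverse z ^ k" unfolding assms(2) by simp
  also have "\<dots> = (\<Sum>i<k. a i * inverse z ^ (k - i))"
    unfolding sum_distrib_right using z
    by (intro sum.cong refl) (auto simp: power_diff field_simps)
  also have "\<dots> \<in> P" using z assms(3) by (intro P_sum P_mult P_power) auto
  finally show False by simp
qed

end

section \<open>Discreteness of the places\<close>

text \<open>The degree of the field over \<open>K(z)\<close> is at most \<open>N\<close>; dividing a relation by a power of \<open>z\<close> makes
  one of the constant coefficients nonzero.\<close>
definition degree_bound :: "('k::field \<Rightarrow> 'a::field) \<Rightarrow> 'a \<Rightarrow> nat \<Rightarrow> bool" where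
  "degree_bound emb z N \<longleftrightarrow> (\<forall>I::nat set. \<forall>v. finite I \<and> N < card I \<longrightarrow>
     (\<exists>c. (\<exists>i\<in>I. coeff (c i) 0 \<noteq> 0) \<and> (\<Sum>i\<in>I. eval1 emb z (c i) * v i) = 0))"

text \<open>The definition fixes index sets of natural numbers, since it cannot quantify over types;
  a bijection carries relations over to other index types.\<close>

lemma degree_boundD:
  assumes "degree_bound emb z N" "finite I" "N < card I"
  obtains c where "\<exists>i\<in>I. coeff (c i) 0 \<noteq> 0" "(\<Sum>i\<in>I. eval1 emb z (c i) * v i) = 0"
proof -
  obtain h where h: "bij_betw h {0..<card I} I" using ex_bij_betw_nat_finite[OF assms(2)] by blast
  have inj: "inj_on h {0..<card I}" and im: "h ` {0..<card I} = I" using h by (auto simp: bij_betw_def)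
  obtain c where c: "\<exists>i\<in>{0..<card I}. coeff (c i) 0 \<noteq> 0"
    "(\<Sum>i\<in>{0..<card I}. eval1 emb z (c i) * v (h i)) = 0"
    using assms(1)[unfolded degree_bound_def, rule_format, of "{0..<card I}" "\<lambda>i. v (h i)"] assms(3) by auto
  define c' where "c' = (\<lambda>i. c (the_inv_into {0..<card I} h i))"
  have c': "c' (h i) = c i" if "i < card I" for i
    using the_inv_into_f_f[OF inj] that by (simp add: c'_def)
  show ?thesis
  proof (rule that[of c'])
    show "\<exists>i\<in>I. coeff (c' i) 0 \<noteq> 0" using c(1) c' im by (metis atLeastLessThan_iff imageI)
    have "(\<Sum>i\<in>I. eval1 emb z (c' i) * v i) = (\<Sum>i\<in>{0..<card I}. eval1 emb z (c' (h i)) * v (h i))"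
      using inj im by (metis (no_types, lifting) sum.reindex_cong)
    also have "\<dots> = (\<Sum>i\<in>{0..<card I}. eval1 emb z (c i) * v (h i))" by (intro sum.cong refl) (auto simp: c')
    also note c(2)
    finally show "(\<Sum>i\<in>I. eval1 emb z (c' i) * v i) = 0" .
  qed
qed

context place
begin

context
  fixes z N
  assumes z: "z \<in> P" "z \<noteq> 0" and N: "degree_bound emb z N"
begin

text \<open>Along the chain the valuation would drop strictly from \<open>z\<close> through
  \<open>N + 1\<close> positive values, while the \<open>N + 1\<close> elements satisfy a relation
  over \<open>K[z]\<close>. This is the source of discreteness.\<close>

lemma no_long_chain:
  assumes "u 0 = z" and u: "\<And>i. i \<le> N \<Longrightarrow> u i \<in> P \<and> u i \<noteq> 0" and chain: "\<And>i. i < N \<Longrightarrow> u i / u (Suc i) \<in> P"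
  shows False
proof -
  have lt: "u i / u j \<in> P" if "i < j" "j \<le> N" for i j
    using that
  proof (induction j)
    case (Suc j)
    show ?case
    proof (cases "i = j")
      case False
      then have "u i / u j * (u j / u (Suc j)) \<in> P" using Suc chain[of j] by (intro P_mult'[OF _ P_subset]) auto
      moreover have "u j \<noteq> 0" using u[of j] Suc by simp
      then have "u i / u j * (u j / u (Suc j)) = u i / u (Suc j)" by (simp add: field_simps)
      ultimately show ?thesis by metis
    qed (use chain Suc in auto)
  qed simp
  obtain c where c: "\<exists>i\<in>{..N}. coeff (c i) 0 \<noteq> 0" "(\<Sum>i\<in>{..N}. eval1 emb z (c i) * u i) = 0"
    using degree_boundD[OF N, of "{..N}" u] by auto
  \<comment> \<open>The last index whose coefficient is a unit. After division by \<open>u i\<close>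
    the earlier terms lie in \<open>P\<close> by the chain condition; the later ones do because
    their coefficients are multiples of \<open>z\<close> and \<open>z / u i\<close> is
    integral.\<close>
  define i where "i = Max {i\<in>{..N}. coeff (c i) 0 \<noteq> 0}"
  have "i \<in> {i\<in>{..N}. coeff (c i) 0 \<noteq> 0}" unfolding i_def using c(1) by (intro Max_in) auto
  then have i: "i \<le> N" "coeff (c i) 0 \<noteq> 0" by auto
  have i': "coeff (c j) 0 = 0" if "i < j" "j \<le> N" for j
    using Max_ge[of "{i\<in>{..N}. coeff (c i) 0 \<noteq> 0}" j] that unfolding i_def[symmetric] by fastforce
  have ui: "u i \<noteq> 0" using u i by simp
  have "eval1 emb z (c j) * u j / u i \<in> P" if "j \<le> N" "j \<noteq> i" for j
  proof (cases "j < i")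
    case True
    then have "eval1 emb z (c j) * (u j / u i) \<in> P" using lt[of j i] i z by (intro P_mult eval1_in_ring P_subset) auto
    then show ?thesis by simp
  next
    case False
    then have "coeff (c j) 0 = 0" using i' that by simp
    then obtain r where "c j = pCons 0 r" by (cases "c j") auto
    moreover have "z / u i \<in> \<O>" using lt[of 0 i] i assms(1) ui by (cases "i = 0") (auto intro: P_subset)
    then have "(eval1 emb z r * (z / u i)) * u j \<in> P" using u[OF that(1)] z
      by (intro P_mult[OF ring_mult] eval1_in_ring P_subset[OF z(1)]) auto
    moreover have "eval1 emb z r * (z / u i) * u j = eval1 emb z (pCons 0 r) * u j / u i" by simp
    ultimately show ?thesis by (simp only:)
  qed
  then have "(\<Sum>j\<in>{..N} - {i}. eval1 emb z (c j) * u j / u i) \<in> P" by (intro P_sum) auto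
  moreover have "(\<Sum>j\<in>{..N}. eval1 emb z (c j) * u j / u i) = 0"
    using c(2) by (simp flip: sum_divide_distrib)
  then have "eval1 emb z (c i) + (\<Sum>j\<in>{..N} - {i}. eval1 emb z (c j) * u j / u i) = 0"
    using i(1) ui by (subst (asm) sum.remove[of _ i]) auto
  then have "eval1 emb z (c i) = - (\<Sum>j\<in>{..N} - {i}. eval1 emb z (c j) * u j / u i)"
    by (simp only: eq_neg_iff_add_eq_0)
  ultimately have "eval1 emb z (c i) \<in> P" using P_uminus by (simp only:)
  with eval1_not_in_P[OF z(1) i(2)] show False by simp
qed

text \<open>Without a prime element every nonzero \<open>u\<close> in \<open>P\<close> has a nonzero
  \<open>w\<close> in \<open>P\<close> with \<open>u / w\<close> in \<open>P\<close>. Iterating this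
  from \<open>z\<close> yields a chain that is too long.\<close>

lemma ex_prime_element: "\<exists>t. prime_element P t"
proof (rule ccontr)
  assume no: "\<nexists>t. prime_element P t"
  have "\<exists>w. w \<in> P \<and> w \<noteq> 0 \<and> u / w \<in> P" if "u \<in> P" "u \<noteq> 0" for u
  proof -
    have "(\<lambda>w. u * w) ` \<O> \<subseteq> P" using that by (auto intro: P_mult')
    with no that obtain w where w: "w \<in> P" "w \<notin> (\<lambda>w. u * w) ` \<O>" unfolding prime_element_def by blast
    have "w \<noteq> 0" using w by (metis P_0 P_subset imageI mult_zero_right)
    moreover have "w / u \<notin> \<O>" using w(2) that by (metis image_eqI nonzero_mult_div_cancel_left times_divide_eq_right)
    ultimately show ?thesis using w(1) divide_cases[of u w] that by auto
  qed
  then obtain g where g: "g u \<in> P \<and> g u \<noteq> 0 \<and> u / g u \<in> P" if "u \<in> P" "u \<noteq> 0" for u by metis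
  have u: "(g ^^ i) z \<in> P \<and> (g ^^ i) z \<noteq> 0" for i
    by (induction i) (use z g in auto)
  show False by (rule no_long_chain[of "\<lambda>i. (g ^^ i) z"]) (use u g in auto)
qed

text \<open>This excludes a pole of \<open>u\<close> that is worse than all powers of
  \<open>inverse z\<close>. With such a pole, the leading term would dominate every relation between
  powers of \<open>u\<close>, as a coefficient from \<open>K[z]\<close> changes the size only by a
  power of \<open>z\<close>.\<close>

lemma mult_power_in_ring: "\<exists>k. u * z ^ k \<in> \<O>"
proof (rule ccontr)
  assume "\<nexists>k. u * z ^ k \<in> \<O>"
  then have no: "u * z ^ k \<notin> \<O>" for k by blast
  have u0: "u \<noteq> 0" using no[of 0] by auto
  have inv: "inverse u * inverse z ^ k \<in> P" for k
    using no[of k] ring_or_inverse[of "u * z ^ k"] z by (auto simp: mem_P_iff power_inverse)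
  obtain c where c: "\<exists>i\<in>{..N}. coeff (c i) 0 \<noteq> 0" "(\<Sum>i\<in>{..N}. eval1 emb z (c i) * u ^ i) = 0"
    using degree_boundD[OF N, of "{..N}" "\<lambda>i. u ^ i"] by auto
  define M where "M = Max {i\<in>{..N}. c i \<noteq> 0}"
  have "\<exists>i\<in>{..N}. c i \<noteq> 0" using c(1) by (metis coeff_0)
  then have "M \<in> {i\<in>{..N}. c i \<noteq> 0}" unfolding M_def by (intro Max_in) auto
  then have M: "M \<le> N" "c M \<noteq> 0" by auto
  have M': "c j = 0" if "M < j" "j \<le> N" for j
    using Max_ge[of "{i\<in>{..N}. c i \<noteq> 0}" j] that unfolding M_def[symmetric] by fastforce
  have "\<exists>j w. w \<in> \<O> - P \<and> eval1 emb z (c M) = z ^ j * w"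
  proof -
    \<comment> \<open>Splitting off the vanishing low coefficients leaves a polynomial in
      \<open>z\<close> with nonzero constant term, which is a unit.\<close>
    have "\<exists>j w. w \<in> \<O> - P \<and> eval1 emb z p = z ^ j * w" if "p \<noteq> 0" for p
      using that
    proof (induction p)
      case (pCons a p)
      show ?case
      proof (cases "a = 0")
        case True
        with pCons obtain j w where "w \<in> \<O> - P" "eval1 emb z p = z ^ j * w" by auto
        with True show ?thesis by (intro exI[of _ "Suc j"] exI[of _ w]) (auto simp: algebra_simps)
      next
        case False
        then show ?thesis using eval1_not_in_P[OF z(1), of "pCons a p"] by (intro exI[of _ 0] exI) auto
      qed
    qed simp
    then show ?thesis using M by blast
  qed
  then obtain j w where jw: "w \<in> \<O> - P" "eval1 emb z (c M) = z ^ j * w" by blast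
  define s where "s = (\<Sum>i\<in>{..N} - {M}. eval1 emb z (c i) * u ^ i)"
  have ws: "z ^ j * w * u ^ M + s = 0"
    using c(2) M(1) jw(2) by (subst (asm) sum.remove[of _ M]) (auto simp: s_def)
  have sP: "s * (inverse z ^ j * inverse u ^ M) \<in> P"
    unfolding s_def sum_distrib_right
  proof (rule P_sum)
    fix i assume i: "i \<in> {..N} - {M}"
    show "eval1 emb z (c i) * u ^ i * (inverse z ^ j * inverse u ^ M) \<in> P"
    proof (cases "i > M")
      case True
      then show ?thesis using M' i by simp
    next
      case False
      then obtain d where d: "M = i + Suc d" using i by (metis Diff_iff insertI1 less_imp_Suc_add linorder_neqE_nat add_Suc_right)
      have "eval1 emb z (c i) * inverse u ^ d * (inverse u * inverse z ^ j) \<in> P"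
        using inv[of 0] P_subset
        by (intro P_mult[OF ring_mult[OF eval1_in_ring[OF P_subset[OF z(1)]] ring_power] inv]) simp
      then show ?thesis using u0 d by (simp add: power_add field_simps)
    qed
  qed
  have "z ^ j * w * u ^ M * (inverse z ^ j * inverse u ^ M)
      = w * (z ^ j * inverse z ^ j) * (u ^ M * inverse u ^ M)"
    by (simp only: mult_ac)
  then have "z ^ j * w * u ^ M * (inverse z ^ j * inverse u ^ M) = w" using u0 z by (simp add: power_inverse)
  moreover have "s = - (z ^ j * w * u ^ M)" using ws by (simp add: eq_neg_iff_add_eq_0 add.commute)
  ultimately have "s * (inverse z ^ j * inverse u ^ M) = - w" by (simp only: mult_minus_left)
  with sP have "w \<in> P" using P_uminus by fastforce
  with jw show False by simp
qed

lemma power_divides_bounded: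
  assumes t: "prime_element P t" and a: "a \<noteq> 0"
  shows "\<exists>k. a / t ^ k \<notin> \<O>"
proof (rule ccontr)
  assume "\<nexists>k. a / t ^ k \<notin> \<O>"
  then have all: "a / t ^ k \<in> \<O>" for k by blast
  note tP = prime_elementD(1)[OF t] and P = prime_elementD(2)[OF t]
  have t0: "t \<noteq> 0" using P[OF z(1)] z(2) by auto
  obtain e where e: "z / t ^ e \<notin> \<O>"
  proof (rule ccontr)
    assume "\<not> thesis"
    then have z': "z / t ^ k \<in> \<O>" for k using that by blast
    \<comment> \<open>If \<open>z\<close> were divisible by all powers of \<open>t\<close>, then
      \<open>z, t^N, t^(N-1), ..., t\<close> would be a forbidden chain.\<close>
    define u where "u i = (if i = 0 then z else t ^ (Suc N - i))" for i
    show False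
    proof (rule no_long_chain[of u])
      fix i assume "i < N"
      then obtain d where d: "N = i + Suc d" using less_imp_Suc_add by fastforce
      show "u i / u (Suc i) \<in> P"
      proof (cases "i = 0")
        case True
        have "t * (z / t ^ Suc N) \<in> P" using z'[of "Suc N"] tP by (intro P_mult')
        then show ?thesis using True t0 by (simp add: u_def)
      next
        case False
        then show ?thesis using d t0 tP by (simp add: u_def Suc_diff_le)
      qed
    qed (use tP t0 z in \<open>auto simp: u_def intro: P_power\<close>)
  qed
  \<comment> \<open>Some power \<open>z^k\<close> is a multiple of \<open>a\<close>, hence of
    \<open>t^(e k + 1)\<close>; but \<open>z\<close> divides \<open>t^e\<close>, so
    \<open>z^k\<close> divides \<open>t^(e k)\<close> and \<open>inverse t\<close> would be
    integral.\<close>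
  obtain k where k: "inverse a * z ^ k \<in> \<O>" using mult_power_in_ring by blast
  obtain d where d: "t ^ e / z \<in> P" using divide_cases[of "t ^ e" z] e t0 by auto
  have "(inverse a * z ^ k) * (a / t ^ Suc (e * k)) \<in> \<O>" using ring_mult[OF k all] .
  moreover have "inverse a * z ^ k * (a / t ^ Suc (e * k)) = z ^ k / t ^ Suc (e * k)" using a by (simp add: field_simps)
  ultimately have "z ^ k / t ^ Suc (e * k) \<in> \<O>" by metis
  then have "(t ^ e / z) ^ k * (z ^ k / t ^ Suc (e * k)) \<in> \<O>"
    using d by (intro ring_mult ring_power) (auto intro: P_subset)
  then have "inverse t \<in> \<O>" using t0 z by (simp add: power_divide power_mult field_simps)
  then show False using tP t0 by (auto simp: mem_P_iff)
qed

end

end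

section \<open>The normalized discrete valuation of a place\<close>

locale discrete_place = place +
  assumes ex_prime: "\<exists>t. prime_element P t"
    and dvr: "prime_element P t \<Longrightarrow> a \<noteq> 0 \<Longrightarrow> \<exists>k. a / t ^ k \<notin> \<O>"

lemma (in place) discrete_placeI:
  assumes "z \<in> P" "z \<noteq> 0" "degree_bound emb z N"
  shows "discrete_place emb P"
  by unfold_locales (use ex_prime_element[OF assms] power_divides_bounded[OF assms] in auto)

context discrete_place
begin

lemma prime_nonzero: "prime_element P t \<Longrightarrow> t \<noteq> 0"
proof
  assume "prime_element P t" "t = 0"
  then have "P \<subseteq> {0}" using prime_elementD(2) by fastforce
  then have "P = {0}" by auto
  then show False using ring_or_inverse ring_proper mem_P_iff by (metis inverse_inverse_eq inverse_zero ring_0 singletonD)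
qed

lemma decompose:
  assumes t: "prime_element P t" and a: "a \<noteq> 0"
  obtains k u where "u \<in> \<O> - P" "a = t powi k * u"
proof -
  note tP = prime_elementD(1)[OF t] and P = prime_elementD(2)[OF t]
  note t0 = prime_nonzero[OF t]
  have ring: "\<exists>k u. u \<in> \<O> - P \<and> a = t powi k * u" if a: "a \<noteq> 0" "a \<in> \<O>" for a
  proof -
    define k where "k = (LEAST k. a / t ^ k \<notin> \<O>)"
    have k: "a / t ^ k \<notin> \<O>" using dvr[OF t a(1)] unfolding k_def by (rule LeastI_ex)
    then obtain l where l: "k = Suc l" using a by (cases k) auto
    have al: "a / t ^ l \<in> \<O>" using not_less_Least[of l "\<lambda>k. a / t ^ k \<notin> \<O>"] l unfolding k_def[symmetric] by simp
    have "a / t ^ l \<notin> P"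
    proof
      assume "a / t ^ l \<in> P"
      then obtain w where "w \<in> \<O>" "a / t ^ l = t * w" using P by blast
      then show False using k l t0 by (simp add: field_simps)
    qed
    then show ?thesis using al t0 by (intro exI[of _ "int l"] exI[of _ "a / t ^ l"]) (auto simp: power_int_def)
  qed
  show ?thesis
  proof (cases "a \<in> \<O>")
    case True
    then show ?thesis using ring[OF a] that by blast
  next
    case False
    then have "inverse a \<in> \<O>" using ring_or_inverse by blast
    then obtain k u where u: "u \<in> \<O> - P" "inverse a = t powi k * u" using ring[of "inverse a"] a by auto
    then have "a = inverse (t powi k * u)" by (metis inverse_inverse_eq)
    then have "a = t powi (- k) * inverse u" by (simp add: power_int_minus)
    then show ?thesis using that unit_inverse u by blast
  qed
qed

lemma power_int_prime_unit: "prime_element P t \<Longrightarrow> t powi k \<in> \<O> - P \<Longrightarrow> k = 0"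
proof (rule ccontr)
  assume t: "prime_element P t" and k: "t powi k \<in> \<O> - P" "k \<noteq> 0"
  then have tP: "t \<in> P" by (simp add: prime_elementD)
  have "t powi \<bar>k\<bar> \<in> \<O> - P" using unit_inverse[OF k(1)] k(1) by (cases "k \<ge> 0") (auto simp: power_int_minus)
  moreover have "t powi \<bar>k\<bar> \<in> P" using k(2) tP by (auto simp: power_int_def intro: P_power)
  ultimately show False by simp
qed

text \<open>Two prime elements differ by a unit, so the exponent does not depend on the prime
  element that the definition of \<open>val\<close> picks.\<close>

lemma val_eqI:
  assumes t: "prime_element P t" and u: "u \<in> \<O> - P"
  shows "val P (t powi k * u) = k"
  unfolding val_def
proof (rule the_equality)
  show "\<exists>t' u'. prime_element P t' \<and> u' \<in> \<O> - P \<and> t powi k * u = t' powi k * u'" using assms by blast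
next
  fix k' assume "\<exists>t' u'. prime_element P t' \<and> u' \<in> \<O> - P \<and> t powi k * u = t' powi k' * u'"
  then obtain t' u' where t': "prime_element P t'" and u': "u' \<in> \<O> - P" and eq: "t powi k * u = t' powi k' * u'" by blast
  have nz: "t \<noteq> 0" "t' \<noteq> 0" using prime_nonzero t t' by auto
  obtain w w' where w: "w \<in> \<O>" "t' = t * w" "w' \<in> \<O>" "t = t' * w'"
    using prime_elementD t t' by metis
  then have "w * w' = 1" using nz by (metis mult.assoc mult.right_neutral mult_left_cancel mult.commute)
  then have "w \<noteq> 0" "inverse w = w'" by (auto simp: inverse_unique)
  then have "w \<in> \<O> - P" using w(1,3) unit_iff by blast
  then have un: "w powi k' * u' * inverse u \<in> \<O> - P" using u u' by (intro unit_mult unit_inverse unit_power_int)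
  have "t powi k * u = t powi k' * (w powi k' * u')" using eq unfolding w(2) by (simp add: power_int_mult_distrib)
  then have "t powi (k - k') = w powi k' * u' * inverse u"
    using nz u[unfolded unit_iff] by (auto simp: power_int_diff field_simps)
  then have "k - k' = 0" using un power_int_prime_unit[OF t] by metis
  then show "k' = k" by simp
qed

lemma val_decompose:
  assumes t: "prime_element P t" and a: "a \<noteq> 0"
  obtains u where "u \<in> \<O> - P" "a = t powi (val P a) * u"
  using decompose[OF assms] val_eqI[OF t] by metis

lemma val_prime: "prime_element P t \<Longrightarrow> val P t = 1"
  using val_eqI[of t 1 1] by simp

lemma val_mult: "a \<noteq> 0 \<Longrightarrow> b \<noteq> 0 \<Longrightarrow> val P (a * b) = val P a + val P b"
proof -
  assume ab: "a \<noteq> 0" "b \<noteq> 0"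
  obtain t where t: "prime_element P t" using ex_prime by blast
  obtain u w where "u \<in> \<O> - P" "a = t powi (val P a) * u" "w \<in> \<O> - P" "b = t powi (val P b) * w"
    using val_decompose[OF t] ab by metis
  then have "a * b = t powi (val P a + val P b) * (u * w)" "u * w \<in> \<O> - P"
    using prime_nonzero[OF t] unit_mult by (auto simp: power_int_add) (metis mult.assoc mult.left_commute)
  then show ?thesis using val_eqI[OF t] by metis
qed

lemma val_1 [simp]: "val P 1 = 0"
  using val_mult[of 1 1] by simp

lemma val_inverse: "a \<noteq> 0 \<Longrightarrow> val P (inverse a) = - val P a"
  using val_mult[of a "inverse a"] by simp

lemma val_divide: "a \<noteq> 0 \<Longrightarrow> b \<noteq> 0 \<Longrightarrow> val P (a / b) = val P a - val P b"
  by (simp add: divide_inverse val_mult val_inverse)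

lemma val_power: "a \<noteq> 0 \<Longrightarrow> val P (a ^ k) = int k * val P a"
  by (induction k) (auto simp: val_mult algebra_simps)

lemma val_prod: "(\<And>i. i \<in> A \<Longrightarrow> h i \<noteq> 0) \<Longrightarrow> val P (prod h A) = (\<Sum>i\<in>A. val P (h i))"
  by (induction A rule: infinite_finite_induct) (auto simp: val_mult)

lemma val_power_int_prime: "prime_element P t \<Longrightarrow> val P (t powi k) = k"
  using val_eqI[of t 1 k] by simp

lemma val_unit_iff: "a \<noteq> 0 \<Longrightarrow> val P a = 0 \<longleftrightarrow> a \<in> \<O> - P"
proof -
  assume a: "a \<noteq> 0"
  obtain t where t: "prime_element P t" using ex_prime by blast
  obtain u where "u \<in> \<O> - P" "a = t powi (val P a) * u" using val_decompose[OF t a] .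
  then show ?thesis using val_eqI[OF t, of a 0] by auto
qed

lemma val_pos_iff: "a \<noteq> 0 \<Longrightarrow> val P a > 0 \<longleftrightarrow> a \<in> P"
proof -
  assume a: "a \<noteq> 0"
  obtain t where t: "prime_element P t" using ex_prime by blast
  then have tP: "t \<in> P" and t0: "t \<noteq> 0" by (auto simp: prime_elementD prime_nonzero)
  obtain u where u: "u \<in> \<O> - P" "a = t powi (val P a) * u" using val_decompose[OF t a] .
  have pos: "t powi k * u \<in> P" if "k > 0" "u \<in> \<O>" for k u
    using that tP by (auto simp: power_int_def intro!: P_mult' P_power)
  show ?thesis
  proof
    assume "val P a > 0"
    then show "a \<in> P" using pos u by (metis DiffD1)
  next
    assume aP: "a \<in> P"
    show "val P a > 0"
    proof (rule ccontr)
      assume "\<not> val P a > 0"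
      then have "val P a < 0" using aP val_unit_iff[OF a] by fastforce
      then have "t powi (- val P a) * inverse u \<in> P" using pos unit_inverse[OF u(1)] by auto
      moreover have "inverse a = t powi (- val P a) * inverse u" by (subst u(2)) (simp add: power_int_minus)
      ultimately show False using aP a by (auto simp: mem_P_iff)
    qed
  qed
qed

lemma val_nonneg_iff: "a \<noteq> 0 \<Longrightarrow> val P a \<ge> 0 \<longleftrightarrow> a \<in> \<O>"
  using val_pos_iff[of a] val_unit_iff[of a] P_subset[of a] by fastforce

lemma val_uminus [simp]: "val P (- a) = val P a"
proof (cases "a = 0")
  case False
  have "val P (- 1 :: 'b) = 0" using val_unit_iff[of "- 1"] P_uminus[of "- 1"] by (auto simp: ring_uminus)
  then show ?thesis using val_mult[of "- 1" a] False by simp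
qed simp

lemma val_emb [simp]: "c \<noteq> 0 \<Longrightarrow> val P (emb c) = 0"
  by (simp add: val_unit_iff emb_in_P_iff)

end

text \<open>Lower bounds for the valuation in which 0 has the value infinity, whatever
  \<open>val P 0\<close> is.\<close>

definition vge :: "'a::field set \<Rightarrow> int \<Rightarrow> 'a \<Rightarrow> bool" where
  "vge P k a \<longleftrightarrow> a = 0 \<or> k \<le> val P a"

context discrete_place
begin

lemma vge_0 [simp]: "vge P k 0"
  by (simp add: vge_def)

text \<open>Scaling by a power of a prime element turns the bound into integrality, so that the
  ultrametric inequality becomes closure of the ring under addition.\<close>

lemma vge_iff: "prime_element P t \<Longrightarrow> vge P k a \<longleftrightarrow> a * t powi (- k) \<in> \<O>"
proof (cases "a = 0")
  case False
  assume t: "prime_element P t"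
  then have "val P (a * t powi (- k)) = val P a - k" "a * t powi (- k) \<noteq> 0"
    using False val_power_int_prime[OF t] prime_nonzero[OF t] by (auto simp: val_mult)
  then show ?thesis using val_nonneg_iff[of "a * t powi (- k)"] False by (auto simp: vge_def)
qed simp

lemma vge_ring_iff: "vge P 0 a \<longleftrightarrow> a \<in> \<O>"
  using val_nonneg_iff[of a] by (cases "a = 0") (auto simp: vge_def)

lemma vge_P_iff: "vge P 1 a \<longleftrightarrow> a \<in> P"
  using val_pos_iff[of a] by (cases "a = 0") (auto simp: vge_def)

lemma vge_add: "vge P k a \<Longrightarrow> vge P k b \<Longrightarrow> vge P k (a + b)"
  using ex_prime vge_iff ring_add by (metis distrib_right)

lemma vge_uminus [simp]: "vge P k (- a) \<longleftrightarrow> vge P k a"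
  by (simp add: vge_def)

lemma vge_diff: "vge P k a \<Longrightarrow> vge P k b \<Longrightarrow> vge P k (a - b)"
  using vge_add[of k a "- b"] by simp

lemma vge_sum: "(\<And>i. i \<in> A \<Longrightarrow> vge P k (h i)) \<Longrightarrow> vge P k (sum h A)"
  by (induction A rule: infinite_finite_induct) (auto intro: vge_add)

lemma vge_mult: "vge P k a \<Longrightarrow> vge P l b \<Longrightarrow> vge P (k + l) (a * b)"
  by (cases "a = 0"; cases "b = 0") (auto simp: vge_def val_mult)

lemma vge_mono: "vge P k a \<Longrightarrow> l \<le> k \<Longrightarrow> vge P l a"
  by (auto simp: vge_def)

lemma vge_emb: "vge P 0 (emb c)"
  by (simp add: vge_ring_iff)

lemma vge_power: "vge P k a \<Longrightarrow> vge P (int j * k) (a ^ j)"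
  by (cases "j = 0"; cases "a = 0") (auto simp: vge_def val_power mult_left_mono)

lemma val_add_eq: "a \<noteq> 0 \<Longrightarrow> vge P (val P a + 1) b \<Longrightarrow> a + b \<noteq> 0 \<and> val P (a + b) = val P a"
proof -
  assume a: "a \<noteq> 0" and b: "vge P (val P a + 1) b"
  have nz: "a + b \<noteq> 0"
  proof
    assume "a + b = 0"
    then have "b = - a" by (simp add: eq_neg_iff_add_eq_0 add.commute)
    then show False using a b by (simp add: vge_def)
  qed
  have "vge P (val P a) (a + b)" using b a by (intro vge_add) (auto simp: vge_def)
  moreover have "\<not> vge P (val P a + 1) (a + b)"
    using vge_diff[of "val P a + 1" "a + b" b] a b by (auto simp: vge_def)
  ultimately show ?thesis using nz by (auto simp: vge_def)
qed

lemma val_sum_eq: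
  assumes "finite A" "i \<in> A" "h i \<noteq> 0" "\<And>j. j \<in> A \<Longrightarrow> j \<noteq> i \<Longrightarrow> h j = 0 \<or> val P (h i) < val P (h j)"
  shows "sum h A \<noteq> 0 \<and> val P (sum h A) = val P (h i)"
proof -
  have "vge P (val P (h i) + 1) (sum h (A - {i}))" using assms(4) by (intro vge_sum) (fastforce simp: vge_def)
  then show ?thesis using val_add_eq[OF assms(3)] assms(1,2) by (simp add: sum.remove)
qed

end

section \<open>Approximation and the sum of the local degrees\<close>

text \<open>A translation maps each fibre of \<open>f\<close> into \<open>W\<close>. This bounds a
  space by a choice of coordinates \<open>f\<close> that need not be additive.\<close>

lemma card_le_fibres:
  fixes f :: "'a::ab_group_add \<Rightarrow> 'b"
  assumes "finite W" "finite T" "f ` V \<subseteq> T" "\<And>v v'. v \<in> V \<Longrightarrow> v' \<in> V \<Longrightarrow> f v = f v' \<Longrightarrow> v - v' \<in> W"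
  shows "finite V" "card V \<le> card T * card W"
proof -
  define r where "r \<tau> = (SOME v. v \<in> V \<and> f v = \<tau>)" for \<tau>
  have r: "r (f v) \<in> V \<and> f (r (f v)) = f v" if "v \<in> V" for v
    using that unfolding r_def by (intro someI[of "\<lambda>w. w \<in> V \<and> f w = f v" v]) auto
  define g where "g v = (f v, v - r (f v))" for v
  have "inj_on g V" by (auto simp: inj_on_def g_def)
  moreover have "g ` V \<subseteq> T \<times> W" using assms(3,4) r by (auto simp: g_def)
  ultimately show "finite V" "card V \<le> card T * card W"
    using assms(1,2) by (metis finite_SigmaI inj_on_finite, metis card_cartesian_product card_inj_on_le finite_SigmaI)
qed

lemma two_le_card: "2 \<le> CARD('k::{field,finite})"
proof -
  have "card {0, 1 :: 'k} \<le> CARD('k)" by (intro card_mono) auto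
  then show ?thesis by simp
qed

locale function_field = field_extension emb for emb :: "'k::{field,finite} \<Rightarrow> 'a::field" +
  assumes finite_over: "P \<in> places emb \<Longrightarrow> \<exists>z N. z \<in> P \<and> z \<noteq> 0 \<and> degree_bound emb z N"
begin

lemma discrete_place: "P \<in> places emb \<Longrightarrow> discrete_place emb P"
proof -
  assume P: "P \<in> places emb"
  interpret place emb P by unfold_locales (rule P)
  show ?thesis using finite_over[OF P] discrete_placeI by blast
qed

text \<open>Discrete valuation rings are maximal proper subrings. If some \<open>t\<close> in
  \<open>P\<close> were a unit of the larger ring, then \<open>a\<close> in \<open>P'\<close>
  divides a power of \<open>t\<close> in the smaller ring, and so \<open>a\<close> would be a unit
  of the larger one.\<close>

lemma place_eqI:
  assumes P: "P \<in> places emb" and P': "P' \<in> places emb" and sub: "ring_at P \<subseteq> ring_at P'"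
  shows "P = P'"
proof -
  interpret p: discrete_place emb P using discrete_place[OF P] .
  interpret p': discrete_place emb P' using discrete_place[OF P'] .
  have "a \<in> P" if "a \<in> P'" for a
  proof (cases "a = 0")
    case False
    then have "inverse a \<notin> ring_at P'" using that p'.mem_P_iff by simp
    then have "inverse a \<notin> ring_at P" using sub by blast
    then show ?thesis using p.ring_or_inverse[of a] p.mem_P_iff by simp
  qed simp
  then have "P' \<subseteq> P" by blast
  obtain a where "prime_element P' a" using p'.ex_prime by blast
  then have a: "a \<in> P'" "a \<noteq> 0" using p'.prime_nonzero prime_elementD(1) by blast+
  have "P \<subseteq> P'"
  proof
    fix t assume t: "t \<in> P"
    show "t \<in> P'"
    proof (rule ccontr)
      assume t': "t \<notin> P'"
      then have t0: "t \<noteq> 0" by auto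
      have "t \<in> ring_at P'" using t p.P_subset sub by blast
      then have "inverse t \<in> ring_at P'" using t' p'.mem_P_iff by blast
      define k where "k = nat (val P a)"
      have va: "val P a > 0" "val P t > 0" using a \<open>P' \<subseteq> P\<close> t t0 p.val_pos_iff by auto
      then have "val P (t ^ k / a) \<ge> 0" using t0 a
        by (simp add: p.val_divide p.val_power k_def)
      then have "t ^ k / a \<in> ring_at P" using p.val_nonneg_iff t0 a by simp
      then have "t ^ k / a * inverse t ^ k \<in> ring_at P'" using sub \<open>inverse t \<in> ring_at P'\<close>
        by (intro p'.ring_mult p'.ring_power) auto
      then have "inverse a \<in> ring_at P'" using t0 by (simp add: field_simps)
      then show False using a p'.mem_P_iff by blast
    qed
  qed
  then show ?thesis using \<open>P' \<subseteq> P\<close> by blast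
qed

lemma separate_two:
  assumes P: "P \<in> places emb" and P': "P' \<in> places emb" and "P \<noteq> P'"
  obtains z where "z \<noteq> 0" "val P z > 0" "val P' z < 0"
proof -
  interpret p: discrete_place emb P using discrete_place[OF P] .
  interpret p': discrete_place emb P' using discrete_place[OF P'] .
  obtain u w where u: "u \<in> ring_at P" "u \<notin> ring_at P'" "w \<in> ring_at P'" "w \<notin> ring_at P"
    using place_eqI[OF P P'] place_eqI[OF P' P] assms(3) by blast
  then have nz: "u \<noteq> 0" "w \<noteq> 0" by auto
  have "val P u \<ge> 0" "val P' u < 0" "val P w < 0" "val P' w \<ge> 0"
    using u nz p.val_nonneg_iff p'.val_nonneg_iff by (auto simp: not_le[symmetric])
  then have "val P (u / w) > 0" "val P' (u / w) < 0" "u / w \<noteq> 0"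
    using nz by (auto simp: p.val_divide p'.val_divide)
  then show ?thesis using that by blast
qed

lemma separate:
  assumes "finite S" "P \<notin> S" "P \<in> places emb" "S \<subseteq> places emb"
  shows "\<exists>z. z \<noteq> 0 \<and> val P z > 0 \<and> (\<forall>P'\<in>S. val P' z < 0)"
  using assms
proof (induction S rule: finite_induct)
  case empty
  interpret p: discrete_place emb P using discrete_place empty by blast
  show ?case using p.ex_prime p.val_prime p.prime_nonzero by (metis empty_iff zero_less_one)
next
  case (insert R S)
  interpret p: discrete_place emb P using discrete_place insert by blast
  obtain y where y: "y \<noteq> 0" "val P y > 0" "\<And>P'. P' \<in> S \<Longrightarrow> val P' y < 0" using insert by auto
  obtain z where z: "z \<noteq> 0" "val P z > 0" "val R z < 0" using separate_two[of P R] insert by auto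
  \<comment> \<open>The exponents \<open>r\<close> for which \<open>y\<close> and \<open>z^r\<close>
    may have the same valuation at one of the places. For any other \<open>r\<close> the sum
    \<open>y + z^r\<close> takes the smaller of the two valuations, which is negative.\<close>
  define bad where "bad = (\<lambda>P'. nat (val P' y div val P' z)) ` insert R S"
  have "finite bad" using insert by (simp add: bad_def)
  then obtain r where r: "r > 0" "r \<notin> bad" by (metis finite_nat_set_iff_bounded gr0I not_less_zero finite_insert infinite_UNIV_nat ex_new_if_finite insertCI)
  have neq: "val P' y \<noteq> int r * val P' z" if "P' \<in> insert R S" "val P' z \<noteq> 0" for P'
    using that r unfolding bad_def by force
  have "vge P 1 (y + z ^ r)" using y z r
    by (intro p.vge_add) (auto simp: vge_def p.val_power pos_imp_zdiv_pos_iff int_one_le_iff_zero_less)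
  moreover have neg: "y + z ^ r \<noteq> 0 \<and> val P' (y + z ^ r) < 0" if P': "P' \<in> insert R S" for P'
  proof -
    interpret p': discrete_place emb P' using discrete_place P' insert by blast
    have vz: "val P' (z ^ r) = int r * val P' z" using z by (simp add: p'.val_power)
    have "val P' y \<noteq> int r * val P' z"
    proof (cases "val P' z = 0")
      case True
      then show ?thesis using P' y z by force
    qed (use neq P' in auto)
    moreover have "val P' y < 0 \<or> int r * val P' z < 0" using P' y z r by (auto simp: mult_pos_neg)
    ultimately consider "val P' y < 0" "val P' y < val P' (z ^ r)" | "val P' (z ^ r) < 0" "val P' (z ^ r) < val P' y"
      using vz by linarith
    then show ?thesis
    proof cases
      case 1
      then have "vge P' (val P' y + 1) (z ^ r)" by (auto simp: vge_def)
      then show ?thesis using p'.val_add_eq[OF y(1)] 1 by simp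
    next
      case 2
      then have "vge P' (val P' (z ^ r) + 1) y" by (auto simp: vge_def)
      then show ?thesis using p'.val_add_eq[of "z ^ r" y] z 2 by (simp add: add.commute)
    qed
  qed
  moreover have "y + z ^ r \<noteq> 0" using neg by blast
  ultimately show ?case by (intro exI[of _ "y + z ^ r"]) (auto simp: vge_def)
qed

lemma approximation:
  fixes k :: int
  assumes "finite S" "P \<notin> S" "P \<in> places emb" "S \<subseteq> places emb"
  obtains e where "vge P k (e - a)" "\<And>P'. P' \<in> S \<Longrightarrow> vge P' k e"
proof -
  interpret p: discrete_place emb P using discrete_place assms by blast
  obtain z where z: "z \<noteq> 0" "val P z > 0" "\<And>P'. P' \<in> S \<Longrightarrow> val P' z < 0" using separate[OF assms] by blast
  define r where "r = Suc (\<Sum>P'\<in>insert P S. nat \<bar>k\<bar> + nat \<bar>val P' a\<bar>)"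
  have r: "int r > k - val P' a" if "P' \<in> insert P S" for P'
  proof -
    have "nat \<bar>k\<bar> + nat \<bar>val P' a\<bar> \<le> (\<Sum>P'\<in>insert P S. nat \<bar>k\<bar> + nat \<bar>val P' a\<bar>)"
      using assms(1) that by (intro member_le_sum) auto
    then show ?thesis unfolding r_def by linarith
  qed
  have r0: "r > 0" by (simp add: r_def)
  have vz: "int r \<le> val P (z ^ r)" using z mult_left_mono[of 1 "val P z" "int r"] by (simp add: p.val_power)
  then have one: "1 + z ^ r \<noteq> 0 \<and> val P (1 + z ^ r) = 0"
    using p.val_add_eq[of 1 "z ^ r"] r0 by (simp add: vge_def)
  \<comment> \<open>The factor \<open>1 + z^r\<close> is close to 1 at \<open>P\<close> and has a
    pole of order at least \<open>r\<close> at the places in \<open>S\<close>; dividing by it hardly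
    changes \<open>a\<close> at \<open>P\<close> and makes it small on \<open>S\<close>.\<close>
  show ?thesis
  proof (rule that[of "a / (1 + z ^ r)"])
    have "a / (1 + z ^ r) - a = - (a * (z ^ r / (1 + z ^ r)))" using one by (simp add: field_simps)
    moreover have "vge P (val P a + int r) (a * (z ^ r / (1 + z ^ r)))"
      using one vz z by (intro p.vge_mult) (auto simp: vge_def p.val_divide)
    then have "vge P k (a * (z ^ r / (1 + z ^ r)))" by (rule p.vge_mono) (use r[of P] in simp)
    ultimately show "vge P k (a / (1 + z ^ r) - a)" by simp
  next
    fix P' assume P': "P' \<in> S"
    interpret p': discrete_place emb P' using discrete_place assms P' by blast
    have v: "val P' (z ^ r) \<le> - int r" using z(1) z(3)[OF P'] r0
      by (simp add: p'.val_power) (metis mult_left_mono of_nat_0_le_iff mult_minus1_right zle_add1_eq_le add.left_neutral add_uminus_conv_diff diff_add_cancel)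
    then have "vge P' (val P' (z ^ r) + 1) 1" using r0 by (simp add: vge_def)
    then have "z ^ r + 1 \<noteq> 0 \<and> val P' (z ^ r + 1) = val P' (z ^ r)" using p'.val_add_eq[of "z ^ r" 1] z by simp
    then have "1 + z ^ r \<noteq> 0 \<and> val P' (1 + z ^ r) \<le> - int r" using v by (simp add: add.commute)
    then show "vge P' k (a / (1 + z ^ r))" using r[of P'] P' by (cases "a = 0") (auto simp: vge_def p'.val_divide)
  qed
qed

section \<open>Residue fields and the degree of a place\<close>

lemma residue_basis_exists:
  assumes P: "P \<in> places emb"
  obtains B where "residue_basis emb P B"
proof -
  interpret p: discrete_place emb P using discrete_place[OF P] .
  obtain z N where z: "z \<in> P" "z \<noteq> 0" "degree_bound emb z N" using finite_over[OF P] by blast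
  define indep where "indep B \<longleftrightarrow> finite B \<and> B \<subseteq> ring_at P \<and> (\<forall>c. (\<Sum>b\<in>B. emb (c b) * b) \<in> P \<longrightarrow> (\<forall>b\<in>B. c b = 0))" for B
  \<comment> \<open>As \<open>z\<close> lies in \<open>P\<close>, a relation over
    \<open>K[z]\<close> with a nonzero constant coefficient reduces modulo \<open>P\<close> to a
    nontrivial relation over \<open>K\<close>. Hence an independent set of largest size exists, and
    it spans.\<close>
  have bound: "card B \<le> N" if B: "indep B" for B
  proof (rule ccontr)
    assume "\<not> card B \<le> N"
    then obtain c where c: "\<exists>b\<in>B. coeff (c b) 0 \<noteq> 0" "(\<Sum>b\<in>B. eval1 emb z (c b) * b) = 0"
      using degree_boundD[OF z(3), of B "\<lambda>b. b"] B by (auto simp: indep_def)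
    have "(\<Sum>b\<in>B. eval1 emb z (c b) * b - emb (coeff (c b) 0) * b) \<in> P"
    proof (rule p.P_sum)
      fix b assume b: "b \<in> B"
      obtain a r where ar: "c b = pCons a r" by (cases "c b")
      have "z * eval1 emb z r * b \<in> P" using b B
        by (intro p.P_mult'[OF p.P_mult'[OF z(1)]] p.eval1_in_ring p.P_subset[OF z(1)]) (auto simp: indep_def)
      then show "eval1 emb z (c b) * b - emb (coeff (c b) 0) * b \<in> P" by (simp add: ar algebra_simps)
    qed
    then have "- (\<Sum>b\<in>B. emb (coeff (c b) 0) * b) \<in> P" by (simp add: sum_subtractf c(2))
    then have "(\<Sum>b\<in>B. emb (coeff (c b) 0) * b) \<in> P" using p.P_uminus by fastforce
    then have "\<forall>b\<in>B. coeff (c b) 0 = 0" using B unfolding indep_def by (elim conjE allE[of _ "\<lambda>b. coeff (c b) 0"]) auto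
    with c(1) show False by blast
  qed
  have "indep {}" by (simp add: indep_def)
  then obtain B where B: "indep B" and max: "\<And>B'. indep B' \<Longrightarrow> card B' \<le> card B"
    using ex_has_greatest_nat[of indep "{}" card "Suc N"] bound le_imp_less_Suc by blast
  have "\<exists>c. w - (\<Sum>b\<in>B. emb (c b) * b) \<in> P" if w: "w \<in> ring_at P" for w
  proof (rule ccontr)
    assume no: "\<nexists>c. w - (\<Sum>b\<in>B. emb (c b) * b) \<in> P"
    have wB: "w \<notin> B"
    proof
      assume "w \<in> B"
      then have "(\<Sum>b\<in>B. emb (if b = w then 1 else 0) * b) = w" using B
        by (subst sum.remove[of _ w]) (auto simp: indep_def)
      then show False using no by (metis diff_self p.P_0)
    qed
    have "indep (insert w B)"
      unfolding indep_def
    proof (intro conjI allI impI)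
      fix c assume s: "(\<Sum>b\<in>insert w B. emb (c b) * b) \<in> P"
      then have s': "emb (c w) * w + (\<Sum>b\<in>B. emb (c b) * b) \<in> P" using B wB by (simp add: indep_def)
      have "c w = 0"
      proof (rule ccontr)
        assume cw: "c w \<noteq> 0"
        have "emb (inverse (c w)) * (emb (c w) * w + (\<Sum>b\<in>B. emb (c b) * b)) \<in> P" using s' by (intro p.P_mult) auto
        moreover have "emb (inverse (c w)) * (emb (c w) * w + (\<Sum>b\<in>B. emb (c b) * b))
            = w - (\<Sum>b\<in>B. emb (- (inverse (c w) * c b)) * b)"
          using cw by (simp add: ring_distribs sum_distrib_left emb_mult emb_uminus sum_negf mult.assoc emb_inverse)
        ultimately show False using no by metis
      qed
      moreover from this have "\<forall>b\<in>B. c b = 0" using s' B by (simp add: indep_def)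
      ultimately show "\<forall>b\<in>insert w B. c b = 0" by blast
    qed (use B w in \<open>auto simp: indep_def\<close>)
    then show False using max[of "insert w B"] B wB by (simp add: indep_def)
  qed
  then show ?thesis using that[of B] B by (simp add: residue_basis_def indep_def)
qed

text \<open>Counting replaces an exchange argument: the combinations of \<open>B\<close> inject into
  those of \<open>C\<close>, because both represent residue classes and \<open>K\<close> is
  finite.\<close>

lemma card_residue_basis_le:
  assumes P: "P \<in> places emb" and B: "residue_basis emb P B" and C: "residue_basis emb P C"
  shows "card B \<le> card C"
proof -
  interpret p: discrete_place emb P using discrete_place[OF P] .
  let ?V = "B \<rightarrow>\<^sub>E (UNIV :: 'k set)" and ?W = "C \<rightarrow>\<^sub>E (UNIV :: 'k set)"
  have fin: "finite B" "finite C" using B C by (auto simp: residue_basis_def)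
  have "\<exists>d\<in>?W. (\<Sum>b\<in>B. emb (c b) * b) - (\<Sum>b\<in>C. emb (d b) * b) \<in> P" for c
  proof -
    have "(\<Sum>b\<in>B. emb (c b) * b) \<in> ring_at P" using B by (intro p.ring_sum p.ring_mult) (auto simp: residue_basis_def)
    then obtain d where "(\<Sum>b\<in>B. emb (c b) * b) - (\<Sum>b\<in>C. emb (d b) * b) \<in> P"
      using C unfolding residue_basis_def by blast
    moreover have "(\<Sum>b\<in>C. emb (d b) * b) = (\<Sum>b\<in>C. emb (restrict d C b) * b)" by (intro sum.cong) auto
    ultimately have "(\<Sum>b\<in>B. emb (c b) * b) - (\<Sum>b\<in>C. emb (restrict d C b) * b) \<in> P" by (simp only:)
    moreover have "restrict d C \<in> ?W" by simp
    ultimately show ?thesis by blast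
  qed
  then have "\<forall>c. \<exists>d. d \<in> ?W \<and> (\<Sum>b\<in>B. emb (c b) * b) - (\<Sum>b\<in>C. emb (d b) * b) \<in> P" by blast
  from choice[OF this] obtain g
    where g: "\<And>c. g c \<in> ?W" "\<And>c. (\<Sum>b\<in>B. emb (c b) * b) - (\<Sum>b\<in>C. emb (g c b) * b) \<in> P" by blast
  have "inj_on g ?V"
  proof (rule inj_onI)
    fix c c' assume c: "c \<in> ?V" "c' \<in> ?V" "g c = g c'"
    have "((\<Sum>b\<in>B. emb (c b) * b) - (\<Sum>b\<in>C. emb (g c b) * b)) - ((\<Sum>b\<in>B. emb (c' b) * b) - (\<Sum>b\<in>C. emb (g c' b) * b)) \<in> P"
      using g(2) p.P_diff by blast
    then have "(\<Sum>b\<in>B. emb (c b - c' b) * b) \<in> P" by (simp add: c(3) emb_diff left_diff_distrib sum_subtractf)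
    then have "\<forall>b\<in>B. c b - c' b = 0" using B unfolding residue_basis_def by (elim conjE allE[of _ "\<lambda>b. c b - c' b"]) auto
    then show "c = c'" using c(1,2) by (intro PiE_ext) auto
  qed
  then have "card ?V \<le> card ?W" using g(1) fin by (intro card_inj_on_le[of g]) (auto intro: finite_PiE)
  then have "CARD('k) ^ card B \<le> CARD('k) ^ card C" using fin by (simp add: card_PiE)
  moreover have "1 < CARD('k)" using two_le_card[where 'k = 'k] by simp
  ultimately show ?thesis by (rule power_le_imp_le_exp[rotated])
qed

lemma place_degree_eq: "P \<in> places emb \<Longrightarrow> residue_basis emb P B \<Longrightarrow> place_degree emb P = card B"
  unfolding place_degree_def
  by (rule the_equality) (auto intro: antisym card_residue_basis_le)

text \<open>The elements that approximate \<open>t\<^sub>P\<^sup>i b\<close> at \<open>P\<close> and \<open>0\<close> at the other places in \<open>S\<close>, for \<open>i < v\<^sub>P(z)\<close> and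
  \<open>b\<close> in a residue basis, are linearly independent modulo \<open>z\<close> and hence over \<open>K(z)\<close>.\<close>
lemma sum_local_degrees_le:
  assumes S: "finite S" "S \<subseteq> places emb" and z: "z \<noteq> 0" "\<And>P. P \<in> S \<Longrightarrow> z \<in> P" and N: "degree_bound emb z N"
  shows "(\<Sum>P\<in>S. val P z * int (place_degree emb P)) \<le> int N"
proof -
  have disc: "discrete_place emb P" if "P \<in> S" for P using discrete_place that S by blast
  have "\<forall>P\<in>S. \<exists>B. residue_basis emb P B" using residue_basis_exists S by blast
  from bchoice[OF this] obtain B where B: "\<And>P. P \<in> S \<Longrightarrow> residue_basis emb P (B P)" by blast
  then have finB: "\<And>P. P \<in> S \<Longrightarrow> finite (B P)" by (simp add: residue_basis_def)
  have "\<forall>P\<in>S. \<exists>t. prime_element P t" using disc discrete_place.ex_prime by blast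
  from bchoice[OF this] obtain t where t: "\<And>P. P \<in> S \<Longrightarrow> prime_element P (t P)" by blast
  \<comment> \<open>Approximation to order \<open>r\<close> is fine enough for every level
    \<open>i\<close>, since \<open>i + 1 \<le> val P z \<le> r\<close>.\<close>
  define r where "r = (\<Sum>P\<in>S. \<bar>val P z\<bar>)"
  have r: "val P z \<le> r" if "P \<in> S" for P
    using member_le_sum[of P S "\<lambda>P. \<bar>val P z\<bar>"] S that unfolding r_def by force
  define J where "J = (SIGMA P:S. {..<nat (val P z)} \<times> B P)"
  have finJ: "finite J" using S finB by (auto simp: J_def)
  define good where "good P i b e \<longleftrightarrow> vge P r (e - t P ^ i * b) \<and> (\<forall>P'\<in>S - {P}. vge P' r e)" for P i b e
  have ex: "\<exists>e. good P i b e" if PS: "P \<in> S" for P i b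
  proof -
    obtain e where "vge P r (e - t P ^ i * b)" "\<And>P'. P' \<in> S - {P} \<Longrightarrow> vge P' r e"
      by (rule approximation[of "S - {P}" P r "t P ^ i * b"]) (use S PS in auto)
    then show ?thesis unfolding good_def by blast
  qed
  have good: "good P i b (SOME e. good P i b e)" if "P \<in> S" for P i b by (rule someI_ex[OF ex[OF that]])
  define e where "e P i b = (SOME e. good P i b e)" for P i b
  have e: "vge P r (e P i b - t P ^ i * b)" "P' \<in> S \<Longrightarrow> P' \<noteq> P \<Longrightarrow> vge P' r (e P i b)" if "P \<in> S" for P i b P'
    using good[OF that, of i b] unfolding e_def[symmetric] by (auto simp: good_def)
  have "card J \<le> N"
  proof (rule ccontr)
    assume "\<not> card J \<le> N"
    then obtain c where c: "\<exists>j\<in>J. coeff (c j) 0 \<noteq> 0" "(\<Sum>j\<in>J. eval1 emb z (c j) * (case j of (P, i, b) \<Rightarrow> e P i b)) = 0"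
      using degree_boundD[OF N finJ, of "\<lambda>(P, i, b). e P i b"] by auto
    then obtain P i0 b0 where j0: "(P, i0, b0) \<in> J" "coeff (c (P, i0, b0)) 0 \<noteq> 0" by auto
    then have PS: "P \<in> S" by (simp add: J_def)
    interpret p: discrete_place emb P using disc[OF PS] .
    \<comment> \<open>The lowest level at \<open>P\<close> with a nonzero constant coefficient. Up
      to valuation \<open>i1 + 1\<close> only this level survives: elements belonging to other
      places are small at \<open>P\<close>, lower levels have coefficients divisible by
      \<open>z\<close>, and higher levels carry a higher power of \<open>t P\<close>.\<close>
    define i1 where "i1 = (LEAST i. \<exists>b. (P, i, b) \<in> J \<and> coeff (c (P, i, b)) 0 \<noteq> 0)"
    have "\<exists>b. (P, i1, b) \<in> J \<and> coeff (c (P, i1, b)) 0 \<noteq> 0"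
      unfolding i1_def by (rule LeastI[of _ i0]) (use j0 in blast)
    then obtain b1 where b1: "(P, i1, b1) \<in> J" "coeff (c (P, i1, b1)) 0 \<noteq> 0" by blast
    have less: "coeff (c (P, i, b)) 0 = 0" if "i < i1" "(P, i, b) \<in> J" for i b
      using not_less_Least[of i "\<lambda>i. \<exists>b. (P, i, b) \<in> J \<and> coeff (c (P, i, b)) 0 \<noteq> 0"] that unfolding i1_def[symmetric] by blast
    have i1: "int i1 + 1 \<le> val P z" "i1 < nat (val P z)" using b1 by (auto simp: J_def)
    then have i1r: "int i1 + 1 \<le> r" using r[OF PS] by linarith
    define g where "g j = (case j of (P', i, b) \<Rightarrow> if P' = P \<and> i = i1 then emb (coeff (c j) 0) * (t P ^ i1 * b) else 0)" for j
    have vt: "vge P (int i) (t P ^ i)" for i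
      using p.vge_power[of 1 "t P" i] p.vge_P_iff t[OF PS] by (simp add: prime_elementD)
    have vb: "vge P 0 b" if "b \<in> B P" for b using B[OF PS] that p.vge_ring_iff by (auto simp: residue_basis_def)
    have vzP: "vge P (val P z) z" by (simp add: vge_def)
    have zO: "z \<in> ring_at P" using z(2)[OF PS] p.P_subset by blast
    have tm: "vge P (int i1 + 1) (eval1 emb z (c j) * (case j of (P, i, b) \<Rightarrow> e P i b) - g j)" if j: "j \<in> J" for j
    proof -
      obtain P' i b where j': "j = (P', i, b)" by (cases j)
      have P': "P' \<in> S" using j by (simp add: J_def j')
      have ev: "vge P 0 (eval1 emb z q)" for q using p.eval1_in_ring[OF zO] p.vge_ring_iff by blast
      show ?thesis
      proof (cases "P' = P")
        case False
        then have "vge P (0 + r) (eval1 emb z (c j) * e P' i b)" by (intro p.vge_mult ev e(2)) (use P' PS in auto)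
        then show ?thesis using False i1r by (auto simp: g_def j' intro: p.vge_mono)
      next
        case True
        then have b: "b \<in> B P" using j by (auto simp: J_def j')
        obtain a q where aq: "c j = pCons a q" by (cases "c j")
        have 1: "vge P (0 + r) (eval1 emb z (c j) * (e P i b - t P ^ i * b))"
          by (intro p.vge_mult ev e(1) PS)
        have "vge P (val P z + 0 + (int i + 0)) (z * eval1 emb z q * (t P ^ i * b))"
          by (intro p.vge_mult ev vt vb b vzP)
        then have 2: "vge P (int i1 + 1) (z * eval1 emb z q * (t P ^ i * b))" using i1 by (auto intro: p.vge_mono)
        have "vge P (0 + (int i + 0)) (emb a * (t P ^ i * b))" by (intro p.vge_mult p.vge_emb vt vb b)
        then have 3: "vge P (int i1 + 1) (emb a * (t P ^ i * b) - g j)"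
          using less[of i b] j True aq by (cases i i1 rule: linorder_cases) (auto simp: g_def j' intro: p.vge_mono)
        have "eval1 emb z (c j) * e P i b - g j = eval1 emb z (c j) * (e P i b - t P ^ i * b)
            + (z * eval1 emb z q * (t P ^ i * b) + (emb a * (t P ^ i * b) - g j))"
          by (simp add: aq algebra_simps)
        moreover have "vge P (int i1 + 1) \<dots>" using 1 2 3 i1r by (intro p.vge_add) (auto intro: p.vge_mono)
        ultimately show ?thesis unfolding j' True[symmetric] prod.case by (simp only: True)
      qed
    qed
    have "vge P (int i1 + 1) (\<Sum>j\<in>J. eval1 emb z (c j) * (case j of (P, i, b) \<Rightarrow> e P i b) - g j)"
      by (intro p.vge_sum tm)
    then have v: "vge P (int i1 + 1) (sum g J)" by (simp add: sum_subtractf c(2))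
    have "sum g J = sum g ((\<lambda>b. (P, i1, b)) ` B P)"
      using finJ i1 PS by (intro sum.mono_neutral_right) (auto simp: J_def g_def)
    also have "\<dots> = (\<Sum>b\<in>B P. emb (coeff (c (P, i1, b)) 0) * (t P ^ i1 * b))"
      by (subst sum.reindex) (auto simp: inj_on_def g_def)
    also have "\<dots> = t P ^ i1 * (\<Sum>b\<in>B P. emb (coeff (c (P, i1, b)) 0) * b)" by (simp add: sum_distrib_left mult_ac)
    finally have "vge P (int i1 + 1) (t P ^ i1 * (\<Sum>b\<in>B P. emb (coeff (c (P, i1, b)) 0) * b))" using v by (simp only:)
    moreover have "t P \<noteq> 0" "val P (t P ^ i1) = int i1" using p.prime_nonzero[OF t[OF PS]] p.val_prime[OF t[OF PS]] p.val_power by auto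
    ultimately have "vge P 1 (\<Sum>b\<in>B P. emb (coeff (c (P, i1, b)) 0) * b)"
      by (cases "(\<Sum>b\<in>B P. emb (coeff (c (P, i1, b)) 0) * b) = 0") (auto simp: vge_def p.val_mult)
    then have "(\<Sum>b\<in>B P. emb (coeff (c (P, i1, b)) 0) * b) \<in> P" by (simp only: p.vge_P_iff)
    then have "\<forall>b\<in>B P. coeff (c (P, i1, b)) 0 = 0" using B[OF PS] unfolding residue_basis_def
      by (elim conjE allE[of _ "\<lambda>b. coeff (c (P, i1, b)) 0"]) auto
    then show False using b1 by (auto simp: J_def)
  qed
  moreover have "card J = (\<Sum>P\<in>S. nat (val P z) * card (B P))" using S finB by (simp add: J_def card_cartesian_product)
  moreover have "int (nat (val P z) * card (B P)) = val P z * int (place_degree emb P)" if "P \<in> S" for P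
  proof -
    interpret p: discrete_place emb P using disc[OF that] .
    have "val P z > 0" using z that p.val_pos_iff by blast
    moreover have "place_degree emb P = card (B P)" using place_degree_eq B that S by blast
    ultimately show ?thesis by simp
  qed
  ultimately show ?thesis by (metis (mono_tags, lifting) of_nat_le_iff of_nat_sum sum.cong)
qed

section \<open>Riemann-Roch spaces and their dimensions by counting\<close>

lemma card_power_le_iff: "CARD('k) ^ a \<le> CARD('k) ^ b \<longleftrightarrow> a \<le> b"
  using two_le_card[where 'k = 'k] by (intro power_increasing_iff) simp

text \<open>This makes \<open>ell\<close> a logarithm of a cardinality: injections give inequalities
  of dimensions, and bounds for index and fibres give bounds for their growth.\<close>

lemma card_finite_subspace:
  assumes "module.subspace (\<lambda>c z. emb c * z) V" "finite V"
  shows "card V = CARD('k) ^ vector_space.dim (\<lambda>c z. emb c * z) V"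
proof -
  interpret vs: vector_space "\<lambda>c z. emb c * z" by (rule vector_space_emb[OF field_embedding])
  obtain B where B: "B \<subseteq> V" "vs.independent B" "V \<subseteq> vs.span B" "card B = vs.dim V"
    using vs.basis_exists by blast
  have finB: "finite B" using B(1) assms(2) finite_subset by blast
  have span: "vs.span B = V" using B assms(1) by (simp add: vs.span_minimal subset_antisym)
  define h where "h c = (\<Sum>b\<in>B. emb (c b) * b)" for c
  have "bij_betw h (B \<rightarrow>\<^sub>E UNIV) V"
    unfolding bij_betw_def
  proof
    show "inj_on h (B \<rightarrow>\<^sub>E UNIV)"
    proof (rule inj_onI)
      fix c d assume *: "c \<in> B \<rightarrow>\<^sub>E UNIV" "d \<in> B \<rightarrow>\<^sub>E UNIV" "h c = h d"
      have "(\<Sum>b\<in>B. emb (c b - d b) * b) = 0" using *(3) by (simp add: h_def emb_diff left_diff_distrib sum_subtractf)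
      moreover have "\<forall>u. (\<Sum>b\<in>B. emb (u b) * b) = 0 \<longrightarrow> (\<forall>b\<in>B. u b = 0)"
        using B(2)[unfolded vs.independent_explicit_finite_subsets] finB by blast
      ultimately have "\<forall>b\<in>B. c b - d b = 0" by (elim allE[of _ "\<lambda>b. c b - d b"]) blast
      then show "c = d" using * by (intro PiE_ext) auto
    qed
    show "h ` (B \<rightarrow>\<^sub>E UNIV) = V"
    proof (intro equalityI subsetI)
      fix z assume "z \<in> V"
      then have "z \<in> range (\<lambda>c. \<Sum>b\<in>B. emb (c b) * b)" using span vs.span_finite[OF finB] by simp
      then obtain c where "z = (\<Sum>b\<in>B. emb (c b) * b)" by blast
      then have "z = h (restrict c B)" by (simp add: h_def)
      moreover have "restrict c B \<in> B \<rightarrow>\<^sub>E UNIV" by simp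
      ultimately show "z \<in> h ` (B \<rightarrow>\<^sub>E UNIV)" by (rule image_eqI)
    next
      fix z assume "z \<in> h ` (B \<rightarrow>\<^sub>E UNIV)"
      then show "z \<in> V" using assms(1) B(1) by (auto simp: h_def intro!: vs.subspace_sum vs.subspace_scale)
    qed
  qed
  then have "card V = card (B \<rightarrow>\<^sub>E (UNIV :: 'k set))" by (metis bij_betw_same_card)
  then show ?thesis using finB B(4) by (simp add: card_PiE)
qed

lemma RR_space_altdef: "RR_space emb A = {z. \<forall>P\<in>places emb. vge P (- Poly_Mapping.lookup A P) z}"
  by (auto simp: RR_space_def vge_def)

lemma subspace_RR_space: "module.subspace (\<lambda>c z. emb c * z) (RR_space emb A)"
proof -
  interpret vs: vector_space "\<lambda>c z. emb c * z" by (rule vector_space_emb[OF field_embedding])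
  have "vge P k (a + b)" if "P \<in> places emb" "vge P k a" "vge P k b" for P k a b
    using discrete_place discrete_place.vge_add that by blast
  moreover have "vge P k (emb c * a)" if "P \<in> places emb" "vge P k a" for P k a c
  proof -
    interpret discrete_place emb P using discrete_place[OF that(1)] .
    show ?thesis using vge_mult[OF vge_emb that(2)] by simp
  qed
  moreover have "vge P k 0" for P k by (simp add: vge_def)
  ultimately show ?thesis unfolding RR_space_altdef by (intro vs.subspaceI) auto
qed

lemma card_RR_space: "finite (RR_space emb A) \<Longrightarrow> card (RR_space emb A) = CARD('k) ^ ell emb A"
  unfolding ell_def by (rule card_finite_subspace[OF subspace_RR_space])

text \<open>Multiplication by \<open>s\<close> makes the functions of the larger space integral at
  \<open>P\<close>. The map \<open>f\<close> takes coordinates of the resulting residue class, and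
  functions with equal coordinates differ by an element of the smaller space.\<close>

lemma RR_space_add_place:
  assumes P: "P \<in> places emb" and fin: "finite (RR_space emb A)"
  shows "finite (RR_space emb (A + frag_of P))"
    and "card (RR_space emb (A + frag_of P)) \<le> CARD('k) ^ place_degree emb P * card (RR_space emb A)"
proof -
  interpret p: discrete_place emb P using discrete_place[OF P] .
  obtain B where B: "residue_basis emb P B" using residue_basis_exists[OF P] .
  then have finB: "finite B" by (simp add: residue_basis_def)
  obtain t where t: "prime_element P t" using p.ex_prime by blast
  let ?V = "RR_space emb (A + frag_of P)"
  define s where "s = t powi (Poly_Mapping.lookup A P + 1)"
  have vs: "val P s = Poly_Mapping.lookup A P + 1" "s \<noteq> 0"
    using p.val_power_int_prime[OF t] p.prime_nonzero[OF t] by (auto simp: s_def)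
  have sV: "s * z \<in> ring_at P" if "z \<in> ?V" for z
  proof -
    have "vge P (- (Poly_Mapping.lookup A P + 1)) z" using that P by (auto simp: RR_space_altdef lookup_add)
    then have "vge P (val P s + - (Poly_Mapping.lookup A P + 1)) (s * z)" by (intro p.vge_mult) (simp add: vge_def)
    then show ?thesis using p.vge_ring_iff vs by simp
  qed
  define f where "f z = restrict (SOME c. s * z - (\<Sum>b\<in>B. emb (c b) * b) \<in> P) B" for z
  have f: "s * z - (\<Sum>b\<in>B. emb (f z b) * b) \<in> P" if "z \<in> ?V" for z
  proof -
    have "\<exists>c. s * z - (\<Sum>b\<in>B. emb (c b) * b) \<in> P" using sV[OF that] B by (auto simp: residue_basis_def)
    from someI_ex[OF this] show ?thesis by (simp add: f_def)
  qed
  have diff: "v - v' \<in> RR_space emb A" if v: "v \<in> ?V" "v' \<in> ?V" "f v = f v'" for v v'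
  proof -
    have "(s * v - (\<Sum>b\<in>B. emb (f v b) * b)) - (s * v' - (\<Sum>b\<in>B. emb (f v' b) * b)) \<in> P"
      by (rule p.P_diff[OF f[OF v(1)] f[OF v(2)]])
    then have "s * (v - v') \<in> P" by (simp add: v(3) algebra_simps)
    then have "vge P 1 (s * (v - v'))" by (simp only: p.vge_P_iff)
    then have 1: "vge P (- Poly_Mapping.lookup A P) (v - v')"
      using vs by (cases "v = v'") (auto simp: vge_def p.val_mult)
    have "vge P' (- Poly_Mapping.lookup A P') (v - v')" if P': "P' \<in> places emb" "P' \<noteq> P" for P'
    proof -
      interpret p': discrete_place emb P' using discrete_place[OF P'(1)] .
      have "Poly_Mapping.lookup (A + frag_of P) P' = Poly_Mapping.lookup A P'"
        using P'(2) by (simp add: lookup_add)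
      then show ?thesis using v(1,2) P'(1) unfolding RR_space_altdef by (intro p'.vge_diff) force+
    qed
    with 1 show ?thesis by (auto simp: RR_space_altdef)
  qed
  have "f ` ?V \<subseteq> B \<rightarrow>\<^sub>E UNIV" "finite (B \<rightarrow>\<^sub>E (UNIV :: 'k set))" using finB by (auto simp: f_def intro!: finite_PiE)
  note le = card_le_fibres[OF fin this(2) this(1) diff]
  show "finite ?V" by (rule le(1))
  have "card (B \<rightarrow>\<^sub>E (UNIV :: 'k set)) = CARD('k) ^ place_degree emb P"
    unfolding place_degree_eq[OF P B] using finB by (simp add: card_PiE)
  then show "card ?V \<le> CARD('k) ^ place_degree emb P * card (RR_space emb A)"
    using le(2) by (simp only:)
qed

lemma div_degree_superset:
  assumes "finite S" "Poly_Mapping.keys A \<subseteq> S"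
  shows "div_degree emb A = (\<Sum>P\<in>S. Poly_Mapping.lookup A P * int (place_degree emb P))"
  unfolding div_degree_def using assms by (intro sum.mono_neutral_left) (auto simp: in_keys_iff)

lemma RR_space_add_effective:
  assumes "finite S" "S \<subseteq> places emb" "finite (RR_space emb A)"
  shows "finite (RR_space emb (A + (\<Sum>P\<in>S. frag_cmul (int (b P)) (frag_of P)))) \<and>
    card (RR_space emb (A + (\<Sum>P\<in>S. frag_cmul (int (b P)) (frag_of P))))
      \<le> CARD('k) ^ (\<Sum>P\<in>S. b P * place_degree emb P) * card (RR_space emb A)"
  using assms
proof (induction S rule: finite_induct)
  case (insert P S)
  define A' where "A' = A + (\<Sum>P\<in>S. frag_cmul (int (b P)) (frag_of P))"
  have A': "finite (RR_space emb A')"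
    "card (RR_space emb A') \<le> CARD('k) ^ (\<Sum>P\<in>S. b P * place_degree emb P) * card (RR_space emb A)"
    using insert by (auto simp: A'_def)
  have P: "P \<in> places emb" using insert by simp
  have *: "finite (RR_space emb (A' + frag_cmul (int k) (frag_of P))) \<and>
    card (RR_space emb (A' + frag_cmul (int k) (frag_of P))) \<le> CARD('k) ^ (k * place_degree emb P) * card (RR_space emb A')" for k
  proof (induction k)
    case 0
    then show ?case using A' by simp
  next
    case (Suc k)
    have eq: "A' + frag_cmul (int (Suc k)) (frag_of P) = A' + frag_cmul (int k) (frag_of P) + frag_of P"
      by (simp add: frag_cmul_distrib add_ac)
    note 1 = RR_space_add_place[OF P Suc.IH[THEN conjunct1]]
    have "card (RR_space emb (A' + frag_cmul (int (Suc k)) (frag_of P)))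
      \<le> CARD('k) ^ place_degree emb P * (CARD('k) ^ (k * place_degree emb P) * card (RR_space emb A'))"
      unfolding eq using 1(2) Suc.IH by (meson le_trans mult_le_mono2)
    then show ?case using 1(1) unfolding eq by (simp add: power_add mult_ac)
  qed
  have eq: "A + (\<Sum>P\<in>insert P S. frag_cmul (int (b P)) (frag_of P)) = A' + frag_cmul (int (b P)) (frag_of P)"
    using insert by (simp add: A'_def add_ac)
  have "card (RR_space emb (A' + frag_cmul (int (b P)) (frag_of P)))
     \<le> CARD('k) ^ (b P * place_degree emb P) * (CARD('k) ^ (\<Sum>P\<in>S. b P * place_degree emb P) * card (RR_space emb A))"
    using *[of "b P"] A'(2) by (meson le_trans mult_le_mono2)
  then show ?case unfolding eq using * insert by (simp add: power_add mult_ac)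
qed simp

lemma effective_eq_sum:
  assumes "\<And>P. Poly_Mapping.lookup C P \<ge> 0" "divisor emb C"
  obtains b S where "finite S" "S \<subseteq> places emb" "C = (\<Sum>P\<in>S. frag_cmul (int (b P)) (frag_of P))"
    "div_degree emb C = int (\<Sum>P\<in>S. b P * place_degree emb P)"
proof (rule that[of "Poly_Mapping.keys C" "\<lambda>P. nat (Poly_Mapping.lookup C P)"])
  show "C = (\<Sum>P\<in>Poly_Mapping.keys C. frag_cmul (int (nat (Poly_Mapping.lookup C P))) (frag_of P))"
    using assms(1) by (subst frag_expansion[of C]) (simp add: frag_extend_def)
qed (use assms in \<open>auto simp: divisor_def div_degree_def\<close>)

lemma ell_add_effective:
  assumes "\<And>P. Poly_Mapping.lookup C P \<ge> 0" "divisor emb C" "finite (RR_space emb A)"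
  shows "finite (RR_space emb (A + C))" "int (ell emb (A + C)) \<le> int (ell emb A) + div_degree emb C"
proof -
  obtain b S where S: "finite S" "S \<subseteq> places emb" and C: "C = (\<Sum>P\<in>S. frag_cmul (int (b P)) (frag_of P))"
    and deg: "div_degree emb C = int (\<Sum>P\<in>S. b P * place_degree emb P)"
    using effective_eq_sum[OF assms(1,2)] .
  note * = RR_space_add_effective[OF S assms(3), of b, folded C]
  then show fin: "finite (RR_space emb (A + C))" by blast
  define d where "d = (\<Sum>P\<in>S. b P * place_degree emb P)"
  have "CARD('k) ^ ell emb (A + C) \<le> CARD('k) ^ (d + ell emb A)"
    using * unfolding d_def[symmetric] by (simp add: card_RR_space[OF fin] card_RR_space[OF assms(3)] power_add)
  then show "int (ell emb (A + C)) \<le> int (ell emb A) + div_degree emb C"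
    unfolding deg d_def[symmetric] card_power_le_iff by simp
qed

lemma ell_eq_0_iff: "finite (RR_space emb A) \<Longrightarrow> ell emb A = 0 \<longleftrightarrow> RR_space emb A = {0}"
proof -
  assume fin: "finite (RR_space emb A)"
  have "0 \<in> RR_space emb A" by (simp add: RR_space_def)
  then have "card (RR_space emb A) = 1 \<longleftrightarrow> RR_space emb A = {0}" by (auto simp: card_1_singleton_iff)
  then show ?thesis using card_RR_space[OF fin] two_le_card[where 'k = 'k] by simp
qed

end

section \<open>The function field of the curve\<close>

lemma card_poly_degree_le:
  "finite {p :: 'k::{field,finite} poly. degree p \<le> s}"
  "card {p :: 'k::{field,finite} poly. degree p \<le> s} = CARD('k) ^ Suc s"
proof -
  have "finite {p :: 'k poly. degree p \<le> s} \<and> card {p :: 'k poly. degree p \<le> s} = CARD('k) ^ Suc s"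
  proof (induction s)
    case 0
    have "{p :: 'k poly. degree p \<le> 0} = (\<lambda>a. [:a:]) ` UNIV" by (auto elim: degree_eq_zeroE)
    moreover have "inj (\<lambda>a :: 'k. [:a:])" by (auto simp: inj_on_def)
    ultimately show ?case by (simp add: card_image)
  next
    case (Suc s)
    have "{p :: 'k poly. degree p \<le> Suc s} = (\<lambda>(a, p). pCons a p) ` (UNIV \<times> {p. degree p \<le> s})"
    proof (intro equalityI subsetI)
      fix p :: "'k poly" assume "p \<in> {p. degree p \<le> Suc s}"
      then show "p \<in> (\<lambda>(a, p). pCons a p) ` (UNIV \<times> {p. degree p \<le> s})"
        by (cases p) (auto simp: degree_pCons_eq_if split: if_splits)
    qed (auto simp: degree_pCons_eq_if)
    moreover have "inj_on (\<lambda>(a, p). pCons a p) (UNIV \<times> {p :: 'k poly. degree p \<le> s})" by (auto simp: inj_on_def)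
    ultimately show ?case using Suc by (simp add: card_image card_cartesian_product)
  qed
  then show "finite {p :: 'k poly. degree p \<le> s}" "card {p :: 'k poly. degree p \<le> s} = CARD('k) ^ Suc s" by auto
qed

lemma (in field_extension) eval1_pcompose: "eval1 emb z (pcompose p r) = eval1 emb (eval1 emb z r) p"
  by (induction p) (auto simp: pcompose_pCons eval1_add eval1_mult)

lemma poly_shift_monom_mult:
  fixes p :: "'k::comm_semiring_1 poly"
  assumes "\<And>i. i < k \<Longrightarrow> coeff p i = 0"
  shows "p = monom 1 k * poly_shift k p"
  using assms by (intro poly_eqI) (auto simp: coeff_monom_mult coeff_poly_shift not_less)

lemma (in field_extension) relation_normalize:
  assumes "z \<noteq> 0" "\<exists>i\<in>I. c i \<noteq> 0" "(\<Sum>i\<in>I. eval1 emb z (c i) * v i) = 0"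
  shows "\<exists>c'. (\<exists>i\<in>I. coeff (c' i) 0 \<noteq> 0) \<and> (\<Sum>i\<in>I. eval1 emb z (c' i) * v i) = 0"
proof -
  define k where "k = (LEAST k. \<exists>i\<in>I. coeff (c i) k \<noteq> 0)"
  have "\<exists>k. \<exists>i\<in>I. coeff (c i) k \<noteq> 0" using assms(2) leading_coeff_0_iff by blast
  then have k: "\<exists>i\<in>I. coeff (c i) k \<noteq> 0" unfolding k_def by (rule LeastI_ex)
  have less: "coeff (c i) l = 0" if "i \<in> I" "l < k" for i l
    using not_less_Least[of l "\<lambda>k. \<exists>i\<in>I. coeff (c i) k \<noteq> 0"] that unfolding k_def[symmetric] by blast
  define c' where "c' i = poly_shift k (c i)" for i
  have c: "c i = monom 1 k * c' i" if "i \<in> I" for i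
    unfolding c'_def by (rule poly_shift_monom_mult) (use less that in auto)
  have "z ^ k * (\<Sum>i\<in>I. eval1 emb z (c' i) * v i) = (\<Sum>i\<in>I. eval1 emb z (monom 1 k * c' i) * v i)"
    by (simp add: sum_distrib_left eval1_mult eval1_monom mult.assoc)
  also have "\<dots> = (\<Sum>i\<in>I. eval1 emb z (c i) * v i)" by (intro sum.cong refl) (simp flip: c)
  finally have "(\<Sum>i\<in>I. eval1 emb z (c' i) * v i) = 0" using assms(1,3) by simp
  moreover have "\<exists>i\<in>I. coeff (c' i) 0 \<noteq> 0" using k by (simp add: c'_def coeff_poly_shift)
  ultimately show ?thesis by blast
qed

locale curve = field_extension emb for emb :: "'k::{field,finite} \<Rightarrow> 'a::field" +
  fixes x y :: 'a and m :: nat and f :: "'k poly"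
  assumes m: "m \<ge> 2" and char: "\<not> CHAR('k) dvd m" and separable: "coprime f (pderiv f)"
    and degree_f: "degree f \<ge> 2" and coprime_degree: "coprime m (degree f)"
    and curve: "is_function_field_of_curve emb x y m f"
begin

abbreviation "n \<equiv> degree f"
abbreviation "ev \<equiv> eval1 emb x"

text \<open>The normal form of elements of \<open>K[x,y]\<close> modulo \<open>y^m = f\<close>.
  Uniqueness of the coordinates, \<open>comb_eq_iff\<close>, has to wait for the valuation at
  infinity.\<close>

definition comb :: "(nat \<Rightarrow> 'k poly) \<Rightarrow> 'a" where
  "comb a = (\<Sum>j<m. ev (a j) * y ^ j)"

abbreviation "coordinate_ring \<equiv> range comb"

lemma ev_eq_0_iff [simp]: "ev p = 0 \<longleftrightarrow> p = 0"
  using curve by (auto simp: is_function_field_of_curve_def)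

lemma y_power_m: "y ^ m = ev f"
  using curve by (simp add: is_function_field_of_curve_def)

lemma f_nonzero [simp]: "f \<noteq> 0" and y_nonzero [simp]: "y \<noteq> 0" and x_nonzero [simp]: "x \<noteq> 0"
proof -
  show "f \<noteq> 0" using degree_f by auto
  then have "y ^ m \<noteq> 0" by (simp add: y_power_m)
  then show "y \<noteq> 0" using m by auto
  have "ev [:0, 1:] \<noteq> 0" by (simp only: ev_eq_0_iff) simp
  then show "x \<noteq> 0" by simp
qed

lemma comb_add: "comb (\<lambda>j. a j + b j) = comb a + comb b"
  by (simp add: comb_def eval1_add distrib_right sum.distrib)

lemma comb_uminus: "comb (\<lambda>j. - a j) = - comb a"
  by (simp add: comb_def eval1_uminus sum_negf)

lemma comb_diff: "comb (\<lambda>j. a j - b j) = comb a - comb b"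
  by (simp add: comb_def eval1_diff left_diff_distrib sum_subtractf)

lemma comb_smult: "comb (\<lambda>j. p * a j) = ev p * comb a"
  by (simp add: comb_def eval1_mult sum_distrib_left mult.assoc)

lemma comb_sum: "comb (\<lambda>j. \<Sum>i\<in>I. a i j) = (\<Sum>i\<in>I. comb (a i))"
  by (simp add: comb_def eval1_sum sum_distrib_right sum.swap[of _ I])

lemma comb_single: "i < m \<Longrightarrow> comb (\<lambda>j. if j = i then p else 0) = ev p * y ^ i"
  by (subst comb_def, subst sum.remove[of _ i]) auto

lemma comb_0: "comb (\<lambda>j. 0) = 0"
  by (simp add: comb_def)

lemma coord_add: "a \<in> coordinate_ring \<Longrightarrow> b \<in> coordinate_ring \<Longrightarrow> a + b \<in> coordinate_ring"
  by (auto simp flip: comb_add)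

lemma coord_diff: "a \<in> coordinate_ring \<Longrightarrow> b \<in> coordinate_ring \<Longrightarrow> a - b \<in> coordinate_ring"
  by (auto simp flip: comb_diff)

lemma coord_uminus: "a \<in> coordinate_ring \<Longrightarrow> - a \<in> coordinate_ring"
  by (auto simp flip: comb_uminus)

lemma coord_0 [simp]: "0 \<in> coordinate_ring"
  by (metis comb_0 rangeI)

lemma coord_sum: "(\<And>i. i \<in> I \<Longrightarrow> h i \<in> coordinate_ring) \<Longrightarrow> sum h I \<in> coordinate_ring"
  by (induction I rule: infinite_finite_induct) (auto intro: coord_add)

lemma coord_ev_mult: "a \<in> coordinate_ring \<Longrightarrow> ev p * a \<in> coordinate_ring"
  by (auto simp flip: comb_smult)

lemma coord_ev [simp]: "ev p \<in> coordinate_ring"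
proof -
  have "comb (\<lambda>j. if j = 0 then p else 0) = ev p" using comb_single[of 0 p] m by simp
  then show ?thesis by (metis rangeI)
qed

lemma coord_1 [simp]: "1 \<in> coordinate_ring"
  using coord_ev[of 1] by simp

lemma coord_y_mult: "b \<in> coordinate_ring \<Longrightarrow> y * b \<in> coordinate_ring"
proof -
  assume "b \<in> coordinate_ring"
  then obtain a where b: "b = comb a" by blast
  obtain l where l: "m = Suc l" using m by (cases m) auto
  have "y * b = (\<Sum>j<m. ev (a j) * y ^ Suc j)"
    by (simp add: b comb_def sum_distrib_left mult.left_commute)
  also have "\<dots> = (\<Sum>j<l. ev (a j) * y ^ Suc j) + ev (a l) * y ^ m" by (simp add: l)
  also have "\<dots> = ev (a l * f) + (\<Sum>j<l. ev (a j) * y ^ Suc j)" by (simp add: y_power_m eval1_mult)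
  also have "\<dots> = (\<Sum>j<m. ev (if j = 0 then a l * f else a (j - 1)) * y ^ j)"
    by (simp add: l sum.lessThan_Suc_shift del: sum.lessThan_Suc)
  also have "\<dots> = comb (\<lambda>j. if j = 0 then a l * f else a (j - 1))" by (simp only: comb_def)
  finally have "y * b = comb (\<lambda>j. if j = 0 then a l * f else a (j - 1))" .
  then show ?thesis by blast
qed

lemma coord_y_power_mult: "b \<in> coordinate_ring \<Longrightarrow> y ^ k * b \<in> coordinate_ring"
  by (induction k) (auto simp: mult.assoc intro: coord_y_mult)

lemma coord_mult: "a \<in> coordinate_ring \<Longrightarrow> b \<in> coordinate_ring \<Longrightarrow> a * b \<in> coordinate_ring"
proof -
  assume "a \<in> coordinate_ring" and b: "b \<in> coordinate_ring"
  then obtain c where "a = comb c" by blast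
  then have "a * b = (\<Sum>j<m. ev (c j) * (y ^ j * b))" by (simp add: comb_def sum_distrib_right mult.assoc)
  then show ?thesis using b by (simp add: coord_sum coord_ev_mult coord_y_power_mult)
qed

lemma coord_power: "a \<in> coordinate_ring \<Longrightarrow> a ^ k \<in> coordinate_ring"
  by (induction k) (auto intro: coord_mult)

lemma coord_eval2: "eval2 emb x y p \<in> coordinate_ring"
proof (induction p)
  case (pCons c p)
  have "eval2 emb x y (pCons c p) = ev c + y * eval2 emb x y p"
    by (simp add: eval2_def map_poly_pCons)
  then show ?case using pCons by (simp add: coord_add coord_y_mult)
qed (simp add: eval2_def)

lemma quotient_coord:
  obtains a b where "a \<in> coordinate_ring" "b \<in> coordinate_ring" "b \<noteq> 0" "z = a / b"
proof -
  have "\<forall>z. \<exists>p r. eval2 emb x y r \<noteq> 0 \<and> z = eval2 emb x y p / eval2 emb x y r"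
    using curve unfolding is_function_field_of_curve_def by (elim conjE)
  then obtain p r where "eval2 emb x y r \<noteq> 0" "z = eval2 emb x y p / eval2 emb x y r" by metis
  then show ?thesis using that[OF coord_eval2 coord_eval2] by blast
qed

lemma common_denominator_coord:
  assumes "finite I"
  obtains g where "g \<in> coordinate_ring" "g \<noteq> 0" "\<And>i. i \<in> I \<Longrightarrow> g * v i \<in> coordinate_ring"
proof -
  have "\<exists>g. g \<in> coordinate_ring \<and> g \<noteq> 0 \<and> (\<forall>i\<in>I. g * v i \<in> coordinate_ring)"
    using assms
  proof (induction I rule: finite_induct)
    case empty
    show ?case by (intro exI[of _ 1]) auto
  next
    case (insert i I)
    then obtain g where g: "g \<in> coordinate_ring" "g \<noteq> 0" "\<forall>i\<in>I. g * v i \<in> coordinate_ring" by blast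
    obtain a b where ab: "a \<in> coordinate_ring" "b \<in> coordinate_ring" "b \<noteq> 0" "v i = a / b" by (rule quotient_coord)
    have "(b * g) * v i \<in> coordinate_ring" using ab g coord_mult[of a g] by (simp add: mult.commute)
    moreover have "(b * g) * v j \<in> coordinate_ring" if "j \<in> I" for j
      using coord_mult[OF ab(2), of "g * v j"] g(3) that by (simp add: mult.assoc)
    moreover have "b * g \<in> coordinate_ring" "b * g \<noteq> 0"
      using g ab coord_mult by simp_all
    ultimately show ?case by (intro exI[of _ "b * g"]) (simp del: mult_eq_0_iff)
  qed
  then show ?thesis using that by blast
qed

section \<open>Algebraic relations from a pigeonhole count\<close>

definition coord_le :: "nat \<Rightarrow> 'a set" where
  "coord_le d = comb ` ({..<m} \<rightarrow>\<^sub>E {p. degree p \<le> d})"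

lemma card_coord_le: "finite (coord_le d)" "card (coord_le d) \<le> CARD('k) ^ (m * Suc d)"
proof -
  have fin: "finite ({..<m} \<rightarrow>\<^sub>E {p :: 'k poly. degree p \<le> d})"
    by (intro finite_PiE) (auto simp: card_poly_degree_le)
  then show "finite (coord_le d)" by (simp add: coord_le_def)
  have "card (coord_le d) \<le> card ({..<m} \<rightarrow>\<^sub>E {p :: 'k poly. degree p \<le> d})"
    unfolding coord_le_def by (intro card_image_le fin)
  also have "\<dots> = CARD('k) ^ (m * Suc d)"
    by (simp only: card_PiE[OF finite_lessThan] card_poly_degree_le prod_constant card_lessThan power_mult mult.commute[of m])
  finally show "card (coord_le d) \<le> CARD('k) ^ (m * Suc d)" .
qed

lemma comb_in_coord_le: "(\<And>j. j < m \<Longrightarrow> degree (a j) \<le> d) \<Longrightarrow> comb a \<in> coord_le d"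
proof -
  assume "\<And>j. j < m \<Longrightarrow> degree (a j) \<le> d"
  moreover have "comb a = comb (restrict a {..<m})" by (simp add: comb_def)
  ultimately show ?thesis unfolding coord_le_def by (intro image_eqI[of _ _ "restrict a {..<m}"]) auto
qed

text \<open>There are \<open>q\<close> to the power \<open>(s + 1) |I|\<close> linear combinations with coefficients of degree at most \<open>s\<close>,
  whose values, up to a common denominator, lie in a set of at most \<open>q\<close> to the power
  \<open>m (s deg h + C + 1)\<close> elements.\<close>
lemma nontrivial_relation:
  assumes I: "finite I" "m * degree h < card I"
  obtains c where "\<exists>i\<in>I. c i \<noteq> 0" "(\<Sum>i\<in>I. eval1 emb (ev h) (c i) * v i) = 0"
proof -
  obtain g where g: "g \<in> coordinate_ring" "g \<noteq> 0" "\<And>i. i \<in> I \<Longrightarrow> g * v i \<in> coordinate_ring"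
    using common_denominator_coord[OF I(1), of v] by blast
  then have "\<forall>i\<in>I. \<exists>a. g * v i = comb a" by blast
  from bchoice[OF this] obtain a where a: "\<And>i. i \<in> I \<Longrightarrow> g * v i = comb (a i)" by blast
  define C where "C = (\<Sum>i\<in>I. \<Sum>j<m. degree (a i j))"
  have C: "degree (a i j) \<le> C" if "i \<in> I" "j < m" for i j
  proof -
    have "degree (a i j) \<le> (\<Sum>j<m. degree (a i j))" using that by (intro member_le_sum) auto
    also have "\<dots> \<le> C" unfolding C_def using that I(1) by (intro member_le_sum[of i I "\<lambda>i. \<Sum>j<m. degree (a i j)"]) auto
    finally show ?thesis .
  qed
  \<comment> \<open>With this choice \<open>(s + 1) (m deg h + 1)\<close> exceeds
    \<open>m (s deg h + C + 1)\<close> by \<open>m deg h + 1\<close>, so there are more combinations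
    than values.\<close>
  define s where "s = m * Suc C"
  define T where "T c = g * (\<Sum>i\<in>I. eval1 emb (ev h) (c i) * v i)" for c
  let ?Dom = "I \<rightarrow>\<^sub>E {p :: 'k poly. degree p \<le> s}"
  have "T c \<in> coord_le (s * degree h + C)" if c: "c \<in> ?Dom" for c
  proof -
    have "T c = (\<Sum>i\<in>I. ev (pcompose (c i) h) * (g * v i))"
      by (simp add: T_def sum_distrib_left eval1_pcompose mult.left_commute)
    also have "\<dots> = (\<Sum>i\<in>I. ev (pcompose (c i) h) * comb (a i))" by (intro sum.cong) (auto simp: a)
    also have "\<dots> = comb (\<lambda>j. \<Sum>i\<in>I. pcompose (c i) h * a i j)" by (simp only: comb_sum comb_smult)
    also have "\<dots> \<in> coord_le (s * degree h + C)"
    proof (intro comb_in_coord_le degree_sum_le I(1))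
      fix i j assume ij: "i \<in> I" "j < m"
      have "degree (pcompose (c i) h) \<le> s * degree h" using c ij by (auto simp: degree_pcompose)
      then show "degree (pcompose (c i) h * a i j) \<le> s * degree h + C"
        using degree_mult_le[of "pcompose (c i) h" "a i j"] C[OF ij] by linarith
    qed
    finally show ?thesis .
  qed
  then have sub: "T ` ?Dom \<subseteq> coord_le (s * degree h + C)" by blast
  have "m * Suc (s * degree h + C) < Suc s * card I"
  proof -
    have "m * Suc (s * degree h + C) < Suc s * Suc (m * degree h)" by (simp add: s_def algebra_simps)
    also have "\<dots> \<le> Suc s * card I" using I(2) by (intro mult_le_mono2) simp
    finally show ?thesis .
  qed
  then have "CARD('k) ^ (m * Suc (s * degree h + C)) < CARD('k) ^ (Suc s * card I)"
    using two_le_card[where 'k = 'k] by (intro power_strict_increasing) auto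
  also have "\<dots> = card ?Dom" by (simp only: card_PiE[OF I(1)] card_poly_degree_le prod_constant power_mult)
  finally have "card (coord_le (s * degree h + C)) < card ?Dom"
    using card_coord_le(2)[of "s * degree h + C"] by linarith
  then have "\<not> inj_on T ?Dom" using sub card_coord_le(1) by (metis card_inj_on_le not_le)
  then obtain c c' where c: "c \<in> ?Dom" "c' \<in> ?Dom" "c \<noteq> c'" "T c = T c'" unfolding inj_on_def by blast
  have "\<exists>i\<in>I. c i - c' i \<noteq> 0"
  proof (rule ccontr)
    assume "\<not> ?thesis"
    then have "c = c'" using c by (intro PiE_ext[of c I _ c']) auto
    with c show False by simp
  qed
  moreover have "(\<Sum>i\<in>I. eval1 emb (ev h) (c i - c' i) * v i) = 0"
    using c(4) g(2) by (simp add: T_def eval1_diff left_diff_distrib sum_subtractf)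
  ultimately show ?thesis using that[of "\<lambda>i. c i - c' i"] by blast
qed

lemma degree_bound_ev: "h \<noteq> 0 \<Longrightarrow> degree_bound emb (ev h) (m * degree h)"
  unfolding degree_bound_def
proof (intro allI impI)
  fix I :: "nat set" and v :: "nat \<Rightarrow> 'a"
  assume h: "h \<noteq> 0" and I: "finite I \<and> m * degree h < card I"
  then obtain c where c: "\<exists>i\<in>I. c i \<noteq> 0" "(\<Sum>i\<in>I. eval1 emb (ev h) (c i) * v i) = 0"
    using nontrivial_relation[of I h v] by blast
  show "\<exists>c. (\<exists>i\<in>I. coeff (c i) 0 \<noteq> 0) \<and> (\<Sum>i\<in>I. eval1 emb (ev h) (c i) * v i) = 0"
    by (rule relation_normalize[OF _ c]) (use h in auto)
qed

text \<open>Division by \<open>x^d\<close>, for a common bound \<open>d\<close> of the degrees,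
  reverses the coefficients and turns a relation over \<open>K[x]\<close> into one over
  \<open>K[1/x]\<close>.\<close>

lemma degree_bound_inverse_x: "degree_bound emb (inverse x) m"
  unfolding degree_bound_def
proof (intro allI impI)
  fix I :: "nat set" and v :: "nat \<Rightarrow> 'a"
  assume I: "finite I \<and> m < card I"
  obtain c where c: "\<exists>i\<in>I. c i \<noteq> 0" "(\<Sum>i\<in>I. ev (c i) * v i) = 0"
    using nontrivial_relation[of I "[:0, 1:]" v] I by auto
  define d where "d = (\<Sum>i\<in>I. degree (c i))"
  define c' where "c' i = (\<Sum>k\<le>d. monom (coeff (c i) (d - k)) k)" for i
  have cc: "eval1 emb (inverse x) (c' i) = inverse x ^ d * ev (c i)" if "i \<in> I" for i
  proof -
    have "degree (c i) \<le> d" using member_le_sum[of i I "\<lambda>i. degree (c i)"] I that by (simp add: d_def)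
    then have "ev (c i) = (\<Sum>k\<le>d. emb (coeff (c i) k) * x ^ k)"
      unfolding eval1_altdef by (intro sum.mono_neutral_left) (auto simp: coeff_eq_0)
    also have "\<dots> = (\<Sum>k\<le>d. emb (coeff (c i) (d - k)) * x ^ (d - k))"
      by (intro sum.reindex_bij_witness[of _ "\<lambda>k. d - k" "\<lambda>k. d - k"]) auto
    finally have "inverse x ^ d * ev (c i) = (\<Sum>k\<le>d. inverse x ^ d * (emb (coeff (c i) (d - k)) * x ^ (d - k)))"
      by (simp add: sum_distrib_left)
    also have "\<dots> = (\<Sum>k\<le>d. emb (coeff (c i) (d - k)) * inverse x ^ k)"
    proof (intro sum.cong refl)
      fix k assume "k \<in> {..d}"
      then have "inverse x ^ d = inverse x ^ (d - k) * inverse x ^ k" by (simp flip: power_add)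
      moreover have "inverse x ^ (d - k) * x ^ (d - k) = 1" by (simp flip: power_mult_distrib)
      ultimately show "inverse x ^ d * (emb (coeff (c i) (d - k)) * x ^ (d - k)) = emb (coeff (c i) (d - k)) * inverse x ^ k"
        by (simp add: mult_ac)
    qed
    also have "\<dots> = eval1 emb (inverse x) (c' i)" by (simp add: c'_def eval1_sum eval1_monom)
    finally show ?thesis by simp
  qed
  have "\<exists>i\<in>I. c' i \<noteq> 0"
  proof -
    obtain i where "i \<in> I" "c i \<noteq> 0" using c(1) by blast
    then have "eval1 emb (inverse x) (c' i) \<noteq> 0" using cc[of i] by simp
    then have "c' i \<noteq> 0" by auto
    then show ?thesis using \<open>i \<in> I\<close> by blast
  qed
  moreover have "(\<Sum>i\<in>I. eval1 emb (inverse x) (c' i) * v i) = inverse x ^ d * (\<Sum>i\<in>I. ev (c i) * v i)"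
    unfolding sum_distrib_left by (intro sum.cong) (auto simp: cc mult.assoc)
  ultimately show "\<exists>c. (\<exists>i\<in>I. coeff (c i) 0 \<noteq> 0) \<and> (\<Sum>i\<in>I. eval1 emb (inverse x) (c i) * v i) = 0"
    by (intro relation_normalize[of "inverse x" I c' v]) (simp_all add: c(2))
qed

text \<open>Cancelling the lowest power of \<open>r\<close> in a relation between its powers
  exhibits the coefficient of that power, a nonzero polynomial in \<open>x\<close>, as a multiple of
  \<open>r\<close>. Thus denominators can be taken from \<open>K[x]\<close>.\<close>

lemma coord_multiple_ev:
  assumes r: "r \<in> coordinate_ring" "r \<noteq> 0"
  obtains w g where "w \<in> coordinate_ring" "g \<noteq> 0" "r * w = ev g"
proof -
  obtain c where c: "\<exists>i\<in>{..m}. c i \<noteq> 0" "(\<Sum>i\<in>{..m}. ev (c i) * r ^ i) = 0"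
    using nontrivial_relation[of "{..m}" "[:0, 1:]" "\<lambda>i. r ^ i"] by auto
  define k where "k = (LEAST k. k \<le> m \<and> c k \<noteq> 0)"
  have "\<exists>k. k \<le> m \<and> c k \<noteq> 0" using c(1) by auto
  from LeastI_ex[OF this] have k: "k \<le> m" "c k \<noteq> 0" unfolding k_def by auto
  have less: "c i = 0" if "i < k" for i
    using not_less_Least[of i "\<lambda>k. k \<le> m \<and> c k \<noteq> 0"] that k(1) unfolding k_def[symmetric] by simp
  define w where "w = - (\<Sum>i\<in>{k<..m}. ev (c i) * r ^ (i - Suc k))"
  have "(\<Sum>i\<in>{..m}. ev (c i) * r ^ i) = (\<Sum>i\<in>{k..m}. ev (c i) * r ^ i)"
    using less by (intro sum.mono_neutral_right) auto
  also have "{k..m} = insert k {k<..m}" using k by auto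
  also have "(\<Sum>i\<in>insert k {k<..m}. ev (c i) * r ^ i) = ev (c k) * r ^ k + (\<Sum>i\<in>{k<..m}. ev (c i) * r ^ i)" by simp
  also have "(\<Sum>i\<in>{k<..m}. ev (c i) * r ^ i) = - (w * r * r ^ k)"
    unfolding w_def sum_distrib_right sum_negf minus_minus mult_minus_left
    by (intro sum.cong refl) (auto simp: mult.assoc simp flip: power_add power_Suc power_Suc2)
  finally have "(ev (c k) - w * r) * r ^ k = 0" using c(2) by (simp add: left_diff_distrib)
  then have "r * w = ev (c k)" using r(2) by (simp add: mult.commute)
  moreover have "w \<in> coordinate_ring"
    unfolding w_def using r by (intro coord_uminus coord_sum coord_ev_mult coord_power)
  ultimately show ?thesis using that k by blast
qed

lemma quotient_ev:
  obtains w g where "w \<in> coordinate_ring" "g \<noteq> 0" "z = w / ev g"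
proof -
  obtain a b where ab: "a \<in> coordinate_ring" "b \<in> coordinate_ring" "b \<noteq> 0" "z = a / b" by (rule quotient_coord)
  obtain w g where w: "w \<in> coordinate_ring" "g \<noteq> 0" "b * w = ev g" using coord_multiple_ev ab by blast
  then have "w \<noteq> 0" by auto
  then have "z = (a * w) / ev g" using ab by (simp flip: w(3))
  then show ?thesis using that w ab coord_mult by blast
qed

lemma coord_in_ring:
  assumes "P \<in> places emb" "x \<in> ring_at P" "a \<in> coordinate_ring"
  shows "a \<in> ring_at P"
proof -
  interpret place emb P by unfold_locales (rule assms)
  have "y \<in> \<O>"
  proof (rule root_in_ring[of m _ "\<lambda>i. if i = 0 then ev f else 0"])
    show "y ^ m = (\<Sum>i<m. (if i = 0 then ev f else 0) * y ^ i)"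
      using m by (subst sum.remove[of _ 0]) (auto simp: y_power_m)
  qed (use m assms eval1_in_ring in auto)
  then show ?thesis using assms by (auto simp: comb_def intro!: ring_sum ring_mult ring_power eval1_in_ring)
qed

text \<open>Otherwise all nonzero polynomials in \<open>x\<close> are units at \<open>P\<close>, and
  as they suffice as denominators, the valuation ring would be the whole field.\<close>

lemma ev_in_place:
  assumes "P \<in> places emb" "x \<in> ring_at P"
  obtains h where "h \<noteq> 0" "ev h \<in> P"
proof -
  interpret place emb P by unfold_locales (rule assms)
  have "\<exists>h. h \<noteq> 0 \<and> ev h \<in> P"
  proof (rule ccontr)
    assume no: "\<nexists>h. h \<noteq> 0 \<and> ev h \<in> P"
    have "z \<in> \<O>" for z
    proof -
      obtain w g where w: "w \<in> coordinate_ring" "g \<noteq> 0" "z = w / ev g" by (rule quotient_ev)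
      have "ev g \<in> \<O> - P" using no w(2) assms(2) eval1_in_ring by blast
      then have "inverse (ev g) \<in> \<O>" using unit_iff by blast
      then show ?thesis using w coord_in_ring[OF assms] ring_mult by (simp add: divide_inverse)
    qed
    then show False using ring_proper by blast
  qed
  then show ?thesis using that by blast
qed

end

sublocale curve \<subseteq> function_field
proof
  fix P assume P: "P \<in> places emb"
  interpret place emb P by unfold_locales (rule P)
  show "\<exists>z N. z \<in> P \<and> z \<noteq> 0 \<and> degree_bound emb z N"
  proof (cases "x \<in> ring_at P")
    case True
    then obtain h where "h \<noteq> 0" "ev h \<in> P" using ev_in_place[OF P] by blast
    then show ?thesis using degree_bound_ev[of h] by (intro exI[of _ "ev h"]) auto
  next
    case False
    then have "inverse x \<in> P" using mem_P_iff ring_or_inverse by auto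
    then show ?thesis using degree_bound_inverse_x by (intro exI[of _ "inverse x"]) auto
  qed
qed

section \<open>Places of the curve\<close>

lemma le_div_iff: "(b :: int) > 0 \<Longrightarrow> c \<le> a div b \<longleftrightarrow> c * b \<le> a"
proof
  assume b: "b > 0"
  show "c * b \<le> a" if "c \<le> a div b"
  proof -
    have "c * b \<le> a div b * b" using that b by (intro mult_right_mono) auto
    also have "\<dots> \<le> a" using b div_mult_mod_eq[of a b] pos_mod_sign[of b a] by linarith
    finally show ?thesis .
  qed
  show "c \<le> a div b" if "c * b \<le> a"
    using zdiv_mono1[OF that b] b by simp
qed

lemma div_less_iff: "(b :: int) > 0 \<Longrightarrow> a div b < c \<longleftrightarrow> a < c * b"
  using le_div_iff[of b c a] by (simp flip: not_le)

lemma mult_div_le: "(b :: int) > 0 \<Longrightarrow> b * (a div b) \<le> a"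
  using le_div_iff[of b "a div b" a] by (simp add: mult.commute)

lemma lt_mult_div: "(b :: int) > 0 \<Longrightarrow> a < b * (a div b + 1)"
  using div_less_iff[of b a "a div b + 1"] by (simp add: mult.commute)

lemma eq_if_dvd_diff:
  assumes "i < m" "j < m" "int m dvd int i - int j"
  shows "i = j"
proof (rule ccontr)
  assume "i \<noteq> j"
  then have "int m \<le> \<bar>int i - int j\<bar>" using dvd_imp_le_int[OF _ assms(3)] by simp
  then show False using assms(1,2) by linarith
qed

text \<open>Exactly one of the nonzero terms has the least valuation, so nothing cancels and bounds
  can be tested term by term.\<close>

lemma (in discrete_place) sum_distinct_vals:
  assumes A: "finite A" and distinct: "\<And>i j. i \<in> A \<Longrightarrow> j \<in> A \<Longrightarrow> i \<noteq> j \<Longrightarrow> h i \<noteq> 0 \<Longrightarrow> h j \<noteq> 0 \<Longrightarrow> val P (h i) \<noteq> val P (h j)"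
  shows "sum h A = 0 \<longleftrightarrow> (\<forall>i\<in>A. h i = 0)" and "vge P k (sum h A) \<longleftrightarrow> (\<forall>i\<in>A. vge P k (h i))"
proof -
  have "(sum h A = 0 \<longleftrightarrow> (\<forall>i\<in>A. h i = 0)) \<and> (vge P k (sum h A) \<longleftrightarrow> (\<forall>i\<in>A. vge P k (h i)))"
  proof (cases "\<forall>i\<in>A. h i = 0")
    case False
    define B where "B = {i\<in>A. h i \<noteq> 0}"
    have B: "finite B" "B \<noteq> {}" using False A by (auto simp: B_def)
    obtain i where i: "i \<in> B" "\<And>j. j \<in> B \<Longrightarrow> val P (h i) \<le> val P (h j)"
      using finite_has_minimal[of "(\<lambda>i. val P (h i)) ` B"] B by fastforce
    have "h j = 0 \<or> val P (h i) < val P (h j)" if "j \<in> A" "j \<noteq> i" for j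
      using i(1) i(2)[of j] distinct[of j i] that by (fastforce simp: B_def)
    then have *: "sum h A \<noteq> 0 \<and> val P (sum h A) = val P (h i)"
      using i(1) A by (intro val_sum_eq) (auto simp: B_def)
    have "vge P k (sum h A) \<longleftrightarrow> (\<forall>i\<in>A. vge P k (h i))"
    proof
      assume "vge P k (sum h A)"
      then have "k \<le> val P (h i)" using * by (simp add: vge_def)
      then show "\<forall>i\<in>A. vge P k (h i)" using i(2) by (fastforce simp: B_def vge_def)
    qed (simp add: vge_sum)
    then show ?thesis using * False by blast
  qed simp
  then show "sum h A = 0 \<longleftrightarrow> (\<forall>i\<in>A. h i = 0)" "vge P k (sum h A) \<longleftrightarrow> (\<forall>i\<in>A. vge P k (h i))" by blast+
qed

lemma (in function_field) place_degree_pos: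
  assumes "P \<in> places emb"
  shows "place_degree emb P > 0"
proof -
  interpret p: discrete_place emb P using discrete_place[OF assms] .
  obtain B where B: "residue_basis emb P B" using residue_basis_exists[OF assms] .
  have "B \<noteq> {}"
  proof
    assume "B = {}"
    then have "1 \<in> P" using B p.ring_1 unfolding residue_basis_def by fastforce
    then show False by simp
  qed
  then show ?thesis using place_degree_eq[OF assms B] B by (simp add: residue_basis_def card_gt_0_iff)
qed

lemma (in function_field) val_nonneg_iff: "P \<in> places emb \<Longrightarrow> a \<noteq> 0 \<Longrightarrow> 0 \<le> val P a \<longleftrightarrow> a \<in> ring_at P"
  using discrete_place discrete_place.val_nonneg_iff by blast

context curve
begin

text \<open>At a pole of \<open>x\<close> the leading monomial has strictly the smallest
  valuation.\<close>

lemma val_ev_pole: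
  assumes P: "P \<in> places emb" and x: "val P x < 0" and p: "p \<noteq> 0"
  shows "val P (ev p) = int (degree p) * val P x"
proof -
  interpret p: discrete_place emb P using discrete_place[OF P] .
  define h where "h i = emb (coeff p i) * x ^ i" for i
  have v: "h i \<noteq> 0 \<and> val P (h i) = int i * val P x" if "coeff p i \<noteq> 0" for i
    using that by (simp add: h_def p.val_mult p.val_power)
  have "sum h {..degree p} \<noteq> 0 \<and> val P (sum h {..degree p}) = val P (h (degree p))"
  proof (rule p.val_sum_eq)
    fix j assume j: "j \<in> {..degree p}" "j \<noteq> degree p"
    show "h j = 0 \<or> val P (h (degree p)) < val P (h j)"
    proof (cases "coeff p j = 0")
      case False
      then show ?thesis using v[of j] v[of "degree p"] j x p by simp
    qed (simp add: h_def)
  qed (use v p in auto)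
  then show ?thesis using v[of "degree p"] p by (simp add: h_def eval1_altdef)
qed

text \<open>From \<open>m v(y) = n v(x)\<close> and coprimality, \<open>m\<close> divides
  \<open>v(x)\<close>. The bound for the zeros of \<open>inverse x\<close> says that
  \<open>- v(x) deg P\<close> is at most \<open>m\<close>, so equality holds throughout.\<close>

lemma pole:
  assumes P: "P \<in> places emb" and x: "val P x < 0"
  shows "val P x = - int m" "val P y = - int n" "place_degree emb P = 1"
proof -
  interpret p: discrete_place emb P using discrete_place[OF P] .
  have "int m * val P y = int n * val P x"
    using val_ev_pole[OF P x f_nonzero] by (simp flip: y_power_m add: p.val_power)
  then have "int m dvd int n * val P x" by (metis dvd_triv_left)
  moreover have "coprime (int m) (int n)" using coprime_degree by simp
  ultimately have dvd: "int m dvd - val P x" by (simp add: coprime_dvd_mult_right_iff)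
  have "inverse x \<in> P" using p.val_pos_iff[of "inverse x"] x by (simp add: p.val_inverse)
  then have "- val P x * int (place_degree emb P) \<le> int m"
    using sum_local_degrees_le[of "{P}" "inverse x" m] P degree_bound_inverse_x by (simp add: p.val_inverse)
  moreover have "int m \<le> - val P x" using dvd x by (intro zdvd_imp_le) auto
  moreover have "place_degree emb P > 0" using place_degree_pos[OF P] .
  moreover have "- val P x * 1 \<le> - val P x * int (place_degree emb P)" using calculation(3) x
    by (intro mult_left_mono) auto
  ultimately have vx: "- val P x = int m" "- val P x * int (place_degree emb P) = - val P x * 1" by linarith+
  then show "val P x = - int m" "place_degree emb P = 1" using x by auto
  then have "int m * val P y = int m * (- int n)" using \<open>int m * val P y = int n * val P x\<close> by simp
  then have "int m = 0 \<or> val P y = - int n" by (simp only: mult_cancel_left)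
  then show "val P y = - int n" using m by simp
qed

text \<open>After the power of \<open>x - a\<close> is split off, the cofactor \<open>q\<close> is
  congruent to the nonzero constant \<open>q(a)\<close> modulo \<open>P\<close> and hence a
  unit.\<close>

lemma val_ev_zero:
  assumes P: "P \<in> places emb" and a: "val P (ev [:- a, 1:]) > 0" and p: "p \<noteq> 0"
  shows "val P (ev p) = int (order a p) * val P (ev [:- a, 1:])"
proof -
  interpret p: discrete_place emb P using discrete_place[OF P] .
  obtain q where q: "p = [:- a, 1:] ^ order a p * q" "\<not> [:- a, 1:] dvd q" using order_decomp[OF p] by blast
  have aP: "ev [:- a, 1:] \<in> P" using a p.val_pos_iff[of "ev [:- a, 1:]"] by (simp del: eval1_pCons)
  have x: "x \<in> ring_at P" using p.ring_add[OF p.P_subset[OF aP] p.ring_emb[of a]] by (simp add: emb_uminus)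
  define c where "c = poly q a"
  have c: "c \<noteq> 0" using q(2) by (simp add: c_def poly_eq_0_iff_dvd)
  have "[:- a, 1:] dvd q - [:c:]" by (simp add: c_def flip: poly_eq_0_iff_dvd)
  then obtain s where "q - [:c:] = [:- a, 1:] * s" by (elim dvdE)
  then have "q = [:- a, 1:] * s + [:c:]" by (simp add: algebra_simps)
  then have "ev q = ev ([:- a, 1:] * s + [:c:])" by (rule arg_cong)
  also have "\<dots> = ev [:- a, 1:] * ev s + emb c"
    by (simp only: eval1_add eval1_mult eval1_pCons eval1_0 mult_zero_right add_0_right)
  finally have "ev q = ev [:- a, 1:] * ev s + emb c" .
  moreover have "ev [:- a, 1:] * ev s \<in> P" by (intro p.P_mult' aP p.eval1_in_ring x)
  ultimately have "ev q \<notin> P" using p.P_diff[of "ev q" "ev [:- a, 1:] * ev s"] c p.emb_in_P_iff by auto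
  moreover have q0: "q \<noteq> 0" using c by (auto simp: c_def)
  ultimately have vq: "val P (ev q) = 0" using p.val_unit_iff[of "ev q"] p.eval1_in_ring[OF x] by simp
  have "ev p = ev [:- a, 1:] ^ order a p * ev q" by (subst q(1)) (simp only: eval1_mult eval1_power)
  moreover have "ev [:- a, 1:] \<noteq> 0" by (simp only: ev_eq_0_iff) simp
  ultimately show ?thesis using vq q0 by (simp add: p.val_mult p.val_power del: eval1_pCons)
qed

lemma order_root_f:
  assumes "poly f a = 0"
  shows "order a f = 1"
proof -
  have "order a f \<noteq> 0" using assms order_root[of f a] by simp
  moreover have "\<not> [:- a, 1:] ^ 2 dvd f"
  proof
    define X where "X = [:- a, 1:]"
    assume "[:- a, 1:] ^ 2 dvd f"
    then obtain s where "f = X ^ 2 * s" unfolding X_def by (elim dvdE)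
    then have s: "f = X * (X * s)" by (simp only: power2_eq_square mult.assoc)
    then have "[:- a, 1:] dvd f" unfolding X_def by (metis dvd_triv_left)
    moreover have "X dvd pderiv f" unfolding s pderiv_mult by simp
    then have "[:- a, 1:] dvd pderiv f" by (simp only: X_def)
    ultimately have "is_unit [:- a, 1:]" using separable coprime_common_divisor by blast
    then show False by (simp add: is_unit_iff_degree)
  qed
  then have "\<not> 2 \<le> order a f" using order_divides[of a 2 f] by simp
  ultimately show ?thesis by simp
qed

text \<open>The root \<open>a\<close> of \<open>f\<close> is simple, so
  \<open>m v(y) = v(x - a)\<close> at every zero of \<open>x - a\<close>. Each such zero contributes
  at least \<open>m\<close> to a sum that is at most \<open>m\<close>: there is only one, totally
  ramified and of degree one.\<close>

lemma zero:
  assumes P: "P \<in> places emb" and a: "poly f a = 0" "val P (ev [:- a, 1:]) > 0"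
  shows "val P (ev [:- a, 1:]) = int m" "val P y = 1" "place_degree emb P = 1"
    and "P' \<in> places emb \<Longrightarrow> val P' (ev [:- a, 1:]) > 0 \<Longrightarrow> P' = P"
proof -
  define t where "t = ev [:- a, 1:]"
  have t0: "t \<noteq> 0" unfolding t_def by (simp only: ev_eq_0_iff) simp
  have bound: "degree_bound emb t m" using degree_bound_ev[of "[:- a, 1:]"] by (simp add: t_def)
  have ge: "int m \<le> val R t \<and> val R t \<le> val R t * int (place_degree emb R) \<and> t \<in> R \<and> val R t = int m * val R y"
    if R: "R \<in> places emb" "val R t > 0" for R
  proof -
    interpret p: discrete_place emb R using discrete_place[OF R(1)] .
    have "int m * val R y = val R (ev f)" by (simp flip: y_power_m add: p.val_power)
    also have "\<dots> = val R t" using val_ev_zero[OF R(1) R(2)[unfolded t_def] f_nonzero] order_root_f[OF a(1)]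
      by (simp add: t_def del: eval1_pCons)
    finally have v: "int m * val R y = val R t" .
    then have "int m dvd val R t" by (metis dvd_triv_left)
    then have "int m \<le> val R t" using R by (intro zdvd_imp_le) auto
    moreover have "val R t * 1 \<le> val R t * int (place_degree emb R)" using place_degree_pos[OF R(1)] R
      by (intro mult_left_mono) auto
    ultimately show ?thesis using p.val_pos_iff[OF t0] R v by simp
  qed
  have P': "P' = P" if "P' \<in> places emb" "val P' t > 0" for P'
  proof (rule ccontr)
    assume "P' \<noteq> P"
    note g = ge[OF P a(2)[folded t_def]] and g' = ge[OF that]
    have "(\<Sum>R\<in>{P, P'}. val R t * int (place_degree emb R)) \<le> int m"
      by (rule sum_local_degrees_le[OF _ _ t0 _ bound]) (use P that g g' in blast)+
    then have "val P t * int (place_degree emb P) + val P' t * int (place_degree emb P') \<le> int m"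
      using \<open>P' \<noteq> P\<close> by simp
    then show False using g g' m by linarith
  qed
  then show "P' \<in> places emb \<Longrightarrow> val P' (ev [:- a, 1:]) > 0 \<Longrightarrow> P' = P" by (simp add: t_def)
  note g = ge[OF P a(2)[folded t_def]]
  have "(\<Sum>R\<in>{P}. val R t * int (place_degree emb R)) \<le> int m"
    by (rule sum_local_degrees_le[OF _ _ t0 _ bound]) (use P g in blast)+
  then have "val P t * int (place_degree emb P) \<le> int m" by simp
  then have vt: "val P t = int m" "val P t * int (place_degree emb P) = val P t * 1" using g by linarith+
  then show "val P (ev [:- a, 1:]) = int m" "val P y = 1" "place_degree emb P = 1"
    using g m by (auto simp: t_def)
qed

end

section \<open>Functions without finite poles\<close>

text \<open>For a subring \<open>S\<close> this is the ring \<open>S[v]\<close>.\<close>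

definition adjoin :: "'a::comm_ring_1 set \<Rightarrow> 'a \<Rightarrow> 'a set" where
  "adjoin S v = {poly p v | p. \<forall>i. coeff p i \<in> S}"

lemma adjoin_ring:
  assumes S: "0 \<in> S" "1 \<in> S" "\<And>a b. a \<in> S \<Longrightarrow> b \<in> S \<Longrightarrow> a - b \<in> S" "\<And>a b. a \<in> S \<Longrightarrow> b \<in> S \<Longrightarrow> a * b \<in> S"
  shows "S \<subseteq> adjoin S v" "v \<in> adjoin S v"
    "\<And>a b. a \<in> adjoin S v \<Longrightarrow> b \<in> adjoin S v \<Longrightarrow> a - b \<in> adjoin S v"
    "\<And>a b. a \<in> adjoin S v \<Longrightarrow> b \<in> adjoin S v \<Longrightarrow> a * b \<in> adjoin S v"
proof -
  have uminus: "- a \<in> S" if "a \<in> S" for a using S(3)[OF S(1) that] by simp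
  have add: "a + b \<in> S" if "a \<in> S" "b \<in> S" for a b using S(3)[OF that(1) uminus[OF that(2)]] by simp
  have sum: "(\<And>i. i \<in> A \<Longrightarrow> h i \<in> S) \<Longrightarrow> sum h A \<in> S" for h and A :: "nat set"
    by (induction A rule: infinite_finite_induct) (auto intro: S(1) add)
  show "S \<subseteq> adjoin S v"
  proof
    fix a assume "a \<in> S"
    then show "a \<in> adjoin S v" unfolding adjoin_def using S(1)
      by (intro CollectI exI[of _ "[:a:]"]) (auto simp: coeff_pCons split: nat.splits)
  qed
  show "v \<in> adjoin S v" unfolding adjoin_def using S(1,2)
    by (intro CollectI exI[of _ "[:0, 1:]"]) (auto simp: coeff_pCons split: nat.splits)
  fix a b assume "a \<in> adjoin S v" "b \<in> adjoin S v"
  then obtain p r where pr: "\<forall>i. coeff p i \<in> S" "a = poly p v" "\<forall>i. coeff r i \<in> S" "b = poly r v"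
    unfolding adjoin_def by blast
  show "a - b \<in> adjoin S v" unfolding adjoin_def using pr S(3) by (intro CollectI exI[of _ "p - r"]) auto
  show "a * b \<in> adjoin S v" unfolding adjoin_def using pr S(4) sum
    by (intro CollectI exI[of _ "p * r"]) (auto simp: coeff_mult)
qed

text \<open>The core of the extension theorem for valuation rings. Maximality is used for two
  enlargements of \<open>M\<close>: inverting \<open>1 - c\<close> for \<open>c\<close> in the ideal
  \<open>I\<close> generated by \<open>inverse z\<close>, which adds nothing, and adjoining an
  element outside \<open>M\<close>, which must produce \<open>z\<close>.\<close>

lemma (in field_extension) maximal_ring_valuation:
  fixes M :: "'a set" and z u :: 'a
  assumes M1: "1 \<in> M" and diff: "\<And>a b. a \<in> M \<Longrightarrow> b \<in> M \<Longrightarrow> a - b \<in> M" and mult: "\<And>a b. a \<in> M \<Longrightarrow> b \<in> M \<Longrightarrow> a * b \<in> M"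
    and z: "inverse z \<in> M" "z \<notin> M"
    and max: "\<And>R. M \<subseteq> R \<Longrightarrow> (\<And>a b. a \<in> R \<Longrightarrow> b \<in> R \<Longrightarrow> a - b \<in> R) \<Longrightarrow> (\<And>a b. a \<in> R \<Longrightarrow> b \<in> R \<Longrightarrow> a * b \<in> R) \<Longrightarrow> z \<notin> R \<Longrightarrow> R = M"
  shows "u \<in> M \<or> inverse u \<in> M"
proof (rule ccontr)
  assume u: "\<not> (u \<in> M \<or> inverse u \<in> M)"
  have M0: "0 \<in> M" using diff[OF M1 M1] by simp
  have uminus: "- a \<in> M" if "a \<in> M" for a using diff[OF M0 that] by simp
  have add: "a + b \<in> M" if "a \<in> M" "b \<in> M" for a b using diff[OF that(1) uminus[OF that(2)]] by simp
  have power: "a ^ k \<in> M" if "a \<in> M" for a k using that by (induction k) (auto intro: M1 mult)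
  have z0: "z \<noteq> 0" using z M0 by auto
  define I where "I = (\<lambda>c. c * inverse z) ` M"
  have I_M: "c \<in> M" if "c \<in> I" for c using that z mult by (auto simp: I_def)
  have I_add: "c + d \<in> I" if "c \<in> I" "d \<in> I" for c d using that add by (auto simp: I_def simp flip: distrib_right)
  have I_mult: "a * c \<in> I" if "a \<in> M" "c \<in> I" for a c using that mult by (auto simp: I_def simp flip: mult.assoc)
  have I_1: "1 \<notin> I" using z z0 by (auto simp: I_def field_simps)
  have I_0: "0 \<in> I" using M0 by (auto simp: I_def)
  have I_diff: "c - d \<in> I" if "c \<in> I" "d \<in> I" for c d using that diff by (auto simp: I_def simp flip: left_diff_distrib)
  have unit: "inverse (1 - c) \<in> M" if c: "c \<in> I" for c
  proof -
    have w0: "1 - c \<noteq> 0" using c I_1 by auto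
    \<comment> \<open>The localization at the powers of \<open>1 - c\<close>. It omits
      \<open>z\<close>, because \<open>z (1 - c)^k\<close> is \<open>z\<close> minus an element of
      \<open>M\<close> and so is not in \<open>M\<close>.\<close>
    define R where "R = {a / (1 - c) ^ k | a k. a \<in> M}"
    have wM: "1 - c \<in> M" using c I_M diff M1 by blast
    have pw: "\<exists>d\<in>I. (1 - c) ^ k = 1 - d" for k
    proof (induction k)
      case (Suc k)
      then obtain d where d: "d \<in> I" "(1 - c) ^ k = 1 - d" by blast
      have "(1 - c) ^ Suc k = 1 - (c + (1 - c) * d)" by (simp add: d(2) algebra_simps)
      moreover have "c + (1 - c) * d \<in> I" using c d(1) by (intro I_add I_mult wM)
      ultimately show ?case by blast
    qed (use I_0 in auto)
    have "z \<notin> R"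
    proof
      assume "z \<in> R"
      then obtain a k where a: "a \<in> M" "z = a / (1 - c) ^ k" by (auto simp: R_def)
      then have "z * (1 - c) ^ k \<in> M" using w0 by simp
      moreover obtain d where d: "d \<in> M" "(1 - c) ^ k = 1 - d * inverse z" using pw[of k] by (auto simp: I_def)
      moreover have "z * (1 - d * inverse z) = z - d" using z0 by (simp add: field_simps)
      ultimately have "z - d \<in> M" by metis
      then have "z \<in> M" using add[OF _ d(1)] by fastforce
      then show False using z by simp
    qed
    moreover have "M \<subseteq> R"
    proof
      fix a assume "a \<in> M"
      then have "a = a / (1 - c) ^ 0 \<and> a \<in> M" by simp
      then show "a \<in> R" unfolding R_def by blast
    qed
    moreover have "a - b \<in> R" if ab: "a \<in> R" "b \<in> R" for a b
    proof -
      obtain a' k b' l where 1: "a' \<in> M" "a = a' / (1 - c) ^ k" "b' \<in> M" "b = b' / (1 - c) ^ l" using ab by (auto simp: R_def)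
      then have "a - b = (a' * (1 - c) ^ l - b' * (1 - c) ^ k) / (1 - c) ^ (k + l)"
        using w0 by (simp add: diff_divide_distrib power_add)
      moreover have "a' * (1 - c) ^ l - b' * (1 - c) ^ k \<in> M" by (rule diff[OF mult[OF 1(1) power[OF wM]] mult[OF 1(3) power[OF wM]]])
      ultimately show ?thesis unfolding R_def by blast
    qed
    moreover have "a * b \<in> R" if ab: "a \<in> R" "b \<in> R" for a b
    proof -
      obtain a' k b' l where 1: "a' \<in> M" "a = a' / (1 - c) ^ k" "b' \<in> M" "b = b' / (1 - c) ^ l" using ab by (auto simp: R_def)
      then have "a * b = (a' * b') / (1 - c) ^ (k + l)" by (simp add: power_add)
      moreover have "a' * b' \<in> M" using 1 by (intro mult)
      ultimately show ?thesis unfolding R_def by blast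
    qed
    ultimately have "R = M" by (intro max)
    moreover have "inverse (1 - c) \<in> R" unfolding R_def using M1 by (auto intro!: exI[of _ 1] simp: divide_inverse)
    ultimately show ?thesis by simp
  qed
  \<comment> \<open>For \<open>v\<close> outside \<open>M\<close>, the ring \<open>M[v]\<close>
    contains \<open>z\<close>; multiplying the expression for \<open>z\<close> by
    \<open>inverse z\<close> represents 1 with coefficients in \<open>I\<close>.\<close>
  define over where "over S v p \<longleftrightarrow> (\<forall>i. coeff p i \<in> S) \<and> poly p v = 1" for S v and p :: "'a poly"
  have ex: "\<exists>p. over I v p" if v: "v \<notin> M" for v
  proof -
    note R = adjoin_ring[OF M0 M1 diff mult, where v = v]
    have "z \<in> adjoin M v"
    proof (rule ccontr)
      assume "z \<notin> adjoin M v"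
      then have "adjoin M v = M" using R(1,3,4) by (intro max)
      then show False using R(2) v by simp
    qed
    then obtain p where p: "\<forall>i. coeff p i \<in> M" "z = poly p v" unfolding adjoin_def by blast
    then have "over I v (smult (inverse z) p)" using z0 by (auto simp: over_def I_def mult.commute)
    then show ?thesis by blast
  qed
  text \<open>A relation of minimal degree for \<open>v\<close> can be shortened with a relation for \<open>v\<^sup>-\<^sup>1\<close> of at most the same degree.\<close>
  have shorten: False if v: "v \<noteq> 0" and p: "over I v p" and r: "over I (inverse v) r" and le: "degree r \<le> degree p"
    and min: "\<And>p'. over I v p' \<Longrightarrow> degree p \<le> degree p'" for v p r
  proof -
    define s where "s = degree r"
    define d where "d = degree p"
    \<comment> \<open>Since \<open>1 - coeff r 0\<close> is invertible in \<open>M\<close>, the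
      relation can be solved for 1 in terms of the powers of \<open>inverse v\<close> with positive
      exponent. Multiplied by \<open>v^d\<close>, it replaces the leading power in \<open>p\<close>
      by lower ones with coefficients in \<open>I\<close>.\<close>
    define b where "b i = inverse (1 - coeff r 0) * coeff r i" for i
    have "coeff r 0 \<in> I" using r by (simp add: over_def)
    then have "coeff r 0 \<noteq> 1" using I_1 by metis
    then have r0: "1 - coeff r 0 \<noteq> 0" by simp
    have bI: "b i \<in> I" for i unfolding b_def using r unit I_mult by (auto simp: over_def)
    have "1 = (\<Sum>i\<le>s. coeff r i * inverse v ^ i)" using r by (simp add: over_def poly_altdef s_def)
    also have "{..s} = insert 0 {1..s}" by auto
    finally have "1 = coeff r 0 + (\<Sum>i=1..s. coeff r i * inverse v ^ i)" by simp
    then have "1 - coeff r 0 = (\<Sum>i=1..s. coeff r i * inverse v ^ i)" by (metis add_diff_cancel_left')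
    then have "inverse (1 - coeff r 0) * (1 - coeff r 0) = (\<Sum>i=1..s. b i * inverse v ^ i)"
      by (simp add: b_def sum_distrib_left mult.assoc)
    then have b1: "(\<Sum>i=1..s. b i * inverse v ^ i) = 1" using r0 by simp
    then have "s > 0" by (cases s) auto
    define q where "q = (\<Sum>i=1..s. monom (b i) (d - i))"
    have d: "s \<le> d" "d > 0" using le \<open>s > 0\<close> by (auto simp: s_def d_def)
    have qI: "coeff q i \<in> I" for i
    proof -
      have "(\<Sum>j\<in>A. coeff (monom (b j) (d - j)) i) \<in> I" for A :: "nat set"
        by (induction A rule: infinite_finite_induct) (auto intro: I_0 I_add bI)
      then show ?thesis by (simp only: q_def coeff_sum)
    qed
    have qd: "coeff q i = 0" if "i \<ge> d" for i
      unfolding q_def coeff_sum using that d by (intro sum.neutral) auto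
    have "poly q v = (\<Sum>i=1..s. v ^ d * (b i * inverse v ^ i))"
      unfolding q_def poly_sum poly_monom using v d(1)
      by (intro sum.cong refl) (auto simp: power_diff field_simps)
    also have "\<dots> = v ^ d" using b1 by (simp flip: sum_distrib_left)
    finally have qv: "poly q v = v ^ d" .
    define p' where "p' = p - monom (coeff p d) d + smult (coeff p d) q"
    have "over I v p'"
      unfolding over_def p'_def using p qv qI I_M by (auto simp: over_def poly_monom intro!: I_add I_mult I_diff I_0)
    moreover have "degree p' < d"
    proof (rule degree_lessI)
      show "\<forall>k\<ge>d. coeff p' k = 0"
      proof (intro allI impI)
        fix k assume "d \<le> k"
        then show "coeff p' k = 0" using qd by (cases "k = d") (auto simp: p'_def d_def coeff_eq_0)
      qed
    qed (use d in simp)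
    ultimately show False using min by (fastforce simp: d_def)
  qed
  have minimal: "\<exists>p. over I v p \<and> (\<forall>p'. over I v p' \<longrightarrow> degree p \<le> degree p')" if "v \<notin> M" for v
    using ex_has_least_nat[of "over I v" _ degree] ex[OF that] by blast
  have u0: "u \<noteq> 0" using u M0 by auto
  obtain p where p: "over I u p" "\<And>p'. over I u p' \<Longrightarrow> degree p \<le> degree p'" using minimal u by blast
  obtain r where r: "over I (inverse u) r" "\<And>p'. over I (inverse u) p' \<Longrightarrow> degree r \<le> degree p'" using minimal u by blast
  show False
  proof (cases "degree r \<le> degree p")
    case True
    then show False using shorten[OF u0 p(1) r(1) _ p(2)] by blast
  next
    case False
    then show False using shorten[of "inverse u" r p] u0 p r by simp
  qed
qed

text \<open>Rings that contain \<open>R0\<close> and omit \<open>z\<close> are closed under unions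
  of nonempty chains. Omitting the one element \<open>z\<close> keeps the maximal ring
  proper.\<close>

lemma (in field_extension) ex_valuation_ring:
  assumes R0: "range emb \<subset> R0" "\<And>a b. a \<in> R0 \<Longrightarrow> b \<in> R0 \<Longrightarrow> a - b \<in> R0" "\<And>a b. a \<in> R0 \<Longrightarrow> b \<in> R0 \<Longrightarrow> a * b \<in> R0"
    and z: "inverse z \<in> R0" "z \<notin> R0"
  obtains R where "valuation_ring emb R" "R0 \<subseteq> R" "z \<notin> R"
proof -
  define \<A> where "\<A> = {R. R0 \<subseteq> R \<and> z \<notin> R \<and> (\<forall>a\<in>R. \<forall>b\<in>R. a - b \<in> R \<and> a * b \<in> R)}"
  have "\<exists>M\<in>\<A>. \<forall>X\<in>\<A>. M \<subseteq> X \<longrightarrow> X = M"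
  proof (rule subset_Zorn_nonempty)
    show "\<A> \<noteq> {}" using R0 z by (auto simp: \<A>_def)
  next
    fix \<C> assume C: "\<C> \<noteq> {}" "subset.chain \<A> \<C>"
    then have sub: "\<C> \<subseteq> \<A>" and chain: "\<And>A B. A \<in> \<C> \<Longrightarrow> B \<in> \<C> \<Longrightarrow> A \<subseteq> B \<or> B \<subseteq> A"
      by (auto simp: subset_chain_def)
    have "a - b \<in> \<Union>\<C> \<and> a * b \<in> \<Union>\<C>" if ab: "a \<in> \<Union>\<C>" "b \<in> \<Union>\<C>" for a b
    proof -
      obtain A B where AB: "A \<in> \<C>" "a \<in> A" "B \<in> \<C>" "b \<in> B" using ab by blast
      obtain D where D: "D \<in> \<C>" "a \<in> D" "b \<in> D" using chain[OF AB(1,3)] AB by blast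
      then have "a - b \<in> D" "a * b \<in> D" using sub by (auto simp: \<A>_def)
      then show ?thesis using D by blast
    qed
    then show "\<Union>\<C> \<in> \<A>" using sub C(1) by (fastforce simp: \<A>_def)
  qed
  then obtain M where M: "M \<in> \<A>" and max: "\<And>X. X \<in> \<A> \<Longrightarrow> M \<subseteq> X \<Longrightarrow> X = M" by blast
  have M': "R0 \<subseteq> M" "z \<notin> M" "\<And>a b. a \<in> M \<Longrightarrow> b \<in> M \<Longrightarrow> a - b \<in> M" "\<And>a b. a \<in> M \<Longrightarrow> b \<in> M \<Longrightarrow> a * b \<in> M"
    using M by (auto simp: \<A>_def)
  have "u \<in> M \<or> inverse u \<in> M" for u
  proof (rule maximal_ring_valuation[of M z])
    have "emb 1 \<in> M" using R0(1) M'(1) by blast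
    then show "1 \<in> M" by simp
    show "R = M" if "M \<subseteq> R" "\<And>a b. a \<in> R \<Longrightarrow> b \<in> R \<Longrightarrow> a - b \<in> R" "\<And>a b. a \<in> R \<Longrightarrow> b \<in> R \<Longrightarrow> a * b \<in> R" "z \<notin> R" for R
      using that M'(1) by (intro max) (auto simp: \<A>_def)
  qed (use M' z in auto)
  then have "valuation_ring emb M" using R0(1) M' unfolding valuation_ring_def by blast
  then show ?thesis using that M' by blast
qed

locale curve_at_infinity = curve emb x y m f
  for emb :: "'k::{field,finite} \<Rightarrow> 'a::field" and x y m f +
  fixes Q\<^sub>0 :: "'a set"
  assumes infinite_place: "Q\<^sub>0 \<in> places emb" and pole_iff: "P \<in> places emb \<Longrightarrow> val P x < 0 \<longleftrightarrow> P = Q\<^sub>0"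
begin

sublocale Q\<^sub>0: discrete_place emb Q\<^sub>0
  by (rule discrete_place[OF infinite_place])

lemmas val_infinity = pole[OF infinite_place iffD2[OF pole_iff[OF infinite_place] refl]]

lemma finite_place_iff: "P \<in> places emb \<Longrightarrow> x \<in> ring_at P \<longleftrightarrow> P \<noteq> Q\<^sub>0"
  using pole_iff[of P] val_nonneg_iff[of P x] by auto

lemma val_ev_infinity: "p \<noteq> 0 \<Longrightarrow> val Q\<^sub>0 (ev p) = - int (m * degree p)"
  using val_ev_pole[OF infinite_place, of p] pole_iff[OF infinite_place] val_infinity(1) by (simp add: mult.commute)

lemma val_term_infinity: "p \<noteq> 0 \<Longrightarrow> val Q\<^sub>0 (ev p * y ^ j) = - int (m * degree p + n * j)"
  by (simp add: Q\<^sub>0.val_mult Q\<^sub>0.val_power val_ev_infinity val_infinity)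

lemma distinct_mod:
  assumes "i < m" "j < m" "int (m * d + n * i) = int (m * e + n * j)"
  shows "i = j"
proof -
  have "int n * (int i - int j) = int m * (int e - int d)" using assms(3) by (simp add: algebra_simps)
  then have "int m dvd int n * (int i - int j)" by (metis dvd_triv_left)
  moreover have "coprime (int m) (int n)" using coprime_degree by simp
  ultimately have dvd: "int m dvd int i - int j" by (simp add: coprime_dvd_mult_right_iff)
  show ?thesis using eq_if_dvd_diff[OF assms(1,2) dvd] .
qed

lemma distinct_vals_infinity:
  assumes "i < m" "j < m" "i \<noteq> j" "p \<noteq> 0" "r \<noteq> 0"
  shows "val Q\<^sub>0 (ev p * y ^ i) \<noteq> val Q\<^sub>0 (ev r * y ^ j)"
  using assms(3) distinct_mod[OF assms(1,2)]
  unfolding val_term_infinity[OF assms(4)] val_term_infinity[OF assms(5)] neg_equal_iff_equal by blast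

text \<open>The pole orders \<open>m deg (a j) + n j\<close> of the terms at infinity are distinct
  modulo \<open>m\<close>, so the powers of \<open>y\<close> are independent over
  \<open>K(x)\<close>.\<close>

lemma comb_eq_0_iff: "comb a = 0 \<longleftrightarrow> (\<forall>j<m. a j = 0)"
  unfolding comb_def
  by (subst Q\<^sub>0.sum_distinct_vals(1)) (use distinct_vals_infinity in auto)

lemma comb_eq_iff: "comb a = comb b \<longleftrightarrow> (\<forall>j<m. a j = b j)"
  using comb_eq_0_iff[of "\<lambda>j. a j - b j"] by (simp add: comb_diff)

lemma vge_comb_infinity: "vge Q\<^sub>0 k (comb a) \<longleftrightarrow> (\<forall>j<m. a j \<noteq> 0 \<longrightarrow> k \<le> - int (m * degree (a j) + n * j))"
proof -
  have "vge Q\<^sub>0 k (ev p * y ^ j) \<longleftrightarrow> (p \<noteq> 0 \<longrightarrow> k \<le> - int (m * degree p + n * j))" for p j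
    using val_term_infinity[of p j] by (cases "p = 0") (auto simp: vge_def)
  then show ?thesis
    unfolding comb_def by (subst Q\<^sub>0.sum_distinct_vals(2)) (use distinct_vals_infinity in auto)
qed

text \<open>The valuation of the \<open>j\<close>-th term is congruent to \<open>j\<close> modulo
  \<open>m\<close>, so terms with different \<open>j\<close> cannot cancel.\<close>

lemma vge_comb_zero:
  assumes P: "P \<in> places emb" and \<alpha>: "poly f \<alpha> = 0" "val P (ev [:- \<alpha>, 1:]) > 0"
  shows "vge P k (comb a) \<longleftrightarrow> (\<forall>j<m. a j \<noteq> 0 \<longrightarrow> k \<le> int (m * order \<alpha> (a j) + j))"
proof -
  interpret p: discrete_place emb P using discrete_place[OF P] .
  note z = zero(1-3)[OF P \<alpha>]
  have v: "val P (ev p * y ^ j) = int (m * order \<alpha> p + j)" if "p \<noteq> 0" for p j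
    using that z val_ev_zero[OF P \<alpha>(2) that] by (simp add: p.val_mult p.val_power mult.commute)
  have d: "val P (ev p * y ^ i) \<noteq> val P (ev r * y ^ j)" if "i < m" "j < m" "i \<noteq> j" "p \<noteq> 0" "r \<noteq> 0" for i j p r
  proof -
    have "m * order \<alpha> p + i \<noteq> m * order \<alpha> r + j"
    proof
      assume "m * order \<alpha> p + i = m * order \<alpha> r + j"
      then have "(m * order \<alpha> p + i) mod m = (m * order \<alpha> r + j) mod m" by (rule arg_cong)
      then show False using that by simp
    qed
    then show ?thesis unfolding v[OF that(4)] v[OF that(5)] of_nat_eq_iff .
  qed
  have "vge P k (ev p * y ^ j) \<longleftrightarrow> (p \<noteq> 0 \<longrightarrow> k \<le> int (m * order \<alpha> p + j))" for p j
    using v[of p j] by (cases "p = 0") (auto simp: vge_def)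
  then show ?thesis
    unfolding comb_def by (subst p.sum_distinct_vals(2)) (use d in auto)
qed

section \<open>Frobenius powers and denominators over \<open>K[x,y]\<close>\<close>

lemma CHAR_extension: "CHAR('a) = CHAR('k)"
proof -
  have "emb (of_nat k) = of_nat k" for k by (induction k) (auto simp: emb_add)
  then have "of_nat k = (0 :: 'a) \<longleftrightarrow> of_nat k = (0 :: 'k)" for k by (metis emb_eq_0_iff)
  then show ?thesis by (intro CHAR_eqI) (auto simp: of_nat_eq_0_iff_char_dvd)
qed

lemma prime_CHAR: "prime CHAR('k)"
  using prime_CHAR_semidom[where 'a = 'k] finite_imp_CHAR_pos[where 'a = 'k] by simp

text \<open>For a power \<open>L\<close> of the characteristic, \<open>j \<mapsto> j L mod m\<close> is injective on \<open>{..<m}\<close>, so that raising to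
  the power \<open>L\<close> permutes the powers of \<open>y\<close> up to powers of \<open>f\<close>.\<close>
lemma comb_power_CHAR:
  assumes L: "L = CHAR('k) ^ s" and i: "i < m" and eq: "ev h * comb a ^ L = ev g * comb b"
  shows "h * (a i ^ L * f ^ (i * L div m)) = g * b (i * L mod m)"
proof -
  have "coprime CHAR('k) m" using prime_CHAR char by (simp add: prime_imp_coprime)
  then have "coprime m L" unfolding L by (simp add: coprime_commute)
  then have inj: "j = j'" if "j < m" "j' < m" "j * L mod m = j' * L mod m" for j j'
  proof -
    have "int m dvd int (j * L) - int (j' * L)" using that(3) by (metis mod_eq_dvd_iff of_nat_mod)
    then have "int m dvd (int j - int j') * int L" by (simp add: algebra_simps)
    then have dvd: "int m dvd int j - int j'" using \<open>coprime m L\<close> by (simp add: coprime_dvd_mult_left_iff)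
    show ?thesis using eq_if_dvd_diff[OF that(1,2) dvd] .
  qed
  \<comment> \<open>The coordinates of \<open>comb a ^ L\<close>. By injectivity at most one
    \<open>j\<close> contributes to each \<open>k\<close>, so no coordinate of \<open>a\<close> is
    lost in a sum.\<close>
  define c where "c k = (\<Sum>j<m. if j * L mod m = k then a j ^ L * f ^ (j * L div m) else 0)" for k
  have ci: "c (i * L mod m) = a i ^ L * f ^ (i * L div m)"
  proof -
    have "c (i * L mod m) = (\<Sum>j<m. if j = i then a j ^ L * f ^ (j * L div m) else 0)"
      unfolding c_def
    proof (intro sum.cong refl)
      fix j assume "j \<in> {..<m}"
      then have "j * L mod m = i * L mod m \<longleftrightarrow> j = i" using inj[of j i] i by blast
      then show "(if j * L mod m = i * L mod m then a j ^ L * f ^ (j * L div m) else 0)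
          = (if j = i then a j ^ L * f ^ (j * L div m) else 0)" by simp
    qed
    then show ?thesis using i by simp
  qed
  have "comb a ^ L = (\<Sum>j<m. (ev (a j) * y ^ j) ^ L)"
    unfolding comb_def by (rule freshmans_dream_sum'[of L s]) (use L CHAR_extension prime_CHAR in auto)
  also have "\<dots> = (\<Sum>j<m. ev (a j ^ L * f ^ (j * L div m)) * y ^ (j * L mod m))"
  proof (intro sum.cong refl)
    fix j
    have "(y ^ j) ^ L = y ^ (m * (j * L div m) + j * L mod m)" by (simp flip: power_mult)
    also have "\<dots> = ev f ^ (j * L div m) * y ^ (j * L mod m)" by (simp only: power_add power_mult y_power_m)
    finally show "(ev (a j) * y ^ j) ^ L = ev (a j ^ L * f ^ (j * L div m)) * y ^ (j * L mod m)"
      by (simp add: power_mult_distrib eval1_mult eval1_power)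
  qed
  also have "\<dots> = (\<Sum>j<m. \<Sum>k<m. if j * L mod m = k then ev (a j ^ L * f ^ (j * L div m)) * y ^ k else 0)"
    using m by (intro sum.cong refl) (simp add: sum.delta')
  also have "\<dots> = (\<Sum>k<m. \<Sum>j<m. if j * L mod m = k then ev (a j ^ L * f ^ (j * L div m)) * y ^ k else 0)"
    by (rule sum.swap)
  also have "\<dots> = comb c"
    unfolding comb_def c_def eval1_sum sum_distrib_right by (intro sum.cong refl) auto
  finally have "comb (\<lambda>j. h * c j) = comb (\<lambda>j. g * b j)" using eq by (simp add: comb_smult)
  then have "h * c (i * L mod m) = g * b (i * L mod m)" using m by (simp add: comb_eq_iff)
  then show ?thesis by (simp only: ci)
qed

lemma ex_prime_divisor:
  assumes "g \<noteq> (0 :: 'k poly)" "\<not> is_unit g"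
  obtains p where "p dvd g" "prime_elem p"
proof -
  have "g dvd g \<and> degree g > 0" using assms by (auto simp: is_unit_iff_degree)
  then obtain p where p: "p dvd g" "degree p > 0" and min: "\<And>r. r dvd g \<Longrightarrow> degree r > 0 \<Longrightarrow> degree p \<le> degree r"
    using ex_has_least_nat[of "\<lambda>p. p dvd g \<and> degree p > 0" g degree] by blast
  have p0: "p \<noteq> 0" using p by auto
  have "irreducible p"
  proof (rule irreducibleI)
    fix a b assume ab: "p = a * b"
    then have nz: "a \<noteq> 0" "b \<noteq> 0" using p0 by auto
    show "is_unit a \<or> is_unit b"
    proof (rule ccontr)
      assume "\<not> (is_unit a \<or> is_unit b)"
      then have "degree a > 0" "degree b > 0" using nz by (auto simp: is_unit_iff_degree)
      moreover have "a dvd g" using p(1) ab by (metis dvd_mult_left)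
      ultimately show False using min[of a] nz by (simp add: ab degree_mult_eq)
    qed
  qed (use p p0 in \<open>auto simp: is_unit_iff_degree\<close>)
  then show ?thesis using that p field_poly_irreducible_imp_prime by blast
qed

lemma prime_power_dvd_cancel:
  assumes p: "prime_elem (p :: 'k poly)" and u: "\<not> p dvd u"
  shows "p ^ k dvd u * h \<Longrightarrow> p ^ k dvd h"
proof (induction k arbitrary: h)
  case (Suc k)
  then have "p dvd u * h" by (metis dvd_mult_left power_Suc)
  then obtain h' where h': "h = p * h'" using p u prime_elem_dvd_mult_iff by (metis dvdE)
  then have "p * p ^ k dvd p * (u * h')" using Suc.prems by (simp add: mult.left_commute)
  then have "p ^ k dvd u * h'" using p by (simp add: prime_elem_def)
  then show ?case using Suc.IH[of h'] h' p by (simp add: prime_elem_def)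
qed simp

text \<open>By separability \<open>p\<close> divides \<open>f\<close> at most once, so the power of
  \<open>f\<close> absorbs at most \<open>k = i L div m\<close> of the \<open>L\<close> factors
  \<open>p\<close>. As \<open>i < m\<close>, at least \<open>L / m\<close> of them remain, and these
  divide \<open>h\<close>.\<close>

lemma prime_power_dvd_bound:
  assumes p: "prime_elem p" and h: "h \<noteq> 0" and a: "\<not> p dvd a" and i: "i < m"
    and dvd: "p ^ L dvd h * (a ^ L * f ^ (i * L div m))"
  shows "L \<le> m * degree h"
proof -
  define k where "k = i * L div m"
  have p0: "p \<noteq> 0" "\<not> is_unit p" using p by (auto simp: prime_elem_def)
  then have dp: "degree p > 0" by (metis gr0I is_unit_iff_degree)
  have k: "m * k \<le> i * L" by (simp add: k_def)
  have "i * L \<le> (m - 1) * L" using i by (intro mult_le_mono1) simp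
  moreover have "(m - 1) * L + L = m * L" using m by (metis Suc_diff_1 add.commute less_le_trans mult_Suc zero_less_numeral)
  ultimately have mL: "m * k + L \<le> m * L" using k by linarith
  then have kL: "k \<le> L" using m by (metis add_leD1 mult_le_cancel1 not_numeral_le_zero gr0I)
  have "\<exists>e f'. f = p ^ e * f' \<and> e \<le> 1 \<and> \<not> p dvd f'"
  proof (cases "p dvd f")
    case False
    then show ?thesis by (intro exI[of _ 0] exI[of _ f]) simp
  next
    case True
    then obtain f' where f': "f = p * f'" by (elim dvdE)
    have "\<not> p dvd f'"
    proof
      assume "p dvd f'"
      then have "p dvd pderiv f" by (simp add: f' pderiv_mult)
      then show False using True separable p0(2) coprime_common_divisor by blast
    qed
    then show ?thesis using f' by (intro exI[of _ 1] exI[of _ f']) simp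
  qed
  then obtain e f' where f: "f = p ^ e * f'" "e \<le> 1" "\<not> p dvd f'" by blast
  have u: "\<not> p dvd a ^ L * f' ^ k"
    using a f(3) p prime_elem_dvd_power by (auto simp: prime_elem_dvd_mult_iff)
  have "p ^ k * p ^ (L - k) dvd p ^ k * ((a ^ L * f' ^ k) * h)"
  proof -
    have "p ^ L dvd p ^ (e * k) * ((a ^ L * f' ^ k) * h)"
      using dvd unfolding k_def[symmetric] by (simp add: f(1) power_mult_distrib power_mult mult_ac)
    moreover have "p ^ (e * k) dvd p ^ k" using f(2) by (intro le_imp_power_dvd) simp
    ultimately have "p ^ L dvd p ^ k * ((a ^ L * f' ^ k) * h)" by (meson dvd_trans mult_dvd_mono dvd_refl)
    then show ?thesis using kL by (simp flip: power_add)
  qed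
  then have "p ^ (L - k) dvd (a ^ L * f' ^ k) * h" using p0 by simp
  then have "p ^ (L - k) dvd h" by (rule prime_power_dvd_cancel[OF p u])
  then have "degree (p ^ (L - k)) \<le> degree h" using h by (intro dvd_imp_degree_le)
  moreover have "L - k \<le> degree (p ^ (L - k))" using dp by (simp add: degree_power_eq p0)
  ultimately have "m * (L - k) \<le> m * degree h" by simp
  then show ?thesis using mL by (simp add: right_diff_distrib')
qed

text \<open>Complete integral closedness: the powers of \<open>z\<close> have the common denominator
  \<open>h\<close>. An integral equation for \<open>z\<close> supplies such an \<open>h\<close> in
  \<open>integral_in_coord\<close>.\<close>

lemma coord_closed:
  assumes h: "h \<noteq> 0" and bounded: "\<And>i. ev h * z ^ i \<in> coordinate_ring"
  shows "z \<in> coordinate_ring"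
proof (rule ccontr)
  assume z: "z \<notin> coordinate_ring"
  define Den where "Den g \<longleftrightarrow> g \<noteq> 0 \<and> ev g * z \<in> coordinate_ring" for g
  have "\<exists>g. Den g"
  proof -
    obtain w g where "w \<in> coordinate_ring" "g \<noteq> 0" "z = w / ev g" by (rule quotient_ev)
    then show ?thesis by (intro exI[of _ g]) (simp add: Den_def)
  qed
  then obtain g where g: "Den g" and min: "\<And>g'. Den g' \<Longrightarrow> degree g \<le> degree g'"
    using ex_has_least_nat[of Den _ degree] by blast
  have "\<not> is_unit g"
  proof
    assume "is_unit g"
    then obtain g' where "1 = g * g'" by (elim dvdE)
    moreover have "ev g' * (ev g * z) = ev (g * g') * z" by (simp only: eval1_mult mult_ac)
    ultimately have "ev g' * (ev g * z) = z" by (metis eval1_1 mult_1)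
    moreover have "ev g' * (ev g * z) \<in> coordinate_ring" by (rule coord_ev_mult) (use g Den_def in blast)
    ultimately show False using z by metis
  qed
  then obtain p where p: "p dvd g" "prime_elem p"
    using ex_prime_divisor[of g] g unfolding Den_def by blast
  then obtain g' where g': "g = p * g'" by (elim dvdE)
  have p0: "p \<noteq> 0" "\<not> is_unit p" using p by (auto simp: prime_elem_def)
  then have dp: "degree p > 0" by (metis gr0I is_unit_iff_degree)
  have g'0: "g' \<noteq> 0" using g g' by (auto simp: Den_def)
  \<comment> \<open>By minimality of \<open>g\<close>, the element \<open>z'\<close> lies outside
    the ring but has the prime denominator \<open>p\<close>, so some coordinate of
    \<open>p z'\<close> is not divisible by \<open>p\<close>.\<close>
  define z' where "z' = ev g' * z"
  have z': "z' \<notin> coordinate_ring"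
  proof
    assume "z' \<in> coordinate_ring"
    then have "degree g \<le> degree g'" using g'0 by (intro min) (simp add: Den_def z'_def)
    then show False using dp p0 g'0 by (simp add: g' degree_mult_eq)
  qed
  have "ev p * z' \<in> coordinate_ring" using g by (simp add: Den_def z'_def g' eval1_mult mult.assoc)
  then obtain a where a: "ev p * z' = comb a" by blast
  have "\<exists>i<m. \<not> p dvd a i"
  proof (rule ccontr)
    assume "\<not> ?thesis"
    then have "\<forall>i\<in>{..<m}. \<exists>b. a i = p * b" by (auto elim: dvdE)
    from bchoice[OF this] obtain b where "\<And>i. i < m \<Longrightarrow> a i = p * b i" by blast
    then have "comb a = ev p * comb b" using comb_eq_iff[of a "\<lambda>i. p * b i"] by (simp add: comb_smult)
    then have "z' = comb b" using a p0 by simp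
    then show False using z' by blast
  qed
  then obtain i where i: "i < m" "\<not> p dvd a i" by blast
  \<comment> \<open>The exponent is chosen after \<open>h\<close>: the characteristic is at least 2,
    so \<open>L\<close> exceeds \<open>m deg h\<close>, more than \<open>h\<close> can
    absorb.\<close>
  define L where "L = CHAR('k) ^ Suc (m * degree h)"
  have "ev h * z' ^ L = ev (g' ^ L) * (ev h * z ^ L)"
    by (simp add: z'_def power_mult_distrib eval1_power mult_ac)
  then have "ev h * z' ^ L \<in> coordinate_ring" using coord_ev_mult[OF bounded[of L], of "g' ^ L"] by (simp only:)
  then obtain b where "ev h * z' ^ L = comb b" by blast
  then have "ev h * comb a ^ L = ev (p ^ L) * comb b"
    by (simp flip: a add: power_mult_distrib eval1_power mult_ac)
  then have "h * (a i ^ L * f ^ (i * L div m)) = p ^ L * b (i * L mod m)"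
    by (rule comb_power_CHAR[OF L_def i(1)])
  then have "p ^ L dvd h * (a i ^ L * f ^ (i * L div m))" by simp
  then have "L \<le> m * degree h" by (rule prime_power_dvd_bound[OF p(2) h i(2,1)])
  moreover have "Suc (m * degree h) < L" unfolding L_def using prime_CHAR prime_gt_1_nat by (intro power_gt_expt) auto
  ultimately show False by simp
qed

text \<open>Multiplied by a power of \<open>z\<close>, the hypothesis is a monic equation over the
  ring. It expresses all powers of \<open>z\<close> by those up to \<open>z^d\<close>, whose
  denominators \<open>g^d\<close> clears.\<close>

lemma integral_in_coord:
  assumes z: "z = poly p (inverse z)" and p: "\<And>i. coeff p i \<in> coordinate_ring"
  shows "z \<in> coordinate_ring"
proof (cases "z = 0")
  case z0: False
  define d where "d = degree p"
  have rec: "z ^ Suc i = (\<Sum>k\<le>d. coeff p k * z ^ (i - k))" if "i \<ge> d" for i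
  proof -
    have "z ^ Suc i = poly p (inverse z) * z ^ i" using z by simp
    also have "\<dots> = (\<Sum>k\<le>d. coeff p k * inverse z ^ k * z ^ i)" by (simp add: poly_altdef d_def sum_distrib_right)
    also have "\<dots> = (\<Sum>k\<le>d. coeff p k * z ^ (i - k))"
    proof (intro sum.cong refl)
      fix k assume "k \<in> {..d}"
      then have "z ^ i = z ^ k * z ^ (i - k)" using that by (simp flip: power_add)
      then show "coeff p k * inverse z ^ k * z ^ i = coeff p k * z ^ (i - k)" using z0 by (simp add: power_inverse)
    qed
    finally show ?thesis .
  qed
  obtain w g where w: "w \<in> coordinate_ring" "g \<noteq> 0" "z = w / ev g" by (rule quotient_ev)
  have gi: "ev g ^ d * z ^ i \<in> coordinate_ring" for i
  proof (induction i rule: less_induct)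
    case (less i)
    show ?case
    proof (cases "i \<le> d")
      case True
      then have "ev g ^ d = ev g ^ (d - i) * ev g ^ i" by (simp flip: power_add)
      then have "ev g ^ d * z ^ i = ev (g ^ (d - i)) * w ^ i"
        using w by (simp add: power_divide eval1_power)
      then show ?thesis using w coord_ev_mult coord_power by metis
    next
      case False
      then obtain l where l: "i = Suc l" "d \<le> l" by (cases i) auto
      have eq: "ev g ^ d * z ^ i = (\<Sum>k\<le>d. coeff p k * (ev g ^ d * z ^ (l - k)))"
        unfolding l(1) rec[OF l(2)] sum_distrib_left by (simp add: mult.left_commute)
      show ?thesis unfolding eq by (intro coord_sum coord_mult[OF p] less.IH) (use l in simp)
    qed
  qed
  show ?thesis
  proof (rule coord_closed)
    show "g ^ d \<noteq> 0" using w by simp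
    show "ev (g ^ d) * z ^ i \<in> coordinate_ring" for i using gi by (simp add: eval1_power)
  qed
qed simp

text \<open>By integrality, an element \<open>z\<close> outside the ring is also outside the ring
  generated with \<open>inverse z\<close>. A valuation ring that contains the latter and omits
  \<open>z\<close> contains \<open>x\<close>, so its place is not \<open>Q\<^sub>0\<close>, although
  \<open>z\<close> has a pole there.\<close>

lemma regular_in_coord:
  assumes reg: "\<And>P. P \<in> places emb \<Longrightarrow> P \<noteq> Q\<^sub>0 \<Longrightarrow> z \<in> ring_at P"
  shows "z \<in> coordinate_ring"
proof (rule ccontr)
  assume z: "z \<notin> coordinate_ring"
  define R0 where "R0 = adjoin coordinate_ring (inverse z)"
  note R0 = adjoin_ring[OF coord_0 coord_1 coord_diff coord_mult, where v = "inverse z", folded R0_def]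
  have "z \<notin> R0"
  proof
    assume "z \<in> R0"
    then obtain p where "z = poly p (inverse z)" "\<And>i. coeff p i \<in> coordinate_ring" unfolding R0_def adjoin_def by blast
    then show False using z integral_in_coord by blast
  qed
  moreover have "range emb \<subset> R0"
  proof
    have emb: "emb c \<in> coordinate_ring" for c using coord_ev[of "[:c:]"] by simp
    then show "range emb \<subseteq> R0" using R0(1) by blast
    have "x \<in> coordinate_ring" using coord_ev[of "[:0, 1:]"] by simp
    moreover have "x \<notin> range emb"
    proof
      assume "x \<in> range emb"
      then obtain c where "x = emb c" by blast
      then have "ev [:- c, 1:] = 0" by (simp add: emb_uminus)
      then show False by (simp only: ev_eq_0_iff) simp
    qed
    ultimately show "range emb \<noteq> R0" using R0(1) by blast
  qed
  ultimately obtain R where R: "valuation_ring emb R" "R0 \<subseteq> R" "z \<notin> R"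
    using ex_valuation_ring[of R0 z] R0(2-4) by blast
  define P where "P = nonunits R"
  have P: "P \<in> places emb" "ring_at P = R" using R(1) ring_at_nonunits by (auto simp: places_def P_def)
  have "x \<in> ring_at P" using coord_ev[of "[:0, 1:]"] R0(1) R(2) P by auto
  then have "P \<noteq> Q\<^sub>0" using finite_place_iff P by blast
  then show False using reg P R(3) by blast
qed

end

section \<open>Riemann's inequality\<close>

text \<open>Since \<open>c\<close> is coprime to \<open>m\<close>, the remainders run through all
  residues, with sum \<open>m (m - 1) / 2\<close>. Doubling avoids the fraction.\<close>

lemma sum_div_arith_progression:
  fixes m :: nat and c d :: int
  assumes m: "m > 0" and cop: "coprime (int m) c"
  shows "2 * (\<Sum>j<m. (d + c * int j) div int m) = 2 * d + (c - 1) * (int m - 1)"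
proof -
  define r where "r j = nat ((d + c * int j) mod int m)" for j
  have r: "int (r j) = (d + c * int j) mod int m" "r j < m" for j using m by (auto simp: r_def nat_less_iff)
  have "inj_on r {..<m}"
  proof (rule inj_onI)
    fix i j assume ij: "i \<in> {..<m}" "j \<in> {..<m}" "r i = r j"
    then have "(d + c * int i) mod int m = (d + c * int j) mod int m" using r by metis
    then have "int m dvd (d + c * int i) - (d + c * int j)" by (simp add: mod_eq_dvd_iff)
    then have "int m dvd c * (int i - int j)" by (simp add: algebra_simps)
    then have dvd: "int m dvd int i - int j" using cop by (simp add: coprime_dvd_mult_right_iff)
    show "i = j" using eq_if_dvd_diff[OF _ _ dvd] ij by simp
  qed
  moreover from this have "r ` {..<m} = {..<m}" using r by (intro endo_inj_surj) auto
  ultimately have "(\<Sum>j<m. int (r j)) = (\<Sum>j<m. int j)"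
    by (metis (no_types, lifting) sum.reindex_cong)
  moreover have gauss: "2 * (\<Sum>j<m. int j) = int m * (int m - 1)"
    by (induction m) (auto simp: algebra_simps)
  moreover have "(\<Sum>j<m. d + c * int j) = (\<Sum>j<m. int m * ((d + c * int j) div int m) + int (r j))"
    unfolding r by simp
  ultimately have "2 * (int m * d + c * (\<Sum>j<m. int j)) = 2 * (int m * (\<Sum>j<m. (d + c * int j) div int m)) + int m * (int m - 1)"
    by (simp add: sum.distrib sum_distrib_left)
  moreover have "2 * (c * (\<Sum>j<m. int j)) = c * (int m * (int m - 1))" using gauss by (metis mult.left_commute)
  ultimately have "int m * (2 * (\<Sum>j<m. (d + c * int j) div int m)) = int m * (2 * d + (c - 1) * (int m - 1))"
    by (simp add: algebra_simps)
  then show ?thesis using m by simp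
qed

lemma (in discrete_place) val_power_int: "a \<noteq> 0 \<Longrightarrow> val P (a powi k) = k * val P a"
  by (simp add: power_int_def val_power val_inverse)

text \<open>Listing 0 separately makes the count correct for \<open>e = 0\<close> as well, where
  only the zero polynomial remains.\<close>

lemma card_poly_degree_less:
  "card {p :: 'k::{field,finite} poly. p = 0 \<or> degree p < e} = CARD('k) ^ e"
proof (cases e)
  case (Suc d)
  then have "{p :: 'k poly. p = 0 \<or> degree p < e} = {p. degree p \<le> d}" by auto
  then show ?thesis by (simp only: card_poly_degree_le Suc)
qed auto

context curve_at_infinity
begin

definition curve_genus :: int where
  "curve_genus = (int m - 1) * (int n - 1) div 2"

lemma curve_genus: "2 * curve_genus = (int m - 1) * (int n - 1)"
proof -
  have "\<not> (even m \<and> even n)" using coprime_degree coprime_common_divisor[of m n 2] by auto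
  then have "even ((int m - 1) * (int n - 1))" by auto
  then show ?thesis by (simp add: curve_genus_def)
qed

lemma sum_slopes_infinity: "2 * (\<Sum>j<m. (d - int n * int j) div int m) = 2 * d - (int n + 1) * (int m - 1)"
  using sum_div_arith_progression[of m "- int n" d] m coprime_degree by (simp add: algebra_simps)

text \<open>Subtracting a large enough effective \<open>C\<close> leaves functions that are regular
  at the finite places, hence in \<open>K[x,y]\<close>, and vanish at infinity; only 0 does. Adding
  \<open>C\<close> back enlarges the space by a finite factor.\<close>

lemma finite_RR_space: "divisor emb A \<Longrightarrow> finite (RR_space emb A)"
proof -
  assume A: "divisor emb A"
  define S where "S = insert Q\<^sub>0 (Poly_Mapping.keys A)"
  have S: "finite S" "S \<subseteq> places emb" using A infinite_place by (auto simp: S_def divisor_def)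
  define C where "C = (\<Sum>P\<in>S. frag_cmul (\<bar>Poly_Mapping.lookup A P\<bar> + 1) (frag_of P))"
  have C: "Poly_Mapping.lookup C P = (if P \<in> S then \<bar>Poly_Mapping.lookup A P\<bar> + 1 else 0)" for P
    using S(1) by (simp add: C_def lookup_sum if_distrib[of "(*) _"] sum.delta' cong: if_cong)
  have "divisor emb C" using S C by (auto simp: divisor_def in_keys_iff split: if_splits)
  have "RR_space emb (A - C) \<subseteq> {0}"
  proof
    fix z assume z: "z \<in> RR_space emb (A - C)"
    have v: "vge P (if P \<in> S then 1 else 0) z" if P: "P \<in> places emb" for P
    proof -
      interpret p: discrete_place emb P using discrete_place[OF P] .
      have "vge P (- Poly_Mapping.lookup (A - C) P) z" using z P by (auto simp: RR_space_altdef)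
      then show ?thesis by (rule p.vge_mono) (auto simp: lookup_minus C S_def in_keys_iff)
    qed
    have "z \<in> coordinate_ring"
    proof (rule regular_in_coord)
      fix P assume P: "P \<in> places emb"
      interpret p: discrete_place emb P using discrete_place[OF P] .
      have "vge P 0 z" using v[OF P] by (rule p.vge_mono) simp
      then show "z \<in> ring_at P" by (simp add: p.vge_ring_iff)
    qed
    then obtain a where a: "z = comb a" by blast
    have "vge Q\<^sub>0 1 (comb a)" using v[OF infinite_place] by (simp add: S_def a)
    then have *: "\<forall>j<m. a j \<noteq> 0 \<longrightarrow> 1 \<le> - int (m * degree (a j) + n * j)" unfolding vge_comb_infinity .
    have "\<forall>j<m. a j = 0"
    proof (intro allI impI, rule ccontr)
      fix j assume "j < m" "a j \<noteq> 0"
      then have "1 \<le> - int (m * degree (a j) + n * j)" using * by blast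
      then show False by linarith
    qed
    then show "z \<in> {0}" by (simp add: a comb_eq_0_iff)
  qed
  then have "finite (RR_space emb (A - C))" by (rule finite_subset) simp
  then have "finite (RR_space emb (A - C + C))"
    using \<open>divisor emb C\<close> by (intro ell_add_effective) (auto simp: C)
  then show ?thesis by simp
qed

text \<open>The elements of \<open>K[x,y]\<close> with \<open>m deg (a j) + n j \<le> N\<close> for
  all nonzero \<open>a j\<close> belong to the space, and independence of the powers of
  \<open>y\<close> allows them to be counted by coordinates.\<close>

lemma ell_infinity_ge: "N + 1 - curve_genus \<le> int (ell emb (frag_cmul N (frag_of Q\<^sub>0)))"
proof -
  define A where "A = frag_cmul N (frag_of Q\<^sub>0)"
  have lA: "Poly_Mapping.lookup A P = (if P = Q\<^sub>0 then N else 0)" for P by (simp add: A_def)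
  have "divisor emb A" using infinite_place by (auto simp: A_def divisor_def)
  note fin = finite_RR_space[OF this]
  \<comment> \<open>The number of free coefficients of \<open>a j\<close>. Truncation at 0 can only
    increase the sum, so the estimate holds for every integer \<open>N\<close>.\<close>
  define e where "e j = nat ((N - int n * int j) div int m + 1)" for j
  let ?T = "PiE {..<m} (\<lambda>j. {p :: 'k poly. p = 0 \<or> degree p < e j})"
  have "comb a \<in> RR_space emb A" if a: "a \<in> ?T" for a
    unfolding RR_space_altdef
  proof (intro CollectI ballI)
    fix P assume P: "P \<in> places emb"
    interpret p: discrete_place emb P using discrete_place[OF P] .
    show "vge P (- Poly_Mapping.lookup A P) (comb a)"
    proof (cases "P = Q\<^sub>0")
      case False
      then have "comb a \<in> ring_at P" using coord_in_ring[OF P] finite_place_iff[OF P] by blast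
      then show ?thesis using False by (simp add: lA p.vge_ring_iff)
    next
      case True
      have "- N \<le> - int (m * degree (a j) + n * j)" if j: "j < m" "a j \<noteq> 0" for j
      proof -
        have "degree (a j) < e j" using a j by (auto simp: PiE_iff)
        then have "int (degree (a j)) \<le> (N - int n * int j) div int m" by (simp add: e_def)
        then have "int m * int (degree (a j)) \<le> int m * ((N - int n * int j) div int m)" by (intro mult_left_mono) auto
        also have "\<dots> \<le> N - int n * int j" using m by (intro mult_div_le) simp
        finally show ?thesis by simp
      qed
      then show ?thesis unfolding True lA by (auto simp: vge_comb_infinity)
    qed
  qed
  moreover have "inj_on comb ?T"
    by (intro inj_onI, subst (asm) comb_eq_iff) (auto intro: PiE_ext)
  ultimately have "card ?T \<le> card (RR_space emb A)" using fin by (intro card_inj_on_le[of comb]) auto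
  moreover have "card ?T = CARD('k) ^ (\<Sum>j<m. e j)" by (simp add: card_PiE card_poly_degree_less power_sum)
  ultimately have "(\<Sum>j<m. e j) \<le> ell emb A" by (simp only: card_RR_space[OF fin] card_power_le_iff)
  then have 1: "(\<Sum>j<m. int (e j)) \<le> int (ell emb A)" by (metis of_nat_sum of_nat_le_iff)
  have "(\<Sum>j<m. (N - int n * int j) div int m + 1) \<le> (\<Sum>j<m. int (e j))"
    by (intro sum_mono) (simp add: e_def)
  then have "(\<Sum>j<m. (N - int n * int j) div int m) + int m \<le> int (ell emb A)" using 1 by (simp add: sum.distrib)
  moreover define S where "S = (\<Sum>j<m. (N - int n * int j) div int m)"
  ultimately have "S + int m \<le> int (ell emb A)" by simp
  moreover have "2 * (N + 1 - curve_genus) = 2 * (S + int m)"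
    using sum_slopes_infinity[of N, folded S_def] curve_genus by (simp add: algebra_simps)
  then have "N + 1 - curve_genus = S + int m" by (simp only: mult_cancel_left) simp
  ultimately show ?thesis unfolding A_def by (simp only:)
qed

lemma ell_mono_scale:
  assumes A: "divisor emb A" and h: "h \<noteq> 0"
    and le: "\<And>P. P \<in> places emb \<Longrightarrow> Poly_Mapping.lookup E P + val P h \<le> Poly_Mapping.lookup A P"
  shows "finite (RR_space emb E) \<Longrightarrow> ell emb E \<le> ell emb A"
proof -
  assume fin: "finite (RR_space emb E)"
  have "z / h \<in> RR_space emb A" if z: "z \<in> RR_space emb E" for z
    unfolding RR_space_altdef
  proof (intro CollectI ballI)
    fix P assume P: "P \<in> places emb"
    interpret p: discrete_place emb P using discrete_place[OF P] .
    show "vge P (- Poly_Mapping.lookup A P) (z / h)"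
      using z P le[OF P] h by (cases "z = 0") (auto simp: RR_space_altdef vge_def p.val_divide)
  qed
  moreover have "inj_on (\<lambda>z. z / h) (RR_space emb E)" using h by (auto simp: inj_on_def)
  ultimately have "card (RR_space emb E) \<le> card (RR_space emb A)"
    using finite_RR_space[OF A] by (intro card_inj_on_le[of "\<lambda>z. z / h"]) auto
  then show ?thesis by (simp only: card_RR_space[OF fin] card_RR_space[OF finite_RR_space[OF A]] card_power_le_iff)
qed

text \<open>Each zero contributes at least 1 to a sum that never exceeds
  \<open>m deg h\<close>.\<close>

lemma finite_zeros:
  assumes "h \<noteq> 0"
  shows "finite {P \<in> places emb. ev h \<in> P}"
proof (rule ccontr)
  assume "infinite {P \<in> places emb. ev h \<in> P}"
  then obtain T where T: "finite T" "card T = Suc (m * degree h)" "T \<subseteq> {P \<in> places emb. ev h \<in> P}"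
    using infinite_arbitrarily_large by blast
  have "1 \<le> val P (ev h) * int (place_degree emb P)" if "P \<in> T" for P
  proof -
    have P: "P \<in> places emb" "ev h \<in> P" using T that by auto
    interpret p: discrete_place emb P using discrete_place[OF P(1)] .
    have "val P (ev h) > 0" using p.val_pos_iff[of "ev h"] P assms by simp
    then show ?thesis using place_degree_pos[OF P(1)] by (simp add: int_one_le_iff_zero_less)
  qed
  then have "int (card T) \<le> (\<Sum>P\<in>T. val P (ev h) * int (place_degree emb P))"
    using sum_mono[of T "\<lambda>_. 1" "\<lambda>P. val P (ev h) * int (place_degree emb P)"] by simp
  also have "\<dots> \<le> int (m * degree h)" using T assms
    by (intro sum_local_degrees_le[OF _ _ _ _ degree_bound_ev]) auto
  finally show False using T(2) by simp
qed

lemma ex_multiple_zero: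
  assumes "finite S" "S \<subseteq> places emb" "Q\<^sub>0 \<notin> S"
  obtains h where "h \<noteq> 0" "\<And>P. P \<in> S \<Longrightarrow> int (e P) \<le> val P (ev h)"
proof -
  have "\<forall>P\<in>S. \<exists>h. h \<noteq> 0 \<and> ev h \<in> P"
    using ev_in_place finite_place_iff assms by (metis subsetD)
  from bchoice[OF this] obtain h where h: "\<And>P. P \<in> S \<Longrightarrow> h P \<noteq> 0 \<and> ev (h P) \<in> P" by blast
  show ?thesis
  proof (rule that[of "\<Prod>P\<in>S. h P ^ e P"])
    show "(\<Prod>P\<in>S. h P ^ e P) \<noteq> 0" using assms(1) h by simp
    fix P assume PS: "P \<in> S"
    then have P: "P \<in> places emb" using assms by blast
    interpret p: discrete_place emb P using discrete_place[OF P] .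
    have x: "x \<in> ring_at P" using finite_place_iff[OF P] PS assms by blast
    have nonneg: "0 \<le> val P (ev (h R ^ e R))" if "R \<in> S" for R
      using p.val_nonneg_iff[of "ev (h R ^ e R)"] p.eval1_in_ring[OF x] h[OF that] by simp
    have "int (e P) * 1 \<le> int (e P) * val P (ev (h P))"
      using p.val_pos_iff[of "ev (h P)"] h[OF PS] by (intro mult_left_mono) auto
    then have "int (e P) \<le> val P (ev (h P ^ e P))" using h[OF PS] by (simp add: eval1_power p.val_power)
    also have "\<dots> \<le> (\<Sum>R\<in>S. val P (ev (h R ^ e R)))" using nonneg assms(1) PS
      by (intro member_le_sum) auto
    also have "\<dots> = val P (ev (\<Prod>P\<in>S. h P ^ e P))"
      unfolding eval1_prod using h by (subst p.val_prod) auto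
    finally show "int (e P) \<le> val P (ev (\<Prod>P\<in>S. h P ^ e P))" .
  qed
qed

text \<open>Multiplication by a polynomial in \<open>x\<close> that vanishes on the support of \<open>A\<close> reduces the claim to
  divisors \<open>N Q\<^sub>0 - B\<close> with \<open>B \<ge> 0\<close>.\<close>
lemma riemann_inequality:
  assumes A: "divisor emb A"
  shows "div_degree emb A + 1 - curve_genus \<le> int (ell emb A)"
proof -
  let ?A = "Poly_Mapping.lookup A"
  obtain h where h: "h \<noteq> 0" and hv: "\<And>P. P \<in> Poly_Mapping.keys A - {Q\<^sub>0} \<Longrightarrow> int (nat \<bar>?A P\<bar>) \<le> val P (ev h)"
    by (rule ex_multiple_zero[of "Poly_Mapping.keys A - {Q\<^sub>0}" "\<lambda>P. nat \<bar>?A P\<bar>"]) (use A in \<open>auto simp: divisor_def\<close>)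
  define S where "S = {P \<in> places emb. ev h \<in> P}"
  have finS: "finite S" using finite_zeros[OF h] by (simp add: S_def)
  have Q0S: "Q\<^sub>0 \<notin> S"
    using Q\<^sub>0.val_pos_iff[of "ev h"] h val_ev_infinity[OF h] by (auto simp: S_def mult_less_0_iff)
  have pos: "val P (ev h) > 0" if "P \<in> S" for P
    using discrete_place.val_pos_iff[OF discrete_place, of P "ev h"] that h by (auto simp: S_def)
  have keys: "P \<in> S" if "P \<in> Poly_Mapping.keys A" "P \<noteq> Q\<^sub>0" for P
  proof -
    have P: "P \<in> places emb" using that A by (auto simp: divisor_def)
    have "val P (ev h) > 0" using hv[of P] that by (simp add: in_keys_iff)
    then show ?thesis using discrete_place.val_pos_iff[OF discrete_place, of P "ev h"] P h by (auto simp: S_def)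
  qed
  have zero: "?A P = 0 \<and> val P (ev h) = 0" if "P \<in> places emb" "P \<notin> S" "P \<noteq> Q\<^sub>0" for P
  proof -
    interpret p: discrete_place emb P using discrete_place[OF that(1)] .
    have "ev h \<in> ring_at P - P" using that p.eval1_in_ring finite_place_iff[of P] by (auto simp: S_def)
    then show ?thesis using p.val_unit_iff[of "ev h"] h keys[of P] that by (auto simp: in_keys_iff)
  qed
  have le: "?A P \<le> val P (ev h)" if "P \<in> S" for P
  proof (cases "P \<in> Poly_Mapping.keys A")
    case True
    moreover have "P \<noteq> Q\<^sub>0" using that Q0S by blast
    ultimately show ?thesis using hv[of P] by simp
  next
    case False
    then show ?thesis using pos[OF that] by (simp add: in_keys_iff)
  qed
  \<comment> \<open>The zeros of \<open>ev h\<close> minus \<open>A\<close>, effective by the choice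
    of \<open>h\<close>. With this \<open>B\<close>, the divisor \<open>E\<close> plus that of
    \<open>ev h\<close> agrees with \<open>A\<close> on \<open>S\<close> and at infinity, so
    division by \<open>ev h\<close> maps the space of \<open>E\<close> into that of
    \<open>A\<close>.\<close>
  define B where "B = (\<Sum>P\<in>S. frag_cmul (val P (ev h) - ?A P) (frag_of P))"
  have B: "Poly_Mapping.lookup B P = (if P \<in> S then val P (ev h) - ?A P else 0)" for P
    using finS by (simp add: B_def lookup_sum if_distrib[of "(*) _"] sum.delta' cong: if_cong)
  have divB: "divisor emb B" using B by (auto simp: divisor_def in_keys_iff S_def split: if_splits)
  define N where "N = ?A Q\<^sub>0 + int (m * degree h)"
  define E where "E = frag_cmul N (frag_of Q\<^sub>0) - B"
  have "Poly_Mapping.keys E \<subseteq> insert Q\<^sub>0 S"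
    by (auto simp: E_def in_keys_iff lookup_minus B split: if_splits)
  then have divE: "divisor emb E" using infinite_place by (auto simp: divisor_def S_def)
  have EB: "E + B = frag_cmul N (frag_of Q\<^sub>0)" by (simp add: E_def)
  have "ell emb E \<le> ell emb A"
  proof (rule ell_mono_scale[OF A])
    show "ev h \<noteq> 0" using h by simp
    show "finite (RR_space emb E)" by (rule finite_RR_space[OF divE])
    fix P assume "P \<in> places emb"
    then show "Poly_Mapping.lookup E P + val P (ev h) \<le> ?A P"
      using zero[of P] Q0S val_ev_infinity[OF h] by (auto simp: E_def lookup_minus B N_def)
  qed
  moreover have "int (ell emb (E + B)) \<le> int (ell emb E) + div_degree emb B"
    by (rule ell_add_effective(2)) (use B le divB finite_RR_space[OF divE] in auto)
  moreover have "N + 1 - curve_genus \<le> int (ell emb (E + B))" unfolding EB by (rule ell_infinity_ge)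
  \<comment> \<open>It is enough that the zeros of \<open>ev h\<close> have total degree at most
    \<open>m deg h\<close>, the order of its pole at infinity.\<close>
  moreover have "div_degree emb B \<le> int (m * degree h) - (div_degree emb A - ?A Q\<^sub>0)"
  proof -
    have "div_degree emb B = (\<Sum>P\<in>S. (val P (ev h) - ?A P) * int (place_degree emb P))"
      using finS B by (subst div_degree_superset[of S]) (auto simp: in_keys_iff split: if_splits)
    also have "\<dots> = (\<Sum>P\<in>S. val P (ev h) * int (place_degree emb P)) - (\<Sum>P\<in>S. ?A P * int (place_degree emb P))"
      by (simp add: left_diff_distrib sum_subtractf)
    also have "div_degree emb A = (\<Sum>P\<in>insert Q\<^sub>0 S. ?A P * int (place_degree emb P))"
      using finS keys by (intro div_degree_superset) auto
    then have "(\<Sum>P\<in>S. ?A P * int (place_degree emb P)) = div_degree emb A - ?A Q\<^sub>0"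
      using finS Q0S val_infinity(3) by simp
    also have "(\<Sum>P\<in>S. val P (ev h) * int (place_degree emb P)) \<le> int (m * degree h)"
      using finS h by (intro sum_local_degrees_le[OF _ _ _ _ degree_bound_ev]) (auto simp: S_def)
    finally show ?thesis by simp
  qed
  ultimately show ?thesis unfolding N_def by linarith
qed

end

section \<open>Divisors supported on the totally ramified places\<close>

locale split_curve = curve_at_infinity emb x y m f Q\<^sub>0
  for emb :: "'k::{field,finite} \<Rightarrow> 'a::field" and x y m f Q\<^sub>0 +
  fixes Q :: "nat \<Rightarrow> 'a set" and root :: "nat \<Rightarrow> 'k"
  assumes Q_0: "Q 0 = Q\<^sub>0" and Q_places: "k \<in> {1..n} \<Longrightarrow> Q k \<in> places emb"
    and root: "k \<in> {1..n} \<Longrightarrow> poly f (root k) = 0"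
    and Q_root: "k \<in> {1..n} \<Longrightarrow> val (Q k) (ev [:- root k, 1:]) > 0"
    and inj_Q: "inj_on Q {1..n}" and inj_root: "inj_on root {1..n}"
begin

lemma Q_places': "k \<le> n \<Longrightarrow> Q k \<in> places emb"
  using Q_places[of k] Q_0 infinite_place by (cases "k = 0") auto

lemma Q_finite: "k \<in> {1..n} \<Longrightarrow> Q k \<noteq> Q\<^sub>0"
proof
  assume k: "k \<in> {1..n}" "Q k = Q\<^sub>0"
  then show False using Q_root[of k] val_ev_infinity[of "[:- root k, 1:]"] by simp
qed

lemma inj_Q': "inj_on Q {0..n}"
proof -
  have "Q 0 \<notin> Q ` {1..n}"
  proof
    assume "Q 0 \<in> Q ` {1..n}"
    then obtain k where "k \<in> {1..n}" "Q 0 = Q k" by blast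
    then show False using Q_finite Q_0 by metis
  qed
  then have "inj_on Q (insert 0 {1..n})" using inj_Q by simp
  moreover have "{0..n} = insert 0 {1..n}" by auto
  ultimately show ?thesis by metis
qed

lemmas Q_zero = zero[OF Q_places root Q_root]

lemma place_degree_Q: "k \<le> n \<Longrightarrow> place_degree emb (Q k) = 1"
  using Q_zero(3)[of k] val_infinity(3) Q_0 by (cases "k = 0") auto

lemma linear_nonzero: "ev [:- root k, 1:] \<noteq> 0"
  by (simp only: ev_eq_0_iff) simp

lemma val_linear_infinity: "val Q\<^sub>0 (ev [:- root k, 1:]) = - int m"
  using val_ev_infinity[of "[:- root k, 1:]"] by simp

lemma val_linear:
  assumes k: "k \<in> {1..n}" and P: "P \<in> places emb" "P \<noteq> Q\<^sub>0"
  shows "val P (ev [:- root k, 1:]) = (if P = Q k then int m else 0)"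
proof (cases "P = Q k")
  case True
  then show ?thesis using Q_zero(1)[OF k k k] by (simp del: eval1_pCons)
next
  case False
  interpret p: discrete_place emb P using discrete_place[OF P(1)] .
  have "x \<in> ring_at P" using P finite_place_iff by blast
  then have "0 \<le> val P (ev [:- root k, 1:])" using p.val_nonneg_iff[OF linear_nonzero] p.eval1_in_ring by blast
  moreover have "\<not> 0 < val P (ev [:- root k, 1:])" using Q_zero(4)[OF k k k P(1)] False by blast
  ultimately show ?thesis using False by simp
qed

lemma lookup_outside_Q:
  assumes "Poly_Mapping.keys D \<subseteq> Q ` {0..n}" "P \<noteq> Q\<^sub>0" "P \<notin> Q ` {1..n}"
  shows "Poly_Mapping.lookup D P = 0"
proof -
  have "{0..n} = insert 0 {1..n}" by auto
  then have "P \<notin> Poly_Mapping.keys D" using assms Q_0 by auto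
  then show ?thesis by (simp add: in_keys_iff)
qed

lemma div_degree_Q:
  assumes "Poly_Mapping.keys D \<subseteq> Q ` {0..n}"
  shows "div_degree emb D = (\<Sum>k=0..n. Poly_Mapping.lookup D (Q k))"
proof -
  have "div_degree emb D = (\<Sum>P\<in>Q ` {0..n}. Poly_Mapping.lookup D P * int (place_degree emb P))"
    using assms by (intro div_degree_superset) auto
  also have "\<dots> = (\<Sum>k=0..n. Poly_Mapping.lookup D (Q k) * int (place_degree emb (Q k)))"
    by (rule sum.reindex_cong[OF inj_Q' refl]) simp
  finally show ?thesis by (simp add: place_degree_Q)
qed

text \<open>\<open>L(D)\<close> contains \<open>w(x) y^j\<close> for some nonzero rational function \<open>w\<close> if and only if the following
  number is nonnegative: it is the degree of the divisor on the projective line that bounds \<open>w\<close>.\<close>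
definition slope :: "('a set \<Rightarrow>\<^sub>0 int) \<Rightarrow> nat \<Rightarrow> int" where
  "slope D j = (Poly_Mapping.lookup D (Q 0) - int n * int j) div int m
     + (\<Sum>k=1..n. (Poly_Mapping.lookup D (Q k) + int j) div int m)"

lemma nonneg_slope_imp_nonzero:
  assumes keys: "Poly_Mapping.keys D \<subseteq> Q ` {0..n}" and j: "j < m" "0 \<le> slope D j"
  obtains z where "z \<noteq> 0" "z \<in> RR_space emb D"
proof -
  let ?d = "\<lambda>k. Poly_Mapping.lookup D (Q k)"
  define s where "s k = (?d k + int j) div int m" for k
  \<comment> \<open>The exponent \<open>s k\<close> is the largest for which \<open>D\<close>
    permits the resulting order \<open>j - m s k\<close> at \<open>Q k\<close>. The nonnegative
    slope then controls the pole at infinity.\<close>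
  define z where "z = y ^ j * (\<Prod>k\<in>{1..n}. ev [:- root k, 1:] powi (- s k))"
  have nz: "ev [:- root k, 1:] powi (- s k) \<noteq> 0" for k using linear_nonzero by (simp del: eval1_pCons)
  then have prod0: "(\<Prod>k\<in>{1..n}. ev [:- root k, 1:] powi (- s k)) \<noteq> 0" by (simp del: eval1_pCons)
  have z0: "z \<noteq> 0" using prod0 by (simp add: z_def del: eval1_pCons)
  have vz: "val P z = int j * val P y + (\<Sum>k\<in>{1..n}. - s k * val P (ev [:- root k, 1:]))" if P: "P \<in> places emb" for P
  proof -
    interpret p: discrete_place emb P using discrete_place[OF P] .
    have "val P (\<Prod>k\<in>{1..n}. ev [:- root k, 1:] powi (- s k)) = (\<Sum>k\<in>{1..n}. - s k * val P (ev [:- root k, 1:]))"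
      using nz linear_nonzero by (subst p.val_prod) (auto simp: p.val_power_int simp del: eval1_pCons)
    then show ?thesis using prod0 by (simp add: z_def p.val_mult p.val_power del: eval1_pCons)
  qed
  have "- Poly_Mapping.lookup D P \<le> val P z" if P: "P \<in> places emb" for P
  proof (cases "P = Q\<^sub>0")
    case True
    have "int m * (- (\<Sum>k=1..n. s k)) \<le> int m * ((?d 0 - int n * int j) div int m)"
      using j(2) by (intro mult_left_mono) (auto simp: slope_def s_def)
    also have "\<dots> \<le> ?d 0 - int n * int j" using m by (intro mult_div_le) simp
    finally have "- ?d 0 \<le> - int n * int j + int m * (\<Sum>k=1..n. s k)" by simp
    moreover have "val Q\<^sub>0 z = - int n * int j + int m * (\<Sum>k=1..n. s k)"
      unfolding vz[OF infinite_place] val_linear_infinity val_infinity by (simp add: sum_distrib_left mult.commute)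
    ultimately show ?thesis by (simp add: True Q_0)
  next
    case False
    interpret p: discrete_place emb P using discrete_place[OF P] .
    have "y \<in> ring_at P"
      using coord_in_ring[OF P _ coord_y_mult[OF coord_1]] finite_place_iff[OF P] False by simp
    then have vy: "0 \<le> val P y" by (simp add: p.val_nonneg_iff)
    show ?thesis
    proof (cases "P \<in> Q ` {1..n}")
      case True
      then obtain l where l: "l \<in> {1..n}" "P = Q l" by blast
      have vk: "val P (ev [:- root k, 1:]) = (if k = l then int m else 0)" if "k \<in> {1..n}" for k
        using val_linear[OF that P False] inj_on_eq_iff[OF inj_Q l(1) that] l(2) by (simp del: eval1_pCons)
      have "(\<Sum>k\<in>{1..n}. - s k * val P (ev [:- root k, 1:])) = (\<Sum>k\<in>{1..n}. if k = l then - s l * int m else 0)"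
        by (intro sum.cong refl) (simp add: vk del: eval1_pCons)
      also have "\<dots> = - s l * int m" using l by simp
      finally have "val P z = int j - int m * s l" using vz[OF P] Q_zero(2)[OF l(1) l(1) l(1)] l(2) by simp
      moreover have "int m * s l \<le> ?d l + int j" unfolding s_def using m by (intro mult_div_le) simp
      ultimately show ?thesis using l(2) by simp
    next
      case notin: False
      have "Poly_Mapping.lookup D P = 0" using lookup_outside_Q[OF keys] False notin by blast
      moreover have "(\<Sum>k\<in>{1..n}. - s k * val P (ev [:- root k, 1:])) = 0"
        using notin by (intro sum.neutral) (auto simp: val_linear[OF _ P False] simp del: eval1_pCons)
      ultimately show ?thesis using vz[OF P] vy by simp
    qed
  qed
  then show ?thesis using that[of z] z0 by (auto simp: RR_space_def)
qed

text \<open>Once \<open>H\<close> has cleared the poles, every nonzero coordinate \<open>a j\<close>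
  serves: adding the bounds that \<open>D\<close> imposes at all places shows that
  \<open>slope D j\<close> is at least the degree of \<open>a j\<close> minus its orders at the
  roots of \<open>f\<close>, which is not negative.\<close>

lemma nonzero_imp_nonneg_slope:
  assumes keys: "Poly_Mapping.keys D \<subseteq> Q ` {0..n}" and z: "z \<noteq> 0" "z \<in> RR_space emb D"
  obtains j where "j < m" "0 \<le> slope D j"
proof -
  let ?d = "\<lambda>k. Poly_Mapping.lookup D (Q k)"
  \<comment> \<open>Since \<open>(x - root k)^N\<close> vanishes at \<open>Q k\<close> to the order
    \<open>N m\<close>, this \<open>N\<close> clears all finite poles that \<open>D\<close>
    allows.\<close>
  define N where "N = (\<Sum>k\<in>{1..n}. nat \<bar>?d k\<bar>)"
  have N: "?d k \<le> int N" if "k \<in> {1..n}" for k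
  proof -
    have "nat \<bar>?d k\<bar> \<le> N" unfolding N_def using that by (intro member_le_sum) auto
    then show ?thesis by linarith
  qed
  define H where "H = (\<Prod>k\<in>{1..n}. [:- root k, 1:] ^ N)"
  have H0: "H \<noteq> 0" by (simp add: H_def)
  have "degree H = (\<Sum>k\<in>{1..n}. degree ([:- root k, 1:] ^ N))" unfolding H_def by (rule degree_prod_eq_sum_degree) simp
  then have degH: "degree H = n * N" by (simp add: degree_linear_power)
  have vH: "val P (ev H) = (\<Sum>k\<in>{1..n}. int N * val P (ev [:- root k, 1:]))" if P: "P \<in> places emb" for P
  proof -
    interpret p: discrete_place emb P using discrete_place[OF P] .
    show ?thesis unfolding H_def eval1_prod eval1_power using linear_nonzero
      by (subst p.val_prod) (auto simp: p.val_power simp del: eval1_pCons)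
  qed
  have vHQ: "val (Q l) (ev H) = int N * int m" if l: "l \<in> {1..n}" for l
  proof -
    have "(\<Sum>k\<in>{1..n}. int N * val (Q l) (ev [:- root k, 1:])) = (\<Sum>k\<in>{1..n}. if k = l then int N * int m else 0)"
      using l inj_Q by (intro sum.cong refl)
        (auto simp: val_linear[OF _ Q_places Q_finite] inj_on_eq_iff simp del: eval1_pCons)
    then show ?thesis using l vH[OF Q_places[OF l]] by simp
  qed
  have vz: "- Poly_Mapping.lookup D P \<le> val P z" if "P \<in> places emb" for P using z that by (auto simp: RR_space_def)
  have "ev H * z \<in> coordinate_ring"
  proof (rule regular_in_coord)
    fix P assume P: "P \<in> places emb" "P \<noteq> Q\<^sub>0"
    interpret p: discrete_place emb P using discrete_place[OF P(1)] .
    have "0 \<le> val P (ev H) + val P z"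
    proof (cases "P \<in> Q ` {1..n}")
      case True
      then obtain l where l: "l \<in> {1..n}" "P = Q l" by blast
      have "int N * 1 \<le> int N * int m" using m by (intro mult_left_mono) auto
      then show ?thesis using vHQ[OF l(1)] N[OF l(1)] vz[OF P(1)] l(2) by simp
    next
      case False
      then have "Poly_Mapping.lookup D P = 0" using lookup_outside_Q[OF keys P(2)] by blast
      moreover have "0 \<le> val P (ev H)" using p.val_nonneg_iff[of "ev H"] p.eval1_in_ring finite_place_iff[OF P(1)] P(2) H0 by simp
      ultimately show ?thesis using vz[OF P(1)] by simp
    qed
    then show "ev H * z \<in> ring_at P" using p.val_nonneg_iff[of "ev H * z"] H0 z(1) by (simp add: p.val_mult)
  qed
  then obtain a where a: "ev H * z = comb a" by blast
  have "comb a \<noteq> 0" using a H0 z(1) by (metis ev_eq_0_iff mult_eq_0_iff)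
  then obtain j where j: "j < m" "a j \<noteq> 0" by (auto simp: comb_eq_0_iff)
  have "int N - int (order (root k) (a j)) \<le> (?d k + int j) div int m" if k: "k \<in> {1..n}" for k
  proof -
    interpret p: discrete_place emb "Q k" using discrete_place[OF Q_places[OF k]] .
    have "vge (Q k) (int N * int m - ?d k) (comb a)"
      using vHQ[OF k] vz[OF Q_places[OF k]] z(1) H0 by (simp add: vge_def p.val_mult flip: a)
    then have "int N * int m - ?d k \<le> int (m * order (root k) (a j) + j)"
      using vge_comb_zero[OF Q_places root Q_root, OF k k k] j by blast
    then show ?thesis using m by (subst le_div_iff) (auto simp: algebra_simps)
  qed
  then have "(\<Sum>k=1..n. int N - int (order (root k) (a j))) \<le> (\<Sum>k=1..n. (?d k + int j) div int m)"
    by (intro sum_mono) auto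
  then have 1: "int n * int N - int (\<Sum>k=1..n. order (root k) (a j)) \<le> (\<Sum>k=1..n. (?d k + int j) div int m)"
    by (simp add: sum_subtractf)
  have "(\<Sum>k=1..n. order (root k) (a j)) = (\<Sum>r\<in>root ` {1..n}. order r (a j))"
    by (rule sum.reindex_cong[OF inj_root refl, symmetric]) simp
  also have "\<dots> = (\<Sum>r\<in>{r \<in> root ` {1..n}. poly (a j) r = 0}. order r (a j))"
    using j by (intro sum.mono_neutral_right) (auto simp: order_eq_0_iff)
  also have "\<dots> \<le> (\<Sum>r | poly (a j) r = 0. order r (a j))"
    using j poly_roots_finite[of "a j"] by (intro sum_mono2) auto
  also have "\<dots> \<le> degree (a j)" using j by (intro sum_order_le_degree)
  finally have 2: "int (\<Sum>k=1..n. order (root k) (a j)) \<le> int (degree (a j))" by (simp only: of_nat_le_iff)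
  have "vge Q\<^sub>0 (- int (m * (n * N)) - ?d 0) (comb a)"
    using val_ev_infinity[OF H0] degH vz[OF infinite_place] z(1) H0 Q_0 by (simp add: vge_def Q\<^sub>0.val_mult flip: a)
  then have "- int (m * (n * N)) - ?d 0 \<le> - int (m * degree (a j) + n * j)" using vge_comb_infinity j by blast
  then have "int (degree (a j)) - int n * int N \<le> (?d 0 - int n * int j) div int m"
    using m by (subst le_div_iff) (auto simp: algebra_simps)
  then have "0 \<le> slope D j" using 1 2 unfolding slope_def by linarith
  then show ?thesis using that j by blast
qed

lemma RR_space_trivial_iff:
  assumes "Poly_Mapping.keys D \<subseteq> Q ` {0..n}"
  shows "RR_space emb D = {0} \<longleftrightarrow> (\<forall>j<m. slope D j < 0)"
proof -
  have 0: "0 \<in> RR_space emb D" by (simp add: RR_space_def)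
  show ?thesis
  proof (intro iffI allI impI)
    fix j assume *: "RR_space emb D = {0}" "j < m"
    show "slope D j < 0"
    proof (rule ccontr)
      assume "\<not> slope D j < 0"
      then have "0 \<le> slope D j" by simp
      then obtain z where "z \<noteq> 0" "z \<in> RR_space emb D" by (rule nonneg_slope_imp_nonzero[OF assms *(2)])
      then show False using *(1) by simp
    qed
  next
    assume *: "\<forall>j<m. slope D j < 0"
    have "z = 0" if z: "z \<in> RR_space emb D" for z
    proof (rule ccontr)
      assume "z \<noteq> 0"
      then obtain j where "j < m" "0 \<le> slope D j" by (rule nonzero_imp_nonneg_slope[OF assms _ z])
      then show False using * by fastforce
    qed
    then show "RR_space emb D = {0}" using 0 by blast
  qed
qed

lemma sum_slopes:
  assumes "Poly_Mapping.keys D \<subseteq> Q ` {0..n}"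
  shows "2 * (\<Sum>j<m. slope D j) = 2 * div_degree emb D - (int n + 1) * (int m - 1)"
proof -
  let ?d = "\<lambda>k. Poly_Mapping.lookup D (Q k)"
  have "(\<Sum>j<m. (?d k + int j) div int m) = ?d k" for k
    using sum_div_arith_progression[of m 1 "?d k"] m by simp
  then have "(\<Sum>j<m. \<Sum>k=1..n. (?d k + int j) div int m) = (\<Sum>k=1..n. ?d k)"
    by (subst sum.swap) simp
  moreover have "{0..n} = insert 0 {1..n}" by auto
  then have "div_degree emb D = ?d 0 + (\<Sum>k=1..n. ?d k)" unfolding div_degree_Q[OF assms] by simp
  ultimately show ?thesis using sum_slopes_infinity[of "?d 0"] by (simp add: slope_def sum.distrib)
qed

text \<open>By \<open>sum_slopes\<close>, the degree is \<open>curve_genus - 1\<close> exactly if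
  the slopes have sum \<open>-m\<close>, and \<open>m\<close> negative integers with that sum are
  all \<open>-1\<close>.\<close>

lemma trivial_of_degree_iff:
  assumes D: "Poly_Mapping.keys D \<subseteq> Q ` {0..n}"
  shows "ell emb D = 0 \<and> div_degree emb D = curve_genus - 1 \<longleftrightarrow> (\<forall>j<m. slope D j = -1)"
proof -
  have "divisor emb D" using D Q_places' by (auto simp: divisor_def)
  then have ell: "ell emb D = 0 \<longleftrightarrow> (\<forall>j<m. slope D j < 0)"
    using ell_eq_0_iff finite_RR_space RR_space_trivial_iff[OF D] by simp
  have deg: "div_degree emb D = curve_genus - 1 \<longleftrightarrow> (\<Sum>j<m. slope D j) = - int m"
  proof -
    define S where "S = (\<Sum>j<m. slope D j)"
    have "2 * S + 2 * int m = 2 * (div_degree emb D - (curve_genus - 1))"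
      using sum_slopes[OF D, folded S_def] curve_genus by (simp add: algebra_simps)
    then have "2 * (S + int m) = 2 * (div_degree emb D - (curve_genus - 1))" by (simp only: distrib_left)
    then have "S + int m = div_degree emb D - (curve_genus - 1)" by (simp only: mult_cancel_left) simp
    then show ?thesis unfolding S_def[symmetric] by auto
  qed
  show ?thesis
  proof
    assume "ell emb D = 0 \<and> div_degree emb D = curve_genus - 1"
    then have neg: "\<forall>j<m. slope D j < 0" and "(\<Sum>j<m. slope D j) = - int m" using ell deg by auto
    then have "(\<Sum>j<m. - 1 - slope D j) = 0" by (simp add: sum_subtractf)
    then have "\<forall>j\<in>{..<m}. - 1 - slope D j = 0" using neg by (subst (asm) sum_nonneg_eq_0_iff) auto
    then show "\<forall>j<m. slope D j = -1" by fastforce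
  next
    assume "\<forall>j<m. slope D j = -1"
    then show "ell emb D = 0 \<and> div_degree emb D = curve_genus - 1" using ell deg by simp
  qed
qed

end

section \<open>The multiplicity tuple\<close>

definition count_below :: "nat \<Rightarrow> (nat \<Rightarrow> int) \<Rightarrow> int \<Rightarrow> nat" where
  "count_below n r i = card {k \<in> {1..n}. r k < i}"

text \<open>The closed form of the non-decreasing tuple, found by inverting the counting function
  that maps \<open>i\<close> to \<open>(a + n i) div m\<close>; compare
  \<open>tuple_entry_less_iff\<close>. It is the ceiling of \<open>(k m - a) / n\<close>, minus
  1.\<close>

definition tuple_entry :: "nat \<Rightarrow> nat \<Rightarrow> int \<Rightarrow> nat \<Rightarrow> int" where
  "tuple_entry m n a k = (int k * int m - a - 1) div int n"

lemma tuple_entry_less_iff: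
  assumes "m > 0" "n > 0"
  shows "tuple_entry m n a k < i \<longleftrightarrow> int k \<le> (a + int n * i) div int m"
  using assms by (simp add: tuple_entry_def div_less_iff le_div_iff algebra_simps) linarith

lemma tuple_entry_conv_ceiling:
  assumes "n > 0"
  shows "tuple_entry m n a k = \<lceil>(of_nat k * of_nat m - of_int a) / of_nat n :: real\<rceil> - 1"
proof -
  have "\<lceil>(of_nat k * of_nat m - of_int a) / of_nat n :: real\<rceil> = \<lceil>real_of_int (int k * int m - a) / real_of_int (int n)\<rceil>"
    by simp
  also have "\<dots> = - ((- (int k * int m - a)) div int n)" by (simp only: ceiling_divide_eq_div)
  also have "\<dots> = (int k * int m - a - 1) div int n + 1"
  proof -
    define b where "b = int k * int m - a"
    have "(b - 1) div int n + 1 \<le> - (- b div int n)"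
    proof -
      have "- b div int n < - ((b - 1) div int n)"
        using assms mult_div_le[of "int n" "b - 1"] by (simp add: div_less_iff algebra_simps)
      then show ?thesis by simp
    qed
    moreover have "- (- b div int n) \<le> (b - 1) div int n + 1"
    proof -
      have "- ((b - 1) div int n) - 1 \<le> - b div int n"
        using lt_mult_div[of "int n" "b - 1"] assms by (subst le_div_iff) (auto simp: algebra_simps)
      then show ?thesis by simp
    qed
    ultimately show ?thesis by (simp add: b_def)
  qed
  finally show ?thesis by (simp add: tuple_entry_def)
qed

context
  fixes m n :: nat and a :: int
  assumes m: "m > 0" and n: "n > 0" and a: "0 \<le> a" "a < int m"
begin

lemma mn_div: "(a + int n * int m) div int m = int n"
  using m a by simp

lemma div_range:
  assumes "0 \<le> i" "i \<le> int m"
  shows "0 \<le> (a + int n * i) div int m" "(a + int n * i) div int m \<le> int n"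
proof -
  show "0 \<le> (a + int n * i) div int m" using assms a m by (simp add: pos_imp_zdiv_nonneg_iff)
  have "int n * i \<le> int n * int m" using assms by (intro mult_left_mono) auto
  then have "(a + int n * i) div int m \<le> (a + int n * int m) div int m" using m by (intro zdiv_mono1) auto
  then show "(a + int n * i) div int m \<le> int n" by (simp only: mn_div)
qed

lemma tuple_entry_range:
  assumes k: "k \<in> {1..n}"
  shows "0 \<le> tuple_entry m n a k" "tuple_entry m n a k < int m"
proof -
  have "\<not> tuple_entry m n a k < 0" using a k by (simp add: tuple_entry_less_iff m n)
  then show "0 \<le> tuple_entry m n a k" by simp
  have "int k \<le> (a + int n * int m) div int m" using k by (simp only: mn_div) simp
  then show "tuple_entry m n a k < int m" by (simp only: tuple_entry_less_iff m n)
qed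

lemma tuple_entry_mono: "k \<le> l \<Longrightarrow> tuple_entry m n a k \<le> tuple_entry m n a l"
  using n mult_right_mono[of "int k" "int l" "int m"] unfolding tuple_entry_def by (intro zdiv_mono1) auto

lemma count_below_tuple_entry:
  assumes i: "0 \<le> i" "i \<le> int m"
  shows "int (count_below n (tuple_entry m n a) i) = (a + int n * i) div int m"
proof -
  have "{k \<in> {1..n}. tuple_entry m n a k < i} = {1..nat ((a + int n * i) div int m)}"
    using div_range[OF i] by (auto simp: tuple_entry_less_iff m n)
  then show ?thesis using div_range[OF i] by (simp add: count_below_def)
qed

lemma occurrences_eq: "occurrences n r i = int (count_below n r (i + 1)) - int (count_below n r i)"
proof -
  have "{k \<in> {1..n}. r k < i + 1} = {k \<in> {1..n}. r k < i} \<union> {k \<in> {1..n}. r k = i}" by auto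
  then have "card {k \<in> {1..n}. r k < i + 1} = card {k \<in> {1..n}. r k < i} + card {k \<in> {1..n}. r k = i}"
    by (simp only:) (intro card_Un_disjoint; auto)
  then show ?thesis by (simp add: occurrences_def count_below_def)
qed

lemma count_below_0: "(\<And>k. k \<in> {1..n} \<Longrightarrow> 0 \<le> r k) \<Longrightarrow> count_below n r 0 = 0"
  unfolding count_below_def by (subst card_eq_0_iff) (auto simp: not_less[symmetric])

lemma count_below_m: "(\<And>k. k \<in> {1..n} \<Longrightarrow> r k < int m) \<Longrightarrow> count_below n r (int m) = n"
proof -
  assume "\<And>k. k \<in> {1..n} \<Longrightarrow> r k < int m"
  then have "{k \<in> {1..n}. r k < int m} = {1..n}" by auto
  then show ?thesis by (simp add: count_below_def)
qed

text \<open>Differences of the counts are the multiplicities of the values, and families over a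
  finite set with equal multiplicities differ by a permutation.\<close>

lemma permuted_tuple_iff:
  assumes r: "\<And>k. k \<in> {1..n} \<Longrightarrow> 0 \<le> r k \<and> r k < int m"
  shows "(\<forall>i\<in>{1..int m}. int (count_below n r i) = (a + int n * i) div int m)
    \<longleftrightarrow> (\<exists>\<sigma>. \<sigma> permutes {1..n} \<and> (\<forall>k\<in>{1..n}. r k = tuple_entry m n a (\<sigma> k)))" (is "?L \<longleftrightarrow> ?R")
proof
  assume ?R
  then obtain \<sigma> where \<sigma>: "\<sigma> permutes {1..n}" "\<forall>k\<in>{1..n}. r k = tuple_entry m n a (\<sigma> k)" by blast
  have "count_below n r i = count_below n (tuple_entry m n a) i" for i
  proof -
    have "\<sigma> ` {k \<in> {1..n}. r k < i} = {k \<in> {1..n}. tuple_entry m n a k < i}"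
    proof (intro equalityI subsetI)
      fix k assume k: "k \<in> {k \<in> {1..n}. tuple_entry m n a k < i}"
      then have "k \<in> \<sigma> ` {1..n}" using permutes_image[OF \<sigma>(1)] by simp
      then obtain l where "l \<in> {1..n}" "k = \<sigma> l" by blast
      then show "k \<in> \<sigma> ` {k \<in> {1..n}. r k < i}" using k \<sigma>(2) by (intro image_eqI[of _ _ l]) auto
    next
      fix k assume "k \<in> \<sigma> ` {k \<in> {1..n}. r k < i}"
      then obtain l where "l \<in> {1..n}" "r l < i" "k = \<sigma> l" by blast
      then show "k \<in> {k \<in> {1..n}. tuple_entry m n a k < i}" using \<sigma>(2) permutes_in_image[OF \<sigma>(1), of l] by simp
    qed
    moreover have "card (\<sigma> ` {k \<in> {1..n}. r k < i}) = card {k \<in> {1..n}. r k < i}"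
      by (rule card_image) (rule inj_on_subset[OF permutes_inj[OF \<sigma>(1)] subset_UNIV])
    ultimately show ?thesis unfolding count_below_def by (simp only:)
  qed
  then show ?L using count_below_tuple_entry by simp
next
  assume L: ?L
  have cb: "int (count_below n r i) = int (count_below n (tuple_entry m n a) i)" if "0 \<le> i" "i \<le> int m" for i
  proof (cases "i = 0")
    case True
    then show ?thesis using count_below_0[of r] count_below_0[of "tuple_entry m n a"] r tuple_entry_range by simp
  next
    case False
    then show ?thesis using L that count_below_tuple_entry[of i] by simp
  qed
  have count: "card {k \<in> {1..n}. r k = i} = card {k \<in> {1..n}. tuple_entry m n a k = i}" for i
  proof (cases "0 \<le> i \<and> i < int m")
    case True
    then have "occurrences n r i = occurrences n (tuple_entry m n a) i" using cb[of i] cb[of "i + 1"] by (simp add: occurrences_eq)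
    then show ?thesis by (simp add: occurrences_def)
  next
    case False
    then have "{k \<in> {1..n}. r k = i} = {}" "{k \<in> {1..n}. tuple_entry m n a k = i} = {}"
      using r tuple_entry_range by fastforce+
    then show ?thesis by (simp only:)
  qed
  have "image_mset r (mset_set {1..n}) = image_mset (tuple_entry m n a) (mset_set {1..n})"
  proof (rule multiset_eqI)
    fix i
    have "count (image_mset h (mset_set {1..n})) i = card {k \<in> {1..n}. h k = i}" for h :: "nat \<Rightarrow> int"
      by (simp add: count_image_mset vimage_def Int_def conj_commute)
    then show "count (image_mset r (mset_set {1..n})) i = count (image_mset (tuple_entry m n a) (mset_set {1..n})) i"
      using count by simp
  qed
  then obtain p where "p permutes {1..n}" "\<forall>k\<in>{1..n}. r k = tuple_entry m n a (p k)"
    using image_mset_eq_implies_permutes[of "{1..n}" r "tuple_entry m n a"] by auto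
  then show ?R by blast
qed

text \<open>The last identity passes to the complement: the entries equal to \<open>m - 1\<close>
  are all \<open>n = (n m) / m\<close> entries without those below \<open>m - 1\<close>.\<close>

lemma floor_conv_div: "\<lfloor>(of_int a + (of_int i + 1) * of_nat n) / of_nat m :: real\<rfloor> = (a + int n * (i + 1)) div int m"
  "\<lfloor>(of_int a + of_int i * of_nat n) / of_nat m :: real\<rfloor> = (a + int n * i) div int m"
  "\<lfloor>(of_int a + of_nat n) / of_nat m :: real\<rfloor> = (a + int n) div int m"
  "\<lceil>(of_nat n - of_int a) / of_nat m :: real\<rceil> = int n - (a + int n * (int m - 1)) div int m"
proof -
  have fl: "\<lfloor>real_of_int b / real m\<rfloor> = b div int m" for b
    using floor_divide_of_int_eq[of b "int m"] by simp
  have eqs: "real_of_int a + (real_of_int i + 1) * real n = real_of_int (a + int n * (i + 1))"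
    "real_of_int a + real_of_int i * real n = real_of_int (a + int n * i)"
    "real_of_int a + real n = real_of_int (a + int n)" by (simp_all add: algebra_simps)
  show "\<lfloor>(of_int a + (of_int i + 1) * of_nat n) / of_nat m :: real\<rfloor> = (a + int n * (i + 1)) div int m"
    "\<lfloor>(of_int a + of_int i * of_nat n) / of_nat m :: real\<rfloor> = (a + int n * i) div int m"
    "\<lfloor>(of_int a + of_nat n) / of_nat m :: real\<rfloor> = (a + int n) div int m"
    unfolding eqs fl by (rule refl)+
  have "real n - real_of_int a = real_of_int (int n - a)" by simp
  then have "\<lceil>(of_nat n - of_int a) / of_nat m :: real\<rceil> = \<lceil>real_of_int (int n - a) / real_of_int (int m)\<rceil>" by simp
  also have "\<dots> = - ((- (int n - a)) div int m)" by (simp only: ceiling_divide_eq_div)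
  also have "\<dots> = int n - (a + int n * (int m - 1)) div int m"
  proof -
    have "a + int n * (int m - 1) = - (int n - a) + int n * int m" by (simp add: algebra_simps)
    then have "(a + int n * (int m - 1)) div int m = int n + (- (int n - a)) div int m"
      using div_mult_self1[of "int m" "- (int n - a)" "int n"] m by (metis of_nat_0_eq_iff less_irrefl)
    then show ?thesis by simp
  qed
  finally show "\<lceil>(of_nat n - of_int a) / of_nat m :: real\<rceil> = int n - (a + int n * (int m - 1)) div int m" .
qed

text \<open>For a non-decreasing tuple, the positions of the entries below \<open>i\<close> form
  such a set, so comparing an entry with \<open>i\<close> becomes comparing its position with a
  count.\<close>

lemma initial_segment:
  assumes S: "S \<subseteq> {1..n}" and down: "\<And>k l. k \<in> S \<Longrightarrow> l \<in> {1..n} \<Longrightarrow> l \<le> k \<Longrightarrow> l \<in> S" and k: "k \<in> {1..n}"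
  shows "k \<in> S \<longleftrightarrow> k \<le> card S"
proof -
  have fin: "finite S" using S finite_subset by blast
  show ?thesis
  proof (cases "k \<in> S")
    case True
    then have "{1..k} \<subseteq> S" using down[OF True] k by auto
    from card_mono[OF fin this] True show ?thesis by simp
  next
    case False
    have "l < k" if "l \<in> S" for l
    proof (rule ccontr)
      assume "\<not> l < k"
      then have "k \<in> S" using down[OF that k] by simp
      with False show False by blast
    qed
    then have "S \<subseteq> {1..<k}" using S by auto
    then have "card S \<le> k - 1" using card_mono[of "{1..<k}" S] by simp
    then show ?thesis using False k by auto
  qed
qed

text \<open>The prescribed multiplicities telescope to the counts \<open>(a + n i) div m\<close>,
  and a non-decreasing tuple is determined by its counts.\<close>

lemma multiplicity_tuple_iff:
  assumes m2: "m \<ge> 2"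
  shows "multiplicity_tuple m n a \<alpha> \<longleftrightarrow> (\<forall>k\<in>{1..n}. \<alpha> k = tuple_entry m n a k)"
proof
  assume *: "\<forall>k\<in>{1..n}. \<alpha> k = tuple_entry m n a k"
  have range: "\<alpha> k \<in> {0..int m - 1}" if "k \<in> {1..n}" for k using that * tuple_entry_range[of k] by auto
  have "{k \<in> {1..n}. \<alpha> k < i} = {k \<in> {1..n}. tuple_entry m n a k < i}" for i using * by auto
  then have "int (count_below n \<alpha> i) = (a + int n * i) div int m" if "0 \<le> i" "i \<le> int m" for i
    using count_below_tuple_entry[OF that] by (simp only: count_below_def)
  then have cb: "occurrences n \<alpha> i = (a + int n * (i + 1)) div int m - (a + int n * i) div int m" if "0 \<le> i" "i < int m" for i
    using that by (simp add: occurrences_eq)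
  have "mono_on {1..n} \<alpha>" using * tuple_entry_mono by (auto intro!: mono_onI)
  moreover have "occurrences n \<alpha> 0 = (a + int n) div int m" using cb[of 0] m2 a by simp
  moreover have "occurrences n \<alpha> (int m - 1) = int n - (a + int n * (int m - 1)) div int m"
    using cb[of "int m - 1"] m2 mn_div by simp
  ultimately show "multiplicity_tuple m n a \<alpha>"
    unfolding multiplicity_tuple_def floor_conv_div using range cb by auto
next
  assume *: "multiplicity_tuple m n a \<alpha>"
  then have range: "0 \<le> \<alpha> k \<and> \<alpha> k < int m" if "k \<in> {1..n}" for k using that by (auto simp: multiplicity_tuple_def)
  have mono: "mono_on {1..n} \<alpha>" using * by (simp add: multiplicity_tuple_def)
  have occ0: "occurrences n \<alpha> 0 = (a + int n) div int m"
    and occ: "\<And>i. 1 \<le> i \<Longrightarrow> i \<le> int m - 2 \<Longrightarrow> occurrences n \<alpha> i = (a + int n * (i + 1)) div int m - (a + int n * i) div int m"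
    using * unfolding multiplicity_tuple_def floor_conv_div by auto
  have 0: "count_below n \<alpha> 0 = 0" using range by (intro count_below_0) auto
  have cb': "int (count_below n \<alpha> (int (Suc i))) = (a + int n * int (Suc i)) div int m" if "Suc i < m" for i
    using that
  proof (induction i)
    case 0
    then show ?case using occ0 \<open>count_below n \<alpha> 0 = 0\<close> by (simp add: occurrences_eq)
  next
    case (Suc i)
    then show ?case using occ[of "int (Suc i)"] by (simp add: occurrences_eq add.commute)
  qed
  have cb: "int (count_below n \<alpha> i) = (a + int n * i) div int m" if "1 \<le> i" "i \<le> int m" for i
  proof (cases "i = int m")
    case True
    then show ?thesis using count_below_m[of \<alpha>] range mn_div by simp
  next
    case False
    then show ?thesis using cb'[of "nat i - 1"] that by (simp add: Suc_nat_eq_nat_zadd1 nat_less_iff of_nat_diff)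
  qed
  show "\<forall>k\<in>{1..n}. \<alpha> k = tuple_entry m n a k"
  proof
    fix k assume k: "k \<in> {1..n}"
    have less: "\<alpha> k < i \<longleftrightarrow> tuple_entry m n a k < i" if "1 \<le> i" "i \<le> int m" for i
    proof -
      have "k \<in> {l \<in> {1..n}. \<alpha> l < i} \<longleftrightarrow> k \<le> card {l \<in> {1..n}. \<alpha> l < i}"
      proof (rule initial_segment[OF _ _ k])
        fix l l' assume "l \<in> {l \<in> {1..n}. \<alpha> l < i}" "l' \<in> {1..n}" "l' \<le> l"
        moreover from this have "\<alpha> l' \<le> \<alpha> l" using mono_onD[OF mono, of l' l] by simp
        ultimately show "l' \<in> {l \<in> {1..n}. \<alpha> l < i}" by simp
      qed auto
      then have "\<alpha> k < i \<longleftrightarrow> int k \<le> int (count_below n \<alpha> i)" using k by (simp add: count_below_def)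
      then show ?thesis using cb[OF that] by (simp add: tuple_entry_less_iff m n)
    qed
    \<comment> \<open>The thresholds just above the two values both lie between 1 and
      \<open>m\<close>, and each of them excludes one strict inequality.\<close>
    show "\<alpha> k = tuple_entry m n a k"
      using less[of "\<alpha> k + 1"] less[of "tuple_entry m n a k + 1"] range[OF k] tuple_entry_range[OF k] by linarith
  qed
qed

end

section \<open>Non-special divisors of degree one less than the genus\<close>

context split_curve
begin

lemma lookup_sum_Q:
  "l \<le> n \<Longrightarrow> Poly_Mapping.lookup (\<Sum>k=0..n. frag_cmul (c k) (frag_of (Q k))) (Q l) = c l"
proof -
  assume l: "l \<le> n"
  have "Poly_Mapping.lookup (\<Sum>k=0..n. frag_cmul (c k) (frag_of (Q k))) (Q l) = (\<Sum>k=0..n. if k = l then c l else 0)"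
    unfolding lookup_sum using l inj_Q' by (intro sum.cong refl) (auto simp: inj_on_eq_iff)
  then show ?thesis using l by simp
qed

lemma keys_sum_Q: "Poly_Mapping.keys (\<Sum>k=0..n. frag_cmul (c k) (frag_of (Q k))) \<subseteq> Q ` {0..n}"
  by (rule order_trans[OF keys_sum]) (auto simp: keys_cmul_iff split: if_splits)

lemma eq_sum_Q_iff:
  assumes D: "Poly_Mapping.keys D \<subseteq> Q ` {0..n}"
  shows "D = (\<Sum>k=0..n. frag_cmul (c k) (frag_of (Q k))) \<longleftrightarrow> (\<forall>k\<le>n. Poly_Mapping.lookup D (Q k) = c k)"
proof
  assume "D = (\<Sum>k=0..n. frag_cmul (c k) (frag_of (Q k)))"
  then show "\<forall>k\<le>n. Poly_Mapping.lookup D (Q k) = c k" using lookup_sum_Q by blast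
next
  assume c: "\<forall>k\<le>n. Poly_Mapping.lookup D (Q k) = c k"
  show "D = (\<Sum>k=0..n. frag_cmul (c k) (frag_of (Q k)))" (is "D = ?E")
  proof (rule poly_mapping_eqI)
    fix P
    show "Poly_Mapping.lookup D P = Poly_Mapping.lookup ?E P"
    proof (cases "P \<in> Q ` {0..n}")
      case True
      then obtain k where "k \<le> n" "P = Q k" by auto
      then show ?thesis using c lookup_sum_Q by simp
    next
      case False
      then have "P \<notin> Poly_Mapping.keys D" "P \<notin> Poly_Mapping.keys ?E" using D keys_sum_Q by blast+
      then show ?thesis by (simp add: in_keys_iff)
    qed
  qed
qed

text \<open>Adding \<open>j < m\<close> carries over into the quotient by \<open>m\<close> exactly
  if \<open>r k \<ge> m - j\<close>. At infinity \<open>- n j\<close> is written as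
  \<open>- n m + n (m - j)\<close>; the resulting \<open>- n\<close> cancels the \<open>n\<close>
  ones produced by counting the places without a carry.\<close>

lemma slope_decompose:
  assumes d: "\<And>k. k \<le> n \<Longrightarrow> Poly_Mapping.lookup D (Q k) = int m * J k + r k"
    and r: "\<And>k. k \<le> n \<Longrightarrow> 0 \<le> r k \<and> r k < int m" and j: "j < m"
  shows "slope D j = (\<Sum>k=0..n. J k) + (r 0 + int n * (int m - int j)) div int m - int (count_below n r (int m - int j))"
proof -
  have m0: "int m \<noteq> 0" using j by simp
  have div_add: "(int m * b + c) div int m = b + c div int m" for b c using m0 by simp
  have "Poly_Mapping.lookup D (Q 0) - int n * int j = int m * (J 0 - int n) + (r 0 + int n * (int m - int j))"
    using d[of 0] by (simp add: algebra_simps)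
  then have 1: "(Poly_Mapping.lookup D (Q 0) - int n * int j) div int m = J 0 - int n + (r 0 + int n * (int m - int j)) div int m"
    by (simp only: div_add)
  have 2: "(Poly_Mapping.lookup D (Q k) + int j) div int m = J k + 1 - (if r k < int m - int j then 1 else 0)"
    if k: "k \<in> {1..n}" for k
  proof -
    have "(r k + int j) div int m = 1 - (if r k < int m - int j then 1 else 0)"
    proof (cases "r k < int m - int j")
      case True
      then show ?thesis using r[of k] k by (simp add: div_pos_pos_trivial)
    next
      case False
      then have "(r k + int j) div int m = (int m * 1 + (r k + int j - int m)) div int m" by simp
      also have "\<dots> = 1 + (r k + int j - int m) div int m" by (rule div_add)
      also have "(r k + int j - int m) div int m = 0" using False r[of k] k j by (intro div_pos_pos_trivial) auto
      finally show ?thesis using False by simp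
    qed
    moreover have "Poly_Mapping.lookup D (Q k) + int j = int m * J k + (r k + int j)" using d k by simp
    ultimately show ?thesis by (simp only: div_add)
  qed
  have "(\<Sum>k=1..n. (if r k < int m - int j then 1 else 0 :: int)) = int (count_below n r (int m - int j))"
    unfolding count_below_def by (simp add: sum.If_cases Int_def conj_commute)
  then have "(\<Sum>k=1..n. (Poly_Mapping.lookup D (Q k) + int j) div int m)
      = (\<Sum>k=1..n. J k) + int n - int (count_below n r (int m - int j))"
    using 2 by (simp add: sum.distrib sum_subtractf)
  moreover have "{0..n} = insert 0 {1..n}" by auto
  then have "(\<Sum>k=0..n. J k) = J 0 + (\<Sum>k=1..n. J k)" by simp
  ultimately show ?thesis unfolding slope_def 1 by linarith
qed

lemma all_slopes_iff:
  assumes d: "\<And>k. k \<le> n \<Longrightarrow> Poly_Mapping.lookup D (Q k) = int m * J k + r k"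
    and r: "\<And>k. k \<le> n \<Longrightarrow> 0 \<le> r k \<and> r k < int m"
  shows "(\<forall>j<m. slope D j = -1) \<longleftrightarrow>
    (\<Sum>k=0..n. J k) = -1 \<and> (\<exists>\<sigma>. \<sigma> permutes {1..n} \<and> (\<forall>k\<in>{1..n}. r k = tuple_entry m n (r 0) (\<sigma> k)))"
proof -
  have m0: "m > 0" and n0: "n > 0" using m degree_f by auto
  have r0: "0 \<le> r 0" "r 0 < int m" using r[of 0] by auto
  have top: "(r 0 + int n * int m) div int m = int n" by (rule mn_div[OF m0 n0 r0])
  have cbm: "count_below n r (int m) = n" by (rule count_below_m[OF m0 n0 r0]) (use r in auto)
  have slope: "slope D j = (\<Sum>k=0..n. J k) + (r 0 + int n * (int m - int j)) div int m - int (count_below n r (int m - int j))"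
    if "j < m" for j using slope_decompose[OF d r that] by blast
  have "(\<forall>j<m. slope D j = -1) \<longleftrightarrow> (\<Sum>k=0..n. J k) = -1 \<and> (\<forall>i\<in>{1..int m}. int (count_below n r i) = (r 0 + int n * i) div int m)"
  proof (intro iffI conjI ballI allI impI)
    assume *: "\<forall>j<m. slope D j = -1"
    \<comment> \<open>For \<open>j = 0\<close> the floor and the count both equal \<open>n\<close>,
      and the condition reduces to the sum of the \<open>J k\<close>; this sum then cancels in the
      conditions for the other \<open>j\<close>.\<close>
    then have "slope D 0 = -1" using m0 by blast
    then show J: "(\<Sum>k=0..n. J k) = -1" using slope[OF m0] top cbm by simp
    fix i assume i: "i \<in> {1..int m}"
    define j where "j = nat (int m - i)"
    have j: "j < m" "int m - int j = i" using i m0 by (auto simp: j_def)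
    show "int (count_below n r i) = (r 0 + int n * i) div int m"
      using slope[OF j(1)] * j(1) J unfolding j(2) by simp
  next
    fix j assume *: "(\<Sum>k=0..n. J k) = -1 \<and> (\<forall>i\<in>{1..int m}. int (count_below n r i) = (r 0 + int n * i) div int m)" and j: "j < m"
    then have "int m - int j \<in> {1..int m}" by auto
    with * have "int (count_below n r (int m - int j)) = (r 0 + int n * (int m - int j)) div int m" by blast
    then show "slope D j = -1" using slope[OF j] * by simp
  qed
  also have "(\<forall>i\<in>{1..int m}. int (count_below n r i) = (r 0 + int n * i) div int m) \<longleftrightarrow>
      (\<exists>\<sigma>. \<sigma> permutes {1..n} \<and> (\<forall>k\<in>{1..n}. r k = tuple_entry m n (r 0) (\<sigma> k)))"
    by (rule permuted_tuple_iff[OF m0 n0 r0]) (use r in auto)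
  finally show ?thesis .
qed

lemma tuple_entry_bounds:
  assumes "0 \<le> a" "a \<le> int m - 1" "\<sigma> permutes {1..n}" "k \<in> {1..n}"
  shows "0 \<le> tuple_entry m n a (\<sigma> k) \<and> tuple_entry m n a (\<sigma> k) < int m"
proof -
  have "\<sigma> k \<in> {1..n}" using permutes_in_image[OF assms(3), of k] assms(4) by blast
  then show ?thesis using tuple_entry_range[of m n a "\<sigma> k"] m degree_f assms(1,2) by auto
qed

lemma all_slopes_iff_tuple:
  "(\<forall>j<m. slope D j = -1) \<longleftrightarrow> (\<exists>a J \<sigma>. 0 \<le> a \<and> a \<le> int m - 1 \<and> (\<Sum>k=0..n. J k) = -1 \<and> \<sigma> permutes {1..n} \<and>
    (\<forall>k\<le>n. Poly_Mapping.lookup D (Q k) = int m * J k + (if k = 0 then a else tuple_entry m n a (\<sigma> k))))" (is "?L \<longleftrightarrow> ?R")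
proof
  assume L: ?L
  define J where "J k = Poly_Mapping.lookup D (Q k) div int m" for k
  define r where "r k = Poly_Mapping.lookup D (Q k) mod int m" for k
  have d: "Poly_Mapping.lookup D (Q k) = int m * J k + r k" for k by (simp add: J_def r_def)
  have r: "0 \<le> r k \<and> r k < int m" for k using m by (simp add: r_def)
  obtain \<sigma> where "(\<Sum>k=0..n. J k) = -1" "\<sigma> permutes {1..n}" "\<forall>k\<in>{1..n}. r k = tuple_entry m n (r 0) (\<sigma> k)"
    using L all_slopes_iff[of D J r, OF d r] by blast
  moreover from this(3) have "\<forall>k\<le>n. Poly_Mapping.lookup D (Q k) = int m * J k + (if k = 0 then r 0 else tuple_entry m n (r 0) (\<sigma> k))"
    using d by auto
  ultimately show ?R using r[of 0] by (intro exI[of _ "r 0"] exI[of _ J] exI[of _ \<sigma>]) auto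
next
  assume ?R
  then obtain a J \<sigma> where a: "0 \<le> a" "a \<le> int m - 1" and J: "(\<Sum>k=0..n. J k) = -1" and \<sigma>: "\<sigma> permutes {1..n}"
    and d: "\<forall>k\<le>n. Poly_Mapping.lookup D (Q k) = int m * J k + (if k = 0 then a else tuple_entry m n a (\<sigma> k))" by blast
  define r where "r k = (if k = 0 then a else tuple_entry m n a (\<sigma> k))" for k
  have "0 \<le> r k \<and> r k < int m" if "k \<le> n" for k
    using tuple_entry_bounds[OF a \<sigma>, of k] a that by (auto simp: r_def)
  moreover have "\<forall>k\<in>{1..n}. r k = tuple_entry m n (r 0) (\<sigma> k)" by (simp add: r_def)
  ultimately show ?L using J \<sigma> d by (subst all_slopes_iff[of D J r]) (auto simp: r_def)
qed

section \<open>The genus and the criterion for non-special divisors\<close>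

lemma genus_eq: "genus emb = curve_genus"
  unfolding genus_def
proof (rule Greatest_equality)
  \<comment> \<open>The solution with \<open>a = 0\<close>, the identity permutation and the whole
    sum \<open>-1\<close> placed at infinity. It has no nonzero functions and degree
    \<open>curve_genus - 1\<close>, so it attains equality in Riemann's inequality.\<close>
  define c where "c k = (if k = 0 then - int m else tuple_entry m n 0 k)" for k
  define D where "D = (\<Sum>k=0..n. frag_cmul (c k) (frag_of (Q k)))"
  have keys: "Poly_Mapping.keys D \<subseteq> Q ` {0..n}" unfolding D_def by (rule keys_sum_Q)
  have "\<forall>k\<le>n. Poly_Mapping.lookup D (Q k) = int m * (if k = 0 then - 1 else 0) + (if k = 0 then 0 else tuple_entry m n 0 (id k))"
    unfolding D_def using lookup_sum_Q[of _ c] by (simp add: c_def)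
  moreover have "(\<Sum>k=0..n. if k = 0 then - 1 else 0 :: int) = -1" by simp
  ultimately have "\<forall>j<m. slope D j = -1"
    unfolding all_slopes_iff_tuple using m permutes_id[of "{1..n}"]
    by (intro exI[of _ 0] exI[of _ "\<lambda>k. if k = 0 then - 1 else 0"] exI[of _ id]) simp
  then have "ell emb D = 0" "div_degree emb D = curve_genus - 1" using trivial_of_degree_iff[OF keys] by auto
  moreover have "divisor emb D" using keys Q_places' by (auto simp: divisor_def)
  ultimately show "\<exists>A. divisor emb A \<and> curve_genus = div_degree emb A - int (ell emb A) + 1"
    by (intro exI[of _ D]) simp
next
  fix g assume "\<exists>A. divisor emb A \<and> g = div_degree emb A - int (ell emb A) + 1"
  then show "g \<le> curve_genus" using riemann_inequality by fastforce
qed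

text \<open>In degree one less than the genus, being non-special means having no nonzero
  functions.\<close>

lemma nonspecial_iff:
  assumes D: "Poly_Mapping.keys D \<subseteq> Q ` {0..n}"
  shows "nonspecial emb D \<and> div_degree emb D = genus emb - 1 \<longleftrightarrow>
    (\<exists>a J \<sigma>. 0 \<le> a \<and> a \<le> int m - 1 \<and> (\<Sum>k=0..n. J k) = -1 \<and> \<sigma> permutes {1..n} \<and>
      D = (\<Sum>k=0..n. frag_cmul (int m * J k + (if k = 0 then a else tuple_entry m n a (\<sigma> k))) (frag_of (Q k))))"
proof -
  have "nonspecial emb D \<and> div_degree emb D = genus emb - 1 \<longleftrightarrow> ell emb D = 0 \<and> div_degree emb D = curve_genus - 1"
    by (auto simp: nonspecial_def genus_eq)
  then show ?thesis by (simp only: trivial_of_degree_iff[OF D] all_slopes_iff_tuple eq_sum_Q_iff[OF D])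
qed

lemma sum_Q_combine:
  "(\<Sum>k=0..n. frag_cmul (int m * J k) (frag_of (Q k))) + frag_cmul a (frag_of (Q 0)) + (\<Sum>k=1..n. frag_cmul (b k) (frag_of (Q k)))
    = (\<Sum>k=0..n. frag_cmul (int m * J k + (if k = 0 then a else b k)) (frag_of (Q k)))"
proof -
  have "{0..n} = insert 0 {1..n}" by auto
  then have s: "(\<Sum>k=0..n. h k) = h 0 + (\<Sum>k=1..n. h k)" for h :: "nat \<Rightarrow> 'a set \<Rightarrow>\<^sub>0 int" by simp
  have "(\<Sum>k=1..n. frag_cmul (int m * J k + (if k = 0 then a else b k)) (frag_of (Q k)))
      = (\<Sum>k=1..n. frag_cmul (int m * J k) (frag_of (Q k)) + frag_cmul (b k) (frag_of (Q k)))"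
    by (intro sum.cong refl) (auto simp: frag_cmul_distrib)
  then show ?thesis unfolding s by (simp add: frag_cmul_distrib sum.distrib add_ac)
qed

end

lemma (in curve) root_of_zero:
  assumes P: "P \<in> places emb" and x: "x \<in> ring_at P"
  shows "ev (\<Prod>a\<in>#A. [:- a, 1:]) \<in> P \<Longrightarrow> \<exists>a\<in>#A. ev [:- a, 1:] \<in> P"
proof (induction A)
  case empty
  interpret place emb P by unfold_locales (rule P)
  show ?case using empty by simp
next
  case (add a A)
  interpret place emb P by unfold_locales (rule P)
  have "ev [:- a, 1:] * ev (\<Prod>a\<in>#A. [:- a, 1:]) \<in> P" using add.prems by (simp only: image_mset_add_mset prod_mset.add_mset eval1_mult)
  then have "ev [:- a, 1:] \<in> P \<or> ev (\<Prod>a\<in>#A. [:- a, 1:]) \<in> P" by (rule prime_ideal) (rule eval1_in_ring[OF x])+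
  then show ?case using add.IH by (auto simp del: eval1_pCons)
qed

theorem theorem4p2:
  fixes emb :: "'k::{field,finite} \<Rightarrow> 'a::field"
    and x y :: 'a
    and f :: "'k poly"
    and m n q :: nat
    and Q :: "nat \<Rightarrow> 'a set"
    and D :: "'a set \<Rightarrow>\<^sub>0 int"
  assumes "CARD('k) = q"
    and "m \<ge> 2" and "\<not> CHAR('k) dvd m"
    and "coprime f (pderiv f)"
    and "degree f = n" and "2 \<le> n" and "n \<le> q" and "coprime m n"
    and "\<exists>c A. f = smult c (\<Prod>a\<in>#A. [:- a, 1:])"
    and "is_function_field_of_curve emb x y m f"
    and "{P \<in> places emb. val P x < 0} = {Q 0}"
    and "bij_betw Q {1..n}
           {P \<in> places emb. place_degree emb P = 1 \<and> val P (eval1 emb x f) > 0}"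
    and "divisor emb D" and "Poly_Mapping.keys D \<subseteq> Q ` {0..n}"
  shows "(nonspecial emb D \<and> div_degree emb D = genus emb - 1 \<longleftrightarrow>
           (\<exists>\<alpha>\<^sub>0 j \<sigma> \<alpha>. 0 \<le> \<alpha>\<^sub>0 \<and> \<alpha>\<^sub>0 \<le> int m - 1 \<and> (\<Sum>k=0..n. j k) = -1 \<and>
              \<sigma> permutes {1..n} \<and> multiplicity_tuple m n \<alpha>\<^sub>0 \<alpha> \<and>
              D = (\<Sum>k=0..n. frag_cmul (int m * j k) (frag_of (Q k)))
                  + frag_cmul \<alpha>\<^sub>0 (frag_of (Q 0))
                  + (\<Sum>k=1..n. frag_cmul (\<alpha> (\<sigma> k)) (frag_of (Q k)))))
       \<and> (n < m \<longrightarrow>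
           (nonspecial emb D \<and> div_degree emb D = genus emb - 1 \<longleftrightarrow>
             (\<exists>\<alpha>\<^sub>0 j \<sigma>. 0 \<le> \<alpha>\<^sub>0 \<and> \<alpha>\<^sub>0 \<le> int m - 1 \<and> (\<Sum>k=0..n. j k) = -1 \<and>
                \<sigma> permutes {1..n} \<and>
                D = (\<Sum>k=0..n. frag_cmul (int m * j k) (frag_of (Q k)))
                    + frag_cmul \<alpha>\<^sub>0 (frag_of (Q 0))
                    + (\<Sum>k=1..n. frag_cmul
                         (\<lceil>(of_nat k * of_nat m - of_int \<alpha>\<^sub>0) / of_nat n :: real\<rceil> - 1)
                         (frag_of (Q (\<sigma> k)))))))"
proof -
  interpret curve emb x y m f
    by unfold_locales (use assms in \<open>auto simp: is_function_field_of_curve_def\<close>)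
  have Q0: "Q 0 \<in> places emb" "val (Q 0) x < 0" using assms(11) by blast+
  interpret curve_at_infinity emb x y m f "Q 0"
    by unfold_locales (use assms(11) Q0 in blast)+
  have inj: "inj_on Q {1..degree f}"
    and Q: "\<And>k. k \<in> {1..degree f} \<Longrightarrow> Q k \<in> places emb \<and> val (Q k) (ev f) > 0"
    using assms(12) unfolding assms(5)[symmetric] bij_betw_def by blast+
  obtain c A where f: "f = smult c (\<Prod>a\<in>#A. [:- a, 1:])" using assms(9) by blast
  \<comment> \<open>Because \<open>f\<close> is a product of linear factors and \<open>Q k\<close>
    is a prime ideal, a zero of \<open>f\<close> at \<open>Q k\<close> is a zero of one of these
    factors.\<close>
  have "\<exists>a. poly f a = 0 \<and> val (Q k) (ev [:- a, 1:]) > 0" if k: "k \<in> {1..degree f}" for k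
  proof -
    interpret p: discrete_place emb "Q k" using discrete_place Q[OF k] by blast
    have "Q k \<noteq> Q 0" using Q[OF k] val_ev_infinity[OF f_nonzero] by (auto simp: mult_less_0_iff)
    then have x: "x \<in> ring_at (Q k)" using finite_place_iff Q[OF k] by blast
    have c: "c \<noteq> 0" using f f_nonzero by auto
    have "ev f \<in> Q k" using Q[OF k] p.val_pos_iff[of "ev f"] by simp
    then have "emb c * ev (\<Prod>a\<in>#A. [:- a, 1:]) \<in> Q k" using f by (simp add: eval1_smult)
    then have "ev (\<Prod>a\<in>#A. [:- a, 1:]) \<in> Q k" using p.prime_ideal p.eval1_in_ring[OF x] p.ring_emb p.emb_in_P_iff c by blast
    then obtain a where a: "a \<in># A" "ev [:- a, 1:] \<in> Q k" using root_of_zero[OF _ x] Q[OF k] by blast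
    have "[:- a, 1:] dvd (\<Prod>a\<in>#A. [:- a, 1:])" using a(1) by (intro dvd_prod_mset) auto
    then have "poly f a = 0" unfolding f poly_smult using poly_eq_0_iff_dvd by auto
    moreover have "ev [:- a, 1:] \<noteq> 0" by (simp only: ev_eq_0_iff) simp
    ultimately show ?thesis using a(2) p.val_pos_iff by blast
  qed
  then have "\<forall>k\<in>{1..degree f}. \<exists>a. poly f a = 0 \<and> val (Q k) (ev [:- a, 1:]) > 0" by blast
  from bchoice[OF this] obtain root
    where root: "\<And>k. k \<in> {1..degree f} \<Longrightarrow> poly f (root k) = 0 \<and> val (Q k) (ev [:- root k, 1:]) > 0" by blast
  \<comment> \<open>Each \<open>x - a\<close> with a root \<open>a\<close> of \<open>f\<close> has
    only one zero, so different places lie over different roots.\<close>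
  have "inj_on root {1..degree f}"
  proof (rule inj_onI)
    fix k l assume kl: "k \<in> {1..degree f}" "l \<in> {1..degree f}" "root k = root l"
    have "val (Q l) (ev [:- root k, 1:]) > 0" unfolding kl(3) using root[OF kl(2)] by blast
    then have "Q l = Q k" using zero(4)[of "Q k" "root k" "Q l"] root[OF kl(1)] Q[OF kl(1)] Q[OF kl(2)] by blast
    then show "k = l" using inj kl by (auto simp: inj_on_eq_iff)
  qed
  then interpret split_curve emb x y m f "Q 0" Q root
    by unfold_locales (use Q root inj in blast)+
  have keys: "Poly_Mapping.keys D \<subseteq> Q ` {0..degree f}" using assms(14) by (simp only: assms(5))
  have m0: "m > 0" and n0: "degree f > 0" using m degree_f by auto
  have tuple: "multiplicity_tuple m (degree f) a \<alpha> \<longleftrightarrow> (\<forall>k\<in>{1..degree f}. \<alpha> k = tuple_entry m (degree f) a k)"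
    if "0 \<le> a" "a \<le> int m - 1" for a \<alpha>
    using multiplicity_tuple_iff[OF m0 n0 that(1) _ m, of \<alpha>] that(2) by simp
  have cong: "(\<Sum>k=1..degree f. frag_cmul (\<alpha> (\<sigma> k)) (frag_of (Q k))) = (\<Sum>k=1..degree f. frag_cmul (tuple_entry m (degree f) a (\<sigma> k)) (frag_of (Q k)))"
    if "\<sigma> permutes {1..degree f}" "\<forall>k\<in>{1..degree f}. \<alpha> k = tuple_entry m (degree f) a k" for \<alpha> \<sigma> a
    using that permutes_in_image[OF that(1)] by (intro sum.cong refl) auto
  \<comment> \<open>Permuting the places instead of the entries amounts to passing to the inverse
    permutation.\<close>
  have reindex: "(\<Sum>k=1..degree f. frag_cmul (tuple_entry m (degree f) a k) (frag_of (Q (\<sigma> k))))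
      = (\<Sum>k=1..degree f. frag_cmul (tuple_entry m (degree f) a (inv \<sigma> k)) (frag_of (Q k)))"
    if \<sigma>: "\<sigma> permutes {1..degree f}" for \<sigma> a
    using sum.permute[OF \<sigma>, of "\<lambda>k. frag_cmul (tuple_entry m (degree f) a (inv \<sigma> k)) (frag_of (Q k))"]
    by (simp add: comp_def permutes_inverses(2)[OF \<sigma>])
  note iff = nonspecial_iff[OF keys, folded sum_Q_combine]
  note entry = tuple_entry_conv_ceiling[OF n0, symmetric]
  let ?base = "\<lambda>a J. (\<Sum>k=0..degree f. frag_cmul (int m * J k) (frag_of (Q k))) + frag_cmul a (frag_of (Q 0))"
  let ?D = "\<lambda>a J \<sigma>. ?base a J + (\<Sum>k=1..degree f. frag_cmul (tuple_entry m (degree f) a (\<sigma> k)) (frag_of (Q k)))"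
  let ?ok = "\<lambda>a J \<sigma>. 0 \<le> a \<and> a \<le> int m - 1 \<and> (\<Sum>k=0..degree f. J k) = -1 \<and> \<sigma> permutes {1..degree f}"
  show ?thesis
    unfolding assms(5)[symmetric] iff entry
  proof (intro conjI impI iffI)
    assume "\<exists>a J \<sigma>. 0 \<le> a \<and> a \<le> int m - 1 \<and> (\<Sum>k=0..degree f. J k) = -1 \<and> \<sigma> permutes {1..degree f} \<and> D = ?D a J \<sigma>"
    then obtain a J \<sigma> where *: "?ok a J \<sigma>" "D = ?D a J \<sigma>" by blast
    then have "multiplicity_tuple m (degree f) a (tuple_entry m (degree f) a)" using tuple by blast
    with * show "\<exists>a J \<sigma> \<alpha>. 0 \<le> a \<and> a \<le> int m - 1 \<and> (\<Sum>k=0..degree f. J k) = -1 \<and>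
        \<sigma> permutes {1..degree f} \<and> multiplicity_tuple m (degree f) a \<alpha> \<and>
        D = ?base a J + (\<Sum>k=1..degree f. frag_cmul (\<alpha> (\<sigma> k)) (frag_of (Q k)))" by blast
  next
    assume "\<exists>a J \<sigma> \<alpha>. 0 \<le> a \<and> a \<le> int m - 1 \<and> (\<Sum>k=0..degree f. J k) = -1 \<and>
        \<sigma> permutes {1..degree f} \<and> multiplicity_tuple m (degree f) a \<alpha> \<and>
        D = ?base a J + (\<Sum>k=1..degree f. frag_cmul (\<alpha> (\<sigma> k)) (frag_of (Q k)))"
    then obtain a J \<sigma> \<alpha> where *: "?ok a J \<sigma>" "multiplicity_tuple m (degree f) a \<alpha>"
      and D: "D = ?base a J + (\<Sum>k=1..degree f. frag_cmul (\<alpha> (\<sigma> k)) (frag_of (Q k)))" by blast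
    have "\<forall>k\<in>{1..degree f}. \<alpha> k = tuple_entry m (degree f) a k" using * tuple by blast
    then have "D = ?D a J \<sigma>" using D cong[of \<sigma> \<alpha> a] * by (simp only:)
    with * show "\<exists>a J \<sigma>. 0 \<le> a \<and> a \<le> int m - 1 \<and> (\<Sum>k=0..degree f. J k) = -1 \<and> \<sigma> permutes {1..degree f} \<and> D = ?D a J \<sigma>"
      by blast
  next
    assume "\<exists>a J \<sigma>. 0 \<le> a \<and> a \<le> int m - 1 \<and> (\<Sum>k=0..degree f. J k) = -1 \<and> \<sigma> permutes {1..degree f} \<and> D = ?D a J \<sigma>"
    then obtain a J \<sigma> where *: "?ok a J \<sigma>" and D: "D = ?D a J \<sigma>" by blast
    then have \<sigma>: "\<sigma> permutes {1..degree f}" by blast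
    note \<sigma>' = permutes_inv[OF \<sigma>]
    have "D = ?base a J + (\<Sum>k=1..degree f. frag_cmul (tuple_entry m (degree f) a k) (frag_of (Q (inv \<sigma> k))))"
      unfolding reindex[OF \<sigma>'] permutes_inv_inv[OF \<sigma>] by (rule D)
    with * \<sigma>' show "\<exists>a J \<sigma>. 0 \<le> a \<and> a \<le> int m - 1 \<and> (\<Sum>k=0..degree f. J k) = -1 \<and> \<sigma> permutes {1..degree f} \<and>
        D = ?base a J + (\<Sum>k=1..degree f. frag_cmul (tuple_entry m (degree f) a k) (frag_of (Q (\<sigma> k))))" by blast
  next
    assume "\<exists>a J \<sigma>. 0 \<le> a \<and> a \<le> int m - 1 \<and> (\<Sum>k=0..degree f. J k) = -1 \<and> \<sigma> permutes {1..degree f} \<and>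
        D = ?base a J + (\<Sum>k=1..degree f. frag_cmul (tuple_entry m (degree f) a k) (frag_of (Q (\<sigma> k))))"
    then obtain a J \<sigma> where *: "?ok a J \<sigma>"
      and D: "D = ?base a J + (\<Sum>k=1..degree f. frag_cmul (tuple_entry m (degree f) a k) (frag_of (Q (\<sigma> k))))" by blast
    then have \<sigma>: "\<sigma> permutes {1..degree f}" by blast
    have "D = ?D a J (inv \<sigma>)" using D unfolding reindex[OF \<sigma>] .
    with * permutes_inv[OF \<sigma>]
    show "\<exists>a J \<sigma>. 0 \<le> a \<and> a \<le> int m - 1 \<and> (\<Sum>k=0..degree f. J k) = -1 \<and> \<sigma> permutes {1..degree f} \<and> D = ?D a J \<sigma>"
      by blast
  qed
qed

end
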